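(* Let $n\ge1$, $a<b$, and let $\gamma:[a,b]\to\mathbb{R}^n$, $\gamma\in C([a,b])\cap C^n((a,b))$, be a curve with totally positive torsion. If $n=2\ell$ then $$\mathrm{Vol}(\mathrm{conv}(\gamma([a,b])))=\frac{(-1)^{\frac{\ell(\ell-1)}{2}}}{(2\ell)!}\int_{a\le x_1\le\dots\le x_\ell\le b}\det(\gamma(x_1)-\gamma(a),\dots,\gamma(x_\ell)-\gamma(a),\gamma'(x_1),\dots,\gamma'(x_\ell))\,dx$$ $$=\frac{(-1)^{\frac{\ell(\ell-1)}{2}}}{(2\ell)!}\int_{a\le x_1\le\dots\le x_\ell\le b}\det(\gamma(x_1)-\gamma(b),\dots,\gamma(x_\ell)-\gamma(b),\gamma'(x_1),\dots,\gamma'(x_\ell))\,dx.$$ If $n=2\ell-1$ then $$\mathrm{Vol}(\mathrm{conv}(\gamma([a,b])))=\frac{(-1)^{\frac{(\ell-1)(\ell-2)}{2}}}{(2\ell-1)!}\int_{a\le x_2\le\dots\le x_\ell\le b}\det(\gamma(b)-\gamma(a),\gamma(x_2)-\gamma(a),\dots,\gamma(x_\ell)-\gamma(a),\gamma'(x_2),\dots,\gamma'(x_\ell))\,dx$$ $$=\frac{(-1)^{\frac{\ell(\ell-1)}{2}}}{(2\ell-1)!}\int_{a\le x_1\le\dots\le x_\ell\le b}\det(\gamma(x_2)-\gamma(x_1),\dots,\gamma(x_\ell)-\gamma(x_1),\gamma'(x_1),\dots,\gamma'(x_\ell))\,dx.$$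
   Context: A curve $\gamma\in C([a,b],\mathbb{R}^{n})\cap C^{n}((a,b),\mathbb{R}^{n})$ has totally positive torsion if for every $t\in(a,b)$ all leading principal minors of the $n\times n$ matrix with columns $(\gamma'(t),\gamma''(t),\dots,\gamma^{(n)}(t))$ are positive. $\mathrm{conv}$ is convex hull, $\mathrm{Vol}$ is $n$-dimensional Lebesgue measure, $dx$ is Lebesgue measure in the indicated variables, and vectors inside a determinant are its columns. When $\ell=1$ and $n=1$, the integral over the empty set of variables $x_2,\dots,x_\ell$ is understood as the value of the integrand, $\gamma(b)-\gamma(a)$. *)

theory Defs
  imports
    "HOL-Analysis.Analysis"
    "Jordan_Normal_Form.Determinant"
    "Jordan_Normal_Form.DL_Submatrix"
begin

(* Points of R^n are elements of real^'n with 'n finite and linearly ordered: leading principal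
   minors depend on the order of the coordinates, and coord i is the i-th index in increasing
   order, counted from 0 as in the matrices of Jordan_Normal_Form. *)
definition coord :: "nat \<Rightarrow> 'n::{finite,linorder}" where
  "coord i = sorted_list_of_set UNIV ! i"

definition mat_with_cols :: "(real, 'n::{finite,linorder}) Finite_Cartesian_Product.vec list \<Rightarrow> real mat" where
  "mat_with_cols vs =
     Matrix.mat CARD('n) (length vs) (\<lambda>(i, j). vec_nth (vs ! j) (coord i))"

definition nth_vector_derivative :: "nat \<Rightarrow> (real \<Rightarrow> 'a::real_normed_vector) \<Rightarrow> real \<Rightarrow> 'a" where
  "nth_vector_derivative k f = ((\<lambda>g t. vector_derivative g (at t)) ^^ k) f"

(* Intended for open S, since the derivatives are two-sided. *)
definition C_k_on :: "nat \<Rightarrow> (real \<Rightarrow> 'a::real_normed_vector) \<Rightarrow> real set \<Rightarrow> bool" where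
  "C_k_on k f S \<longleftrightarrow>
     (\<forall>i<k. \<forall>t\<in>S. nth_vector_derivative i f differentiable (at t)) \<and>
     (\<forall>i\<le>k. continuous_on S (nth_vector_derivative i f))"

definition torsion_matrix :: "(real \<Rightarrow> real^'n::{finite,linorder}) \<Rightarrow> real \<Rightarrow> real mat" where
  "torsion_matrix \<gamma> t =
     mat_with_cols (map (\<lambda>j. nth_vector_derivative j \<gamma> t) [1..<Suc CARD('n)])"

definition totally_positive_torsion ::
    "(real \<Rightarrow> real^'n::{finite,linorder}) \<Rightarrow> real \<Rightarrow> real \<Rightarrow> bool" where
  "totally_positive_torsion \<gamma> a b \<longleftrightarrow>
     (\<forall>t\<in>{a<..<b}. \<forall>k\<in>{1..CARD('n)}.
        Determinant.det (submatrix (torsion_matrix \<gamma> t) {..<k} {..<k}) > 0)"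

definition ordered_tuples :: "nat set \<Rightarrow> real \<Rightarrow> real \<Rightarrow> (nat \<Rightarrow> real) set" where
  "ordered_tuples I a b =
     {x. (\<forall>i\<in>I. a \<le> x i \<and> x i \<le> b) \<and> (\<forall>i\<in>I. \<forall>j\<in>I. i \<le> j \<longrightarrow> x i \<le> x j)}"

(* Integration over a <= x_i <= ... <= x_j <= b, where I is the set of the indices i, ..., j.
   The product measure over the empty index set is a point mass, so for I = {} this is the value
   of the integrand. *)
definition ordered_integral ::
    "nat set \<Rightarrow> real \<Rightarrow> real \<Rightarrow> ((nat \<Rightarrow> real) \<Rightarrow> real) \<Rightarrow> real" where
  "ordered_integral I a b f = (LINT x:ordered_tuples I a b|(\<Pi>\<^sub>M i\<in>I. lborel). f x)"

end

theory Submission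
  imports Defs
begin

text \<open>
  The interior of the convex hull of a curve with totally positive torsion has an explicit
  one-to-one parametrization, and each of the four volume formulas is the change of variables formula
  for one such parametrization. Let \<open>n\<close> be the dimension. Choose a set of \<open>e\<close> fixed nodes among the
  two end points and \<open>k\<close> moving nodes \<open>x\<^sub>1 < \<dots> < x\<^sub>k\<close> in the open interval with \<open>2 k + e = n + 1\<close>.
  The four choices \<open>{a}\<close>, \<open>{b}\<close>, \<open>{a, b}\<close>, \<open>{}\<close> of fixed nodes give the four formulas. The
  parameters are the moving nodes and the positive weights of a convex combination of the points of
  the curve at all the nodes: \<open>k + (k + e - 1) = n\<close> real parameters.

  Why this is a parametrization. Total positivity of the torsion says that the derivatives of the
  coordinates have positive Wronskians. Hence \<open>(1, \<gamma>)\<close> is a Chebyshev system on the closed interval: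
  its determinants at \<open>n + 1\<close> increasing points are positive
  (\<open>dets_pos_of_wronskians_pos\<close>, \<open>dets_pos_of_derivative_pos\<close>). Two representations of the same point
  involve together at most \<open>e + 2 k = n + 1\<close> nodes, and so they coincide: the parametrization is
  injective and by invariance of domain it has an open image. When a parameter reaches the boundary
  of its domain, the combination uses nodes of total multiplicity at most \<open>n\<close>, where an
  interior node counts twice. An affine functional can be made to vanish there and to stay nonnegative
  on the whole curve, so that such a point lies on the boundary of the hull
  (\<open>hull_of_few_points_misses_interior\<close>). The image of the open domain is therefore open and closed in the
  interior of the hull, which is connected, and so it is the whole interior (\<open>U_image\<close>).

  The Jacobian determinant is the product of the weights of the moving nodes times a determinant that
  depends on the nodes only (\<open>jacobian_det\<close>). The sign of the latter is the sign of the permutation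
  that brings each column \<open>\<gamma>'(x\<^sub>i)\<close> next to the column of \<open>x\<^sub>i\<close> (\<open>coeff_det_sign\<close>). The
  integral factorizes: the weights contribute a Dirichlet integral, which is \<open>1 / n!\<close> in all the four
  cases, and the nodes contribute the integral in the statement (\<open>volume_formula\<close>).
\<close>

section \<open>Determinants as functions of their list of columns\<close>

no_notation Matrix.vec_index (infixl "$" 100)
no_notation Matrix.scalar_prod (infix "\<bullet>" 70)
hide_const (open) Determinants.det

text \<open>The size of the matrix is the length of the list; a column is a function on all natural numbers, of
  which only the entries below the size matter. Inserting, moving and replacing columns then are
  operations on lists.\<close>
definition dets :: "(nat \<Rightarrow> real) list \<Rightarrow> real" where
  "dets us = Determinant.det (Matrix.mat (length us) (length us) (\<lambda>(i, j). (us ! j) i))"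

definition skip :: "nat \<Rightarrow> (nat \<Rightarrow> 'a) \<Rightarrow> nat \<Rightarrow> 'a" where
  "skip i z = (\<lambda>r. z (if r < i then r else Suc r))"

text \<open>Laplace expansion along the column \<open>w\<close>. The cofactors depend on the remaining columns only and, up to
  the sign \<open>(-1) ^ length xs\<close>, not on the place of \<open>w\<close> among them. This makes the determinant a
  fixed linear form in \<open>w\<close> up to an explicit sign, from which everything else about
  \<open>dets\<close> follows.\<close>
lemma dets_expand:
  "dets (xs @ w # ys) =
    (\<Sum>i<Suc (length (xs @ ys)). (-1) ^ (i + length xs) * w i * dets (map (skip i) (xs @ ys)))"
proof -
  let ?N = "Suc (length (xs @ ys))"
  let ?A = "Matrix.mat ?N ?N (\<lambda>(i, j). ((xs @ w # ys) ! j) i)"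
  have "dets (xs @ w # ys) = Determinant.det ?A"
    by (simp add: dets_def)
  also have "\<dots> = (\<Sum>i<?N. ?A $$ (i, length xs) * cofactor ?A i (length xs))"
    by (rule laplace_expansion_column) auto
  also have "\<dots> = (\<Sum>i<?N. (-1) ^ (i + length xs) * w i * dets (map (skip i) (xs @ ys)))"
  proof (rule sum.cong[OF refl])
    fix i assume "i \<in> {..<?N}"
    then have i: "i < ?N" by simp
    have *: "mat_delete ?A i (length xs) =
        Matrix.mat (length (xs @ ys)) (length (xs @ ys)) (\<lambda>(r, c). (map (skip i) (xs @ ys) ! c) r)"
      by (rule eq_matI) (use i in \<open>auto simp: mat_delete_def skip_def nth_append nth_Cons'\<close>)
    show "?A $$ (i, length xs) * cofactor ?A i (length xs) =
        (-1) ^ (i + length xs) * w i * dets (map (skip i) (xs @ ys))"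
      using i unfolding cofactor_def * dets_def by (simp add: nth_append)
  qed
  finally show ?thesis .
qed

lemma dets_sum_column:
  assumes "finite S"
  shows "dets (xs @ (\<lambda>r. \<Sum>s\<in>S. c s * f s r) # ys) = (\<Sum>s\<in>S. c s * dets (xs @ f s # ys))"
proof -
  have "dets (xs @ (\<lambda>r. \<Sum>s\<in>S. c s * f s r) # ys) =
      (\<Sum>i<Suc (length (xs @ ys)). \<Sum>s\<in>S. c s * ((-1) ^ (i + length xs) * f s i * dets (map (skip i) (xs @ ys))))"
    unfolding dets_expand
    by (intro sum.cong refl) (simp add: sum_distrib_left sum_distrib_right mult_ac del: map_append)
  also have "\<dots> = (\<Sum>s\<in>S. c s * dets (xs @ f s # ys))"
    unfolding dets_expand by (subst sum.swap) (simp only: sum_distrib_left)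
  finally show ?thesis .
qed

lemma dets_scale: "dets (xs @ (\<lambda>r. c * f r) # ys) = c * dets (xs @ f # ys)"
  using dets_sum_column[of "{()}" xs "\<lambda>_. c" "\<lambda>_. f" ys] by simp

lemma dets_add: "dets (xs @ (\<lambda>r. f r + g r) # ys) = dets (xs @ f # ys) + dets (xs @ g # ys)"
  using dets_sum_column[of UNIV xs "\<lambda>_. 1" "\<lambda>s. if s then f else g" ys]
  by (simp add: UNIV_bool add.commute)

lemma dets_diff: "dets (xs @ (\<lambda>r. f r - g r) # ys) = dets (xs @ f # ys) - dets (xs @ g # ys)"
  using dets_add[of xs f "\<lambda>r. -1 * g r" ys] dets_scale[of xs "-1" g ys] by simp

lemma dets_repeated: "dets (xs @ w # ys @ w # zs) = 0"
proof -
  let ?us = "xs @ w # ys @ w # zs"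
  have i: "length xs < length ?us" "Suc (length xs + length ys) < length ?us" by auto
  have nth: "?us ! length xs = w" "?us ! Suc (length xs + length ys) = w"
    by (auto simp: nth_append)
  show ?thesis
    unfolding dets_def
    by (rule det_identical_columns[of _ "length ?us" "length xs" "Suc (length xs + length ys)"])
       (use i nth in \<open>auto intro!: eq_vecI simp del: length_append\<close>)
qed

lemma dets_not_distinct: "\<not> distinct us \<Longrightarrow> dets us = 0"
  using not_distinct_decomp[of us] dets_repeated by fastforce

lemma dets_swap: "dets (xs @ v # w # ys) = - dets (xs @ w # v # ys)"
proof -
  define s where "s = (\<lambda>r. v r + w r)"
  have split1: "dets (xs @ s # z # ys) = dets (xs @ v # z # ys) + dets (xs @ w # z # ys)" for z
    unfolding s_def by (rule dets_add)
  have "0 = dets (xs @ s # s # ys)" using dets_repeated[of xs s "[]" ys] by simp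
  also have "\<dots> = dets ((xs @ [s]) @ s # ys)" by simp
  also have "\<dots> = dets ((xs @ [s]) @ v # ys) + dets ((xs @ [s]) @ w # ys)"
    unfolding s_def by (rule dets_add)
  also have "\<dots> = dets (xs @ v # v # ys) + dets (xs @ w # v # ys)
      + (dets (xs @ v # w # ys) + dets (xs @ w # w # ys))"
    using split1 by simp
  also have "dets (xs @ v # v # ys) = 0" using dets_repeated[of xs v "[]" ys] by simp
  also have "dets (xs @ w # w # ys) = 0" using dets_repeated[of xs w "[]" ys] by simp
  finally show ?thesis by simp
qed

lemma dets_move: "dets (xs @ vs @ w # ys) = (-1) ^ length vs * dets (xs @ w # vs @ ys)"
proof (induction vs arbitrary: xs)
  case (Cons v vs)
  have "dets (xs @ (v # vs) @ w # ys) = (-1) ^ length vs * dets ((xs @ [v]) @ w # vs @ ys)"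
    using Cons[of "xs @ [v]"] by simp
  also have "dets ((xs @ [v]) @ w # vs @ ys) = - dets (xs @ w # (v # vs) @ ys)"
    using dets_swap[of xs v w "vs @ ys"] by simp
  finally show ?case by simp
qed simp

text \<open>Moving the first column of the second block past the rest of the first block costs
  \<open>length xs - 1\<close> transpositions, and so on, which adds up to \<open>k (k - 1) / 2\<close>. This is where the
  signs in the volume formulas come from.\<close>
lemma dets_interleave:
  "dets (L @ map f xs @ map g xs @ R) =
    (-1) ^ (length xs * (length xs - 1) div 2) * dets (L @ concat (map (\<lambda>x. [f x, g x]) xs) @ R)"
proof (induction xs arbitrary: L)
  case (Cons x xs)
  have "dets (L @ map f (x # xs) @ map g (x # xs) @ R)
      = dets ((L @ [f x]) @ map f xs @ g x # map g xs @ R)" by simp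
  also have "\<dots> = (-1) ^ length xs * dets ((L @ [f x, g x]) @ map f xs @ map g xs @ R)"
    by (subst dets_move) simp
  also have "\<dots> = (-1) ^ (length xs + length xs * (length xs - 1) div 2) *
      dets ((L @ [f x, g x]) @ concat (map (\<lambda>x. [f x, g x]) xs) @ R)"
    by (subst Cons) (simp add: power_add)
  also have "length xs + length xs * (length xs - 1) div 2 = length (x # xs) * (length (x # xs) - 1) div 2"
    by (cases "length xs") (auto simp: algebra_simps)
  finally show ?case by simp
qed simp

lemma dets_add_multiple:
  assumes "u \<in> set (xs @ ys)"
  shows "dets (xs @ (\<lambda>r. w r - c * u r) # ys) = dets (xs @ w # ys)"
proof -
  have "dets (xs @ u # ys) = 0"
  proof (rule dets_not_distinct)
    show "\<not> distinct (xs @ u # ys)" using assms by auto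
  qed
  then show ?thesis
    using dets_diff[of xs w "\<lambda>r. c * u r" ys] dets_scale[of xs c u ys] by simp
qed

lemma dets_scale_columns:
  "dets (L @ map (\<lambda>x r. c x * f x r) xs @ R) = prod_list (map c xs) * dets (L @ map f xs @ R)"
proof (induction xs arbitrary: L)
  case (Cons x xs)
  have "dets (L @ map (\<lambda>x r. c x * f x r) (x # xs) @ R)
      = c x * dets ((L @ [f x]) @ map (\<lambda>x r. c x * f x r) xs @ R)"
    by (simp add: dets_scale)
  also have "\<dots> = c x * (prod_list (map c xs) * dets ((L @ [f x]) @ map f xs @ R))"
    by (subst Cons) simp
  finally show ?case by simp
qed simp

lemma dets_subtract_first:
  "dets (u # L @ map (\<lambda>x r. f x r - u r) xs @ R) = dets (u # L @ map f xs @ R)"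
proof (induction xs arbitrary: L)
  case (Cons x xs)
  have "dets (u # L @ map (\<lambda>x r. f x r - u r) (x # xs) @ R)
      = dets ((u # L) @ (\<lambda>r. f x r - 1 * u r) # map (\<lambda>x r. f x r - u r) xs @ R)"
    by simp
  also have "\<dots> = dets (u # (L @ [f x]) @ map (\<lambda>x r. f x r - u r) xs @ R)"
    by (subst dets_add_multiple) auto
  also have "\<dots> = dets (u # (L @ [f x]) @ map f xs @ R)"
    by (rule Cons)
  finally show ?case by simp
qed simp

text \<open>Differences of adjacent columns, the form to which the mean value theorem applies.\<close>
fun diffs :: "('a \<Rightarrow> nat \<Rightarrow> real) \<Rightarrow> 'a list \<Rightarrow> (nat \<Rightarrow> real) list" where
  "diffs u (s # t # ts) = (\<lambda>r. u t r - u s r) # diffs u (t # ts)"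
| "diffs u ts = []"

lemma length_diffs: "length (diffs u ts) = length ts - 1"
  by (induction u ts rule: diffs.induct) auto

text \<open>Subtracting from each column its predecessor, starting with the last one, does not change the
  determinant.\<close>
lemma dets_diffs: "dets (L @ map u (t # ts)) = dets (L @ u t # diffs u (t # ts))"
proof (induction ts arbitrary: L t)
  case (Cons s ts)
  have "dets (L @ map u (t # s # ts)) = dets ((L @ [u t]) @ map u (s # ts))" by simp
  also have "\<dots> = dets ((L @ [u t]) @ u s # diffs u (s # ts))" by (rule Cons)
  also have "\<dots> = dets ((L @ [u t]) @ (\<lambda>r. u s r - 1 * u t r) # diffs u (s # ts))"
    by (rule dets_add_multiple[symmetric]) simp
  finally show ?case by simp
qed simp

lemma dets_border:
  assumes "u 0 = 1" "\<And>v. v \<in> set vs \<Longrightarrow> v 0 = 0"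
  shows "dets (u # vs) = dets (map (\<lambda>v r. v (Suc r)) vs)"
proof -
  let ?N = "Suc (length vs)"
  let ?A = "Matrix.mat ?N ?N (\<lambda>(i, j). ((u # vs) ! j) i)"
  have "dets (u # vs) = (\<Sum>j<?N. ?A $$ (0, j) * cofactor ?A 0 j)"
    unfolding dets_def by (subst laplace_expansion_row[of _ ?N 0]) auto
  also have "\<dots> = ?A $$ (0, 0) * cofactor ?A 0 0"
    unfolding sum.lessThan_Suc_shift by (simp add: assms(2))
  also have "\<dots> = cofactor ?A 0 0" using assms by simp
  also have "mat_delete ?A 0 0 = Matrix.mat (length vs) (length vs) (\<lambda>(i, j). (map (\<lambda>v r. v (Suc r)) vs ! j) i)"
    by (rule eq_matI) (auto simp: mat_delete_def)
  then have "cofactor ?A 0 0 = dets (map (\<lambda>v r. v (Suc r)) vs)"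
    by (simp add: cofactor_def dets_def)
  finally show ?thesis .
qed

section \<open>Positive Wronskians and Chebyshev systems\<close>

lemma dets_linear_form:
  obtains C where "\<And>w. dets (xs @ w # ys) = (\<Sum>i<Suc (length (xs @ ys)). C i * w i)"
proof
  show "dets (xs @ w # ys) = (\<Sum>i<Suc (length (xs @ ys)).
      ((-1) ^ (i + length xs) * dets (map (skip i) (xs @ ys))) * w i)" for w
    unfolding dets_expand by (simp add: mult_ac)
qed

text \<open>After passing to differences of adjacent columns, the first row is \<open>(1, 0, \<dots>, 0)\<close>. In each remaining
  column the mean value theorem, applied to the determinant as a function of the upper node, replaces
  the difference by the derivative at an intermediate point times the length of the interval. The
  intermediate points are increasing because the intervals are. Only continuity is used at the end
  points, so that the nodes may include \<open>a\<close> and \<open>b\<close>.\<close>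
lemma dets_pos_of_derivative_pos:
  fixes u u' :: "real \<Rightarrow> nat \<Rightarrow> real"
  assumes u0: "\<And>t. t \<in> {a..b} \<Longrightarrow> u t 0 = 1"
    and cont: "\<And>i. i \<le> n \<Longrightarrow> continuous_on {a..b} (\<lambda>t. u t i)"
    and der: "\<And>i t. i \<le> n \<Longrightarrow> t \<in> {a<..<b} \<Longrightarrow>
      ((\<lambda>t. u t i) has_real_derivative u' t i) (at t)"
    and pos: "\<And>ss. length ss = n \<Longrightarrow> sorted_wrt (<) ss \<Longrightarrow> set ss \<subseteq> {a<..<b} \<Longrightarrow>
      dets (map (\<lambda>s r. u' s (Suc r)) ss) > 0"
    and ts: "length ts = Suc n" "sorted_wrt (<) ts" "set ts \<subseteq> {a..b}"
  shows "dets (map u ts) > 0"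
proof -
  define w w' where "w = (\<lambda>t r. u t (Suc r))" and "w' = (\<lambda>t r. u' t (Suc r))"
  \<comment> \<open>\<open>L\<close> collects the intermediate points of the columns that are already differentiated.\<close>
  have key: "dets (map w' L @ diffs w (t # ts)) > 0"
    if "sorted_wrt (<) L" "set L \<subseteq> {a<..<b}" "\<forall>s\<in>set L. s \<le> t" "sorted_wrt (<) (t # ts)"
      "set (t # ts) \<subseteq> {a..b}" "length L + length ts = n" for L t ts
    using that
  proof (induction ts arbitrary: L t)
    case Nil
    then show ?case using pos[of L] by (simp add: w'_def)
  next
    case (Cons t2 ts)
    have t: "t < t2" "a \<le> t" "t2 \<le> b" using Cons.prems by auto
    obtain C where C: "\<And>v. dets (map w' L @ v # diffs w (t2 # ts)) =
        (\<Sum>i<Suc (length (map w' L @ diffs w (t2 # ts))). C i * v i)"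
      using dets_linear_form[of "map w' L" "diffs w (t2 # ts)"] by blast
    have len: "Suc (length (map w' L @ diffs w (t2 # ts))) = n"
      using Cons.prems(6) by (simp add: length_diffs)
    define \<phi> where "\<phi> s = (\<Sum>i<n. C i * (w s i - w t i))" for s
    have der\<phi>: "(\<phi> has_real_derivative (\<Sum>i<n. C i * w' s i)) (at s)" if "s \<in> {a<..<b}" for s
    proof -
      have *: "((\<lambda>s. w s i) has_real_derivative w' s i) (at s)" if "i < n" for i
        using der[of "Suc i" s] that \<open>s \<in> {a<..<b}\<close> unfolding w_def w'_def by simp
      have "((\<lambda>s. C i * (w s i - w t i)) has_real_derivative C i * w' s i) (at s)" if "i < n" for i
        using DERIV_cmult[OF DERIV_diff[OF *[OF that] DERIV_const[of "w t i"]], of "C i"] by simp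
      then show ?thesis unfolding \<phi>_def by (intro DERIV_sum) auto
    qed
    have cont\<phi>: "continuous_on {t..t2} \<phi>"
      unfolding \<phi>_def w_def
      by (intro continuous_intros continuous_on_subset[OF cont]) (use t in auto)
    have "\<exists>l s. t < s \<and> s < t2 \<and> DERIV \<phi> s :> l \<and> \<phi> t2 - \<phi> t = (t2 - t) * l"
      using t cont\<phi> der\<phi>
      by (intro MVT) (auto simp: real_differentiable_def, metis greaterThanLessThan_iff order_le_less_trans order_less_le_trans)
    then obtain l s where s: "t < s" "s < t2" "DERIV \<phi> s :> l" "\<phi> t2 - \<phi> t = (t2 - t) * l"
      by blast
    have sab: "s \<in> {a<..<b}" using s t by auto
    have l: "l = (\<Sum>i<n. C i * w' s i)" using DERIV_unique[OF s(3) der\<phi>[OF sab]] .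
    have "dets (map w' L @ diffs w (t # t2 # ts)) = \<phi> t2"
      by (simp add: C[unfolded len] \<phi>_def)
    also have "\<dots> = (t2 - t) * dets (map w' (L @ [s]) @ diffs w (t2 # ts))"
      using s(4) l C[unfolded len] by (simp add: \<phi>_def)
    also have "\<dots> > 0"
    proof (intro mult_pos_pos Cons.IH)
      show "sorted_wrt (<) (L @ [s])" using Cons.prems s by (auto simp: sorted_wrt_append)
    qed (use Cons.prems s t sab in auto)
    finally show ?case .
  qed
  obtain t ts' where ts': "ts = t # ts'" using ts(1) by (cases ts) auto
  have shift: "map (\<lambda>v r. v (Suc r)) (diffs u ts) = diffs w ts"
    unfolding w_def by (induction u ts rule: diffs.induct) auto
  have zero: "v 0 = 0" if "v \<in> set (diffs u ts)" for v
    using that u0 ts(3) by (induction u ts rule: diffs.induct) auto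
  have "dets (map u ts) = dets (u t # diffs u ts)"
    using dets_diffs[of "[]" u t ts'] ts' by simp
  also have "\<dots> = dets (diffs w ts)"
    by (subst dets_border) (use zero u0 ts(3) ts' shift in auto)
  also have "\<dots> > 0" using key[of "[]" t ts'] ts ts' by simp
  finally show ?thesis .
qed

text \<open>If \<open>D k i\<close> is the \<open>k\<close>-th derivative of \<open>f\<^sub>i\<close>, then this is the \<open>k\<close>-th derivative of \<open>f\<^sub>i / f\<^sub>0\<close>: the
  Leibniz rule for \<open>f\<^sub>i = f\<^sub>0 \<cdot> (f\<^sub>i / f\<^sub>0)\<close> solved for the term of highest order.\<close>
fun quotient_derivative :: "(nat \<Rightarrow> nat \<Rightarrow> real \<Rightarrow> real) \<Rightarrow> nat \<Rightarrow> nat \<Rightarrow> real \<Rightarrow> real" where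
  "quotient_derivative D k i t =
    (D k i t - (\<Sum>m<k. of_nat (k choose m) * D (k - m) 0 t * quotient_derivative D m i t)) / D 0 0 t"

declare quotient_derivative.simps [simp del]

lemma quotient_derivative_Leibniz:
  assumes "D 0 0 t \<noteq> 0"
  shows "D k i t = (\<Sum>m<Suc k. of_nat (k choose m) * D (k - m) 0 t * quotient_derivative D m i t)"
  using assms quotient_derivative.simps[of D k i t] by (simp add: field_simps)

lemma quotient_derivative_first:
  assumes "D 0 0 t \<noteq> 0"
  shows "quotient_derivative D k 0 t = (if k = 0 then 1 else 0)"
proof (induction k rule: less_induct)
  case (less k)
  show ?case
  proof (cases "k = 0")
    case True
    then show ?thesis using assms by (simp add: quotient_derivative.simps[of D 0])
  next
    case False
    have "(\<Sum>m<k. of_nat (k choose m) * D (k - m) 0 t * quotient_derivative D m 0 t) =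
        (\<Sum>m<k. if m = 0 then D k 0 t else 0)"
      using less by (intro sum.cong) auto
    then show ?thesis using False by (simp add: quotient_derivative.simps[of D k])
  qed
qed

text \<open>Differentiating the Leibniz rule of order \<open>k\<close> and collecting terms by Pascal's rule gives the
  Leibniz rule of order \<open>k + 1\<close>.\<close>
lemma quotient_derivative_has_derivative:
  assumes der: "\<And>k j. Suc k < n \<Longrightarrow> j \<in> {0, i} \<Longrightarrow> (D k j has_real_derivative D (Suc k) j t) (at t)"
    and nz: "D 0 0 t \<noteq> 0" and k: "Suc k < n"
  shows "(quotient_derivative D k i has_real_derivative quotient_derivative D (Suc k) i t) (at t)"
  using k
proof (induction k rule: less_induct)
  case (less k)
  define H where "H = (\<lambda>k. quotient_derivative D k i)"
  define N where "N = (\<lambda>s. D k i s - (\<Sum>m<k. of_nat (k choose m) * D (k - m) 0 s * H m s))"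
  define N' where "N' = D (Suc k) i t -
    (\<Sum>m<k. of_nat (k choose m) * (D (Suc (k - m)) 0 t * H m t + D (k - m) 0 t * H (Suc m) t))"
  have IH: "(H m has_real_derivative H (Suc m) t) (at t)" if "m < k" for m
    using less.IH[OF that] less.prems that unfolding H_def by simp
  have H: "H k = (\<lambda>s. N s / D 0 0 s)"
    unfolding H_def N_def by (rule ext) (simp add: quotient_derivative.simps[of D k])
  have dN: "(N has_real_derivative N') (at t)"
    unfolding N_def N'_def
  proof (intro DERIV_diff DERIV_sum)
    show "(D k i has_real_derivative D (Suc k) i t) (at t)" using der less.prems by simp
  next
    fix m assume "m \<in> {..<k}"
    then have m: "m < k" by simp
    have "(D (k - m) 0 has_real_derivative D (Suc (k - m)) 0 t) (at t)"
      using der[of "k - m" 0] less.prems m by simp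
    from DERIV_mult[OF this IH[OF m]]
    have "((\<lambda>s. D (k - m) 0 s * H m s) has_real_derivative
        D (Suc (k - m)) 0 t * H m t + D (k - m) 0 t * H (Suc m) t) (at t)"
      by (simp add: mult_ac add.commute)
    from DERIV_cmult[OF this, of "of_nat (k choose m)"]
    show "((\<lambda>s. of_nat (k choose m) * D (k - m) 0 s * H m s) has_real_derivative
        of_nat (k choose m) * (D (Suc (k - m)) 0 t * H m t + D (k - m) 0 t * H (Suc m) t)) (at t)"
      by (simp add: mult.assoc)
  qed
  have d0: "(D 0 0 has_real_derivative D 1 0 t) (at t)" using der[of 0 0] less.prems by simp
  have dH: "(H k has_real_derivative (N' * D 0 0 t - N t * D 1 0 t) / (D 0 0 t * D 0 0 t)) (at t)"
    unfolding H by (rule DERIV_divide[OF dN d0 nz])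
  have *: "(N' * D 0 0 t - N t * D 1 0 t) / (D 0 0 t * D 0 0 t) = (N' - H k t * D 1 0 t) / D 0 0 t"
    using nz H by (simp add: field_simps)
  define a where "a = (\<lambda>m. D (Suc k - m) 0 t * H m t)"
  have "(\<Sum>m<k. of_nat (k choose m) * (D (Suc (k - m)) 0 t * H m t + D (k - m) 0 t * H (Suc m) t))
        + H k t * D 1 0 t
      = (\<Sum>m<Suc k. of_nat (k choose m) * a m) + (\<Sum>m<k. of_nat (k choose m) * a (Suc m))"
    by (simp add: a_def distrib_left sum.distrib Suc_diff_le mult_ac)
  also have "(\<Sum>m<Suc k. of_nat (k choose m) * a m) = a 0 + (\<Sum>m<k. of_nat (k choose Suc m) * a (Suc m))"
    by (subst sum.lessThan_Suc_shift) simp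
  also have "a 0 + (\<Sum>m<k. of_nat (k choose Suc m) * a (Suc m)) + (\<Sum>m<k. of_nat (k choose m) * a (Suc m))
      = a 0 + (\<Sum>m<k. of_nat (Suc k choose Suc m) * a (Suc m))"
    by (simp add: sum.distrib[symmetric] algebra_simps)
  also have "\<dots> = (\<Sum>m<Suc k. of_nat (Suc k choose m) * a m)"
    by (subst sum.lessThan_Suc_shift) simp
  finally have "N' - H k t * D 1 0 t = D (Suc k) i t - (\<Sum>m<Suc k. of_nat (Suc k choose m) * a m)"
    by (simp add: N'_def)
  then have "(N' - H k t * D 1 0 t) / D 0 0 t = H (Suc k) t"
    unfolding H_def a_def by (simp only: quotient_derivative.simps[of D "Suc k"] mult.assoc)
  then show ?case using dH * H_def by simp
qed

text \<open>The Leibniz rule writes the Wronskian matrix of the \<open>f\<^sub>i\<close> as that of the quotients \<open>f\<^sub>i / f\<^sub>0\<close> times a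
  triangular matrix with diagonal entries \<open>f\<^sub>0\<close>.\<close>
lemma wronskian_quotient:
  assumes nz: "D 0 0 t \<noteq> 0"
  shows "dets (map (\<lambda>j i. D j i t) [0..<k]) =
    (D 0 0 t) ^ k * dets (map (\<lambda>j i. quotient_derivative D j i t) [0..<k])"
proof -
  let ?H = "Matrix.mat k k (\<lambda>(i, j). quotient_derivative D j i t)"
  let ?L = "Matrix.mat k k (\<lambda>(m, j). if m \<le> j then of_nat (j choose m) * D (j - m) 0 t else 0)"
  have "Matrix.mat k k (\<lambda>(i, j). D j i t) = ?H * ?L"
  proof (rule eq_matI)
    fix i j assume "i < dim_row (?H * ?L)" "j < dim_col (?H * ?L)"
    then have ij: "i < k" "j < k" by auto
    have "(?H * ?L) $$ (i, j) = (\<Sum>m\<in>{0..<k}. quotient_derivative D m i t *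
        (if m \<le> j then of_nat (j choose m) * D (j - m) 0 t else 0))"
      using ij by (simp add: scalar_prod_def)
    also have "\<dots> = (\<Sum>m\<in>{..<Suc j}. of_nat (j choose m) * D (j - m) 0 t * quotient_derivative D m i t)"
      by (rule sum.mono_neutral_cong_right) (use ij in auto)
    also have "\<dots> = D j i t"
      by (rule quotient_derivative_Leibniz[where D = D, OF nz, symmetric])
    finally show "Matrix.mat k k (\<lambda>(i, j). D j i t) $$ (i, j) = (?H * ?L) $$ (i, j)"
      using ij by simp
  qed auto
  then have "Determinant.det (?H * ?L) = Determinant.det (Matrix.mat k k (\<lambda>(i, j). D j i t))" by simp
  also have "\<dots> = dets (map (\<lambda>j i. D j i t) [0..<k])"
    unfolding dets_def by (intro arg_cong[of _ _ Determinant.det] eq_matI) auto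
  finally have "dets (map (\<lambda>j i. D j i t) [0..<k]) = Determinant.det (?H * ?L)" by simp
  also have "\<dots> = Determinant.det ?H * Determinant.det ?L"
    by (rule det_mult) auto
  also have "Determinant.det ?L = prod_list (diag_mat ?L)"
    by (rule det_upper_triangular) (auto simp: upper_triangular_def)
  also have "\<dots> = (D 0 0 t) ^ k"
    by (simp add: prod_list_diag_prod)
  also have "Determinant.det ?H = dets (map (\<lambda>j i. quotient_derivative D j i t) [0..<k])"
    unfolding dets_def by (auto intro!: arg_cong[of _ _ Determinant.det] eq_matI)
  finally show ?thesis by simp
qed

text \<open>Induction on the number of functions. Dividing by \<open>f\<^sub>0 > 0\<close> turns the first function into the constant
  \<open>1\<close>, and the Wronskians of the derivatives of the remaining quotients are those of the original system
  up to positive factors. The induction hypothesis for these derivatives and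
  \<open>dets_pos_of_derivative_pos\<close> give the claim for the quotients.\<close>
lemma dets_pos_of_wronskians_pos:
  fixes D :: "nat \<Rightarrow> nat \<Rightarrow> real \<Rightarrow> real"
  assumes der: "\<And>k i t. Suc k < n \<Longrightarrow> i < n \<Longrightarrow> t \<in> {a<..<b} \<Longrightarrow>
      (D k i has_real_derivative D (Suc k) i t) (at t)"
    and wronskian: "\<And>k t. k \<le> n \<Longrightarrow> t \<in> {a<..<b} \<Longrightarrow> dets (map (\<lambda>j i. D j i t) [0..<k]) > 0"
    and ts: "length ts = n" "sorted_wrt (<) ts" "set ts \<subseteq> {a<..<b}"
  shows "dets (map (\<lambda>t i. D 0 i t) ts) > 0"
  using assms
proof (induction n arbitrary: D ts)
  case 0
  then show ?case by (simp add: dets_def)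
next
  case (Suc n)
  note der = Suc.prems(1) and wronskian = Suc.prems(2) and ts = Suc.prems(3-5)
  define H where "H = quotient_derivative D"
  have D00: "D 0 0 t > 0" if "t \<in> {a<..<b}" for t
    using wronskian[of 1 t] that by (simp add: dets_def det_single)
  have derH: "(H k i has_real_derivative H (Suc k) i t) (at t)"
    if "k < n" "i < Suc n" "t \<in> {a<..<b}" for k i t
    unfolding H_def
    by (rule quotient_derivative_has_derivative[where n = "Suc n"]) (use that der D00[of t] in auto)
  have posH: "dets (map (\<lambda>t i. H 1 (Suc i) t) ss) > 0"
    if "length ss = n" "sorted_wrt (<) ss" "set ss \<subseteq> {a<..<b}" for ss
  proof -
    have "dets (map (\<lambda>t i. (\<lambda>k i. H (Suc k) (Suc i)) 0 i t) ss) > 0"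
    proof (rule Suc.IH[OF _ _ that])
      fix k i t assume "Suc k < n" "i < n" "t \<in> {a<..<b}"
      then show "(H (Suc k) (Suc i) has_real_derivative H (Suc (Suc k)) (Suc i) t) (at t)"
        by (intro derH) auto
    next
      fix k t assume k: "k \<le> n" and t: "t \<in> {a<..<b}"
      have nz: "D 0 0 t \<noteq> 0" using D00[OF t] by simp
      have "dets (map (\<lambda>j i. D j i t) [0..<Suc k]) > 0"
        using wronskian[of "Suc k" t] k t by blast
      then have "0 < (D 0 0 t) ^ Suc k * dets (map (\<lambda>j i. H j i t) [0..<Suc k])"
        by (simp only: H_def wronskian_quotient[where D = D, OF nz])
      moreover have "(D 0 0 t) ^ Suc k > 0" using D00[OF t] by simp
      ultimately have "0 < dets (map (\<lambda>j i. H j i t) [0..<Suc k])"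
        using zero_less_mult_pos by blast
      also have "map (\<lambda>j i. H j i t) [0..<Suc k] = (\<lambda>i. H 0 i t) # map (\<lambda>j i. H (Suc j) i t) [0..<k]"
        by (simp add: upt_conv_Cons map_Suc_upt[symmetric] del: upt_Suc)
      also have "dets \<dots> = dets (map (\<lambda>j i. H (Suc j) (Suc i) t) [0..<k])"
        by (subst dets_border) (auto simp: H_def quotient_derivative_first[where D = D, OF nz] o_def)
      finally show "0 < dets (map (\<lambda>j i. H (Suc j) (Suc i) t) [0..<k])" .
    qed
    then show ?thesis by simp
  qed
  obtain t0 ts' where ts': "ts = t0 # ts'" using ts(1) by (cases ts) auto
  define t1 where "t1 = last ts"
  \<comment> \<open>The quotients satisfy the assumptions of \<open>dets_pos_of_derivative_pos\<close> on the closed interval spanned by the nodes.\<close>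
  have "t \<le> last us" if "t \<in> set us" "sorted_wrt (<) us" for t and us :: "real list"
    using that by (induction us) (auto simp: less_imp_le)
  then have range: "set ts \<subseteq> {t0..t1}"
    using ts(2) unfolding t1_def by (auto simp: ts' less_imp_le)
  have "t1 \<in> set ts" unfolding t1_def ts' by simp
  then have t01: "a < t0" "t1 < b" using ts(3) ts' by auto
  have "dets (map (\<lambda>t i. H 0 i t) ts) > 0"
  proof (rule dets_pos_of_derivative_pos[where a = t0 and b = t1 and n = n and u' = "\<lambda>t i. H 1 i t"])
    show "H 0 0 t = 1" if "t \<in> {t0..t1}" for t
    proof -
      have "D 0 0 t > 0" using D00[of t] that t01 by auto
      then show ?thesis by (simp add: H_def quotient_derivative_first)
    qed
    have *: "(H 0 i has_real_derivative H 1 i t) (at t)" if "i \<le> n" "t \<in> {t0..t1}" "n > 0" for i t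
      using derH[of 0 i t] that t01 by simp
    show "continuous_on {t0..t1} (\<lambda>t. H 0 i t)" if "i \<le> n" for i
    proof (cases "n = 0")
      case True
      then show ?thesis using ts(1) unfolding t1_def ts' by simp
    next
      case False
      then show ?thesis using *[OF that] by (intro continuous_at_imp_continuous_on ballI DERIV_isCont) auto
    qed
    show "(H 0 i has_real_derivative H 1 i t) (at t)" if "i \<le> n" "t \<in> {t0<..<t1}" for i t
    proof (rule *)
      show "n > 0"
      proof (rule ccontr)
        assume "\<not> n > 0"
        then have "t1 = t0" using ts(1) unfolding t1_def ts' by simp
        then show False using that by simp
      qed
    qed (use that in auto)
    show "dets (map (\<lambda>s r. H 1 (Suc r) s) ss) > 0"
      if "length ss = n" "sorted_wrt (<) ss" "set ss \<subseteq> {t0<..<t1}" for ss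
      by (rule posH[OF that(1,2) order_trans[OF that(3)]]) (use t01 in auto)
  qed (fact ts(1) ts(2) range)+
  moreover have "dets (map (\<lambda>t i. D 0 i t) ts) = dets ([] @ map (\<lambda>t i. D 0 0 t * H 0 i t) ts @ [])"
  proof -
    have "D 0 i t = D 0 0 t * H 0 i t" if "t \<in> set ts" for t i
    proof -
      have "D 0 0 t > 0" using D00 that ts(3) by blast
      then show ?thesis by (simp add: H_def quotient_derivative.simps[of D 0 i])
    qed
    then have "map (\<lambda>t i. D 0 i t) ts = map (\<lambda>t i. D 0 0 t * H 0 i t) ts"
      by (intro map_cong refl ext) blast
    then show ?thesis unfolding append_Nil append_Nil2 by (rule arg_cong)
  qed
  moreover have "\<dots> = prod_list (map (D 0 0) ts) * dets (map (\<lambda>t i. H 0 i t) ts)"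
    by (subst dets_scale_columns) simp
  moreover have "prod_list (map (D 0 0) ts) > 0"
    using D00 ts(3) by (induction ts) auto
  ultimately show ?case by simp
qed

section \<open>Affine functionals with prescribed zeros on the curve\<close>

lemma bij_betw_coord: "bij_betw (coord :: nat \<Rightarrow> 'n::{finite,linorder}) {..<CARD('n)} UNIV"
  using bij_betw_nth[OF distinct_sorted_list_of_set, of "{..<CARD('n)}" "UNIV :: 'n set"]
  unfolding coord_def by simp

lemma sum_coord: "(\<Sum>i\<in>UNIV. f i) = (\<Sum>j<CARD('n). f (coord j))"
  for f :: "'n::{finite,linorder} \<Rightarrow> real"
  using sum.reindex_bij_betw[OF bij_betw_coord, of f] by simp

text \<open>With \<open>c = 1\<close> the homogeneous coordinates of a point, with \<open>c = 0\<close> those of a direction.\<close>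
definition homog :: "real \<Rightarrow> real^'n::{finite,linorder} \<Rightarrow> nat \<Rightarrow> real" where
  "homog c v i = (case i of 0 \<Rightarrow> c | Suc j \<Rightarrow> v $ coord j)"

lemma homog_simps [simp]: "homog c v 0 = c" "homog c v (Suc j) = v $ coord j"
  by (simp_all add: homog_def)

lemma finite_superset_of_card:
  assumes "finite A" "A \<subseteq> I" "infinite I" "card A \<le> N"
  obtains B where "finite B" "A \<subseteq> B" "B \<subseteq> I" "card B = N"
proof -
  have "infinite (I - A)" using assms by (simp add: Diff_infinite_finite)
  then obtain B where B: "finite B" "card B = N - card A" "B \<subseteq> I - A"
    using infinite_arbitrarily_large by metis
  show thesis
  proof
    show "card (A \<union> B) = N" using B assms by (subst card_Un_disjoint) auto
  qed (use B assms in auto)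
qed

text \<open>Here \<open>N - m\<close> is the number of zeros that are left after a simple zero at \<open>b\<close> has been prescribed
  or not, \<open>k\<close> is a number of double zeros, and \<open>i\<close> counts a zero at \<open>a\<close>. If \<open>N - m\<close> is even, a zero at
  \<open>a\<close> can be made double; if it is odd, it has to stay simple.\<close>
lemma half_bounds:
  fixes k i m N :: nat
  assumes "2 * k + i + m \<le> N"
  shows "i \<le> 1 \<Longrightarrow> even (N - m) \<Longrightarrow> k + i \<le> (N - m) div 2"
    and "odd (N - m) \<Longrightarrow> k \<le> (N - m) div 2"
    and "even (N - m) \<Longrightarrow> 2 * ((N - m) div 2) + m = N"
    and "odd (N - m) \<Longrightarrow> 2 * ((N - m) div 2) + Suc m = N"
proof -
  obtain d where d: "N = m + d" using assms le_Suc_ex[of m N] by auto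
  show "i \<le> 1 \<Longrightarrow> even (N - m) \<Longrightarrow> k + i \<le> (N - m) div 2"
    "odd (N - m) \<Longrightarrow> k \<le> (N - m) div 2"
    "even (N - m) \<Longrightarrow> 2 * ((N - m) div 2) + m = N"
    "odd (N - m) \<Longrightarrow> 2 * ((N - m) div 2) + Suc m = N"
    using assms unfolding d by (auto elim!: evenE oddE)
qed

text \<open>What the geometric part of the proof uses of the curve. Total positivity of the torsion enters only
  through the positivity of the determinants.\<close>
locale chebyshev_curve =
  fixes \<gamma> \<gamma>' :: "real \<Rightarrow> real^'n::{finite,linorder}" and a b :: real
  assumes a_less_b: "a < b"
    and cont: "continuous_on {a..b} \<gamma>"
    and deriv: "\<And>t. t \<in> {a<..<b} \<Longrightarrow> (\<gamma> has_vector_derivative \<gamma>' t) (at t)"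
    and cont_deriv: "continuous_on {a<..<b} \<gamma>'"
    and dets_pos: "\<And>ts. length ts = Suc CARD('n) \<Longrightarrow> sorted_wrt (<) ts \<Longrightarrow> set ts \<subseteq> {a..b} \<Longrightarrow>
      dets (map (\<lambda>t. homog 1 (\<gamma> t)) ts) > 0"
begin

text \<open>The functional is \<open>t \<mapsto> det ((1, \<gamma>(t)), (1, \<gamma>(y\<^sub>1)), \<dots>, (1, \<gamma>(y\<^sub>n)))\<close> for the increasing
  enumeration of \<open>Y\<close>. Moving the first column to the place where the nodes become increasing takes one
  transposition for each node below \<open>t\<close>, so that the functional changes its sign at each
  node.\<close>
lemma affine_functional_with_zeros:
  assumes Y: "Y \<subseteq> {a..b}" "finite Y" "card Y = CARD('n)"
  obtains c \<phi> where "\<And>y. y \<in> Y \<Longrightarrow> c + \<phi> \<bullet> \<gamma> y = 0"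
    "\<And>t. t \<in> {a..b} \<Longrightarrow> t \<notin> Y \<Longrightarrow> (-1) ^ card {y\<in>Y. y < t} * (c + \<phi> \<bullet> \<gamma> t) > 0"
proof -
  let ?u = "\<lambda>t. homog 1 (\<gamma> t)"
  define ys where "ys = sorted_list_of_set Y"
  have ys: "set ys = Y" "sorted_wrt (<) ys" "length ys = CARD('n)" "distinct ys"
    unfolding ys_def using Y by auto
  obtain C where C: "\<And>w. dets ([] @ w # map ?u ys) = (\<Sum>i<Suc (length ([] @ map ?u ys)). C i * w i)"
    using dets_linear_form by blast
  define \<phi> :: "real^'n::_" where "\<phi> = (\<chi> i. C (Suc (inv_into {..<CARD('n)} coord i)))"
  have \<phi>: "\<phi> $ coord j = C (Suc j)" if "j < CARD('n)" for j
    using bij_betw_coord[where 'n = 'n] that unfolding \<phi>_def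
    by (simp add: bij_betw_inv_into_left)
  have f: "dets (?u t # map ?u ys) = C 0 + \<phi> \<bullet> \<gamma> t" for t
  proof -
    have "dets (?u t # map ?u ys) = (\<Sum>i<Suc CARD('n). C i * ?u t i)"
      using C[of "?u t"] ys(3) by simp
    also have "\<dots> = C 0 + (\<Sum>j<CARD('n). \<phi> $ coord j * \<gamma> t $ coord j)"
      unfolding sum.lessThan_Suc_shift by (simp add: \<phi>)
    also have "(\<Sum>j<CARD('n). \<phi> $ coord j * \<gamma> t $ coord j) = \<phi> \<bullet> \<gamma> t"
      by (simp add: inner_vec_def sum_coord)
    finally show ?thesis .
  qed
  show thesis
  proof
    fix y assume "y \<in> Y"
    then have "\<not> distinct (?u y # map ?u ys)" using ys by auto
    then show "C 0 + \<phi> \<bullet> \<gamma> y = 0" using f[of y] dets_not_distinct by metis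
  next
    fix t assume t: "t \<in> {a..b}" "t \<notin> Y"
    define P Q where "P = filter (\<lambda>y. y < t) ys" and "Q = filter (\<lambda>y. \<not> y < t) ys"
    have "us = filter (\<lambda>y. y < t) us @ filter (\<lambda>y. \<not> y < t) us" if "sorted_wrt (<) us" for us :: "real list"
      using that
    proof (induction us)
      case (Cons x us)
      show ?case
      proof (cases "x < t")
        case False
        then have "filter (\<lambda>y. y < t) us = []" "filter (\<lambda>y. \<not> y < t) us = us"
          using Cons.prems by (auto simp: filter_empty_conv filter_id_conv)
        then show ?thesis using False by simp
      qed (use Cons in simp)
    qed simp
    then have PQ: "P @ Q = ys" using ys(2) unfolding P_def Q_def by simp
    have "\<forall>x\<in>set P. x < t" "\<forall>x\<in>set Q. t < x"
      using t(2) ys(1) unfolding P_def Q_def by (auto simp: not_less less_le)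
    have "length P = card {y\<in>Y. y < t}"
      using ys unfolding P_def by (simp add: distinct_card[symmetric])
    moreover have "sorted_wrt (<) (P @ t # Q)"
      using ys(2) \<open>\<forall>x\<in>set P. x < t\<close> \<open>\<forall>x\<in>set Q. t < x\<close>
      unfolding PQ[symmetric] by (simp add: sorted_wrt_append)
    then have "dets (map ?u (P @ t # Q)) > 0"
      using t Y ys(1,3) unfolding PQ[symmetric] by (intro dets_pos) auto
    moreover have "dets (map ?u (P @ t # Q)) = (-1) ^ length P * dets (?u t # map ?u ys)"
      using dets_move[of "[]" "map ?u P" "?u t" "map ?u Q"] by (simp add: PQ[symmetric])
    ultimately show "(-1) ^ card {y\<in>Y. y < t} * (C 0 + \<phi> \<bullet> \<gamma> t) > 0" using f by simp
  qed
qed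

text \<open>The coefficient at \<open>t0\<close> is isolated by an affine functional that vanishes at all the other points but
  not at \<open>t0\<close>.\<close>
lemma curve_points_affinely_independent:
  assumes T: "finite T" "T \<subseteq> {a..b}" "card T \<le> Suc CARD('n)"
    and sum0: "(\<Sum>t\<in>T. d t) = 0" "(\<Sum>t\<in>T. d t *\<^sub>R \<gamma> t) = 0" and t0: "t0 \<in> T"
  shows "d t0 = 0"
proof -
  have "finite (T - {t0})" "card (T - {t0}) \<le> CARD('n)" using T t0 by auto
  have "infinite ({a..b} - {t0})" using a_less_b by (simp add: Diff_infinite_finite)
  then obtain Y where Y0: "finite Y" "T - {t0} \<subseteq> Y" "Y \<subseteq> {a..b} - {t0}" "card Y = CARD('n)"
    using finite_superset_of_card[of "T - {t0}" "{a..b} - {t0}"] T \<open>card (T - {t0}) \<le> CARD('n)\<close>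
    by blast
  then have Y: "Y \<subseteq> {a..b}" "finite Y" "t0 \<notin> Y" "T - {t0} \<subseteq> Y" and cY: "card Y = CARD('n)" by auto
  obtain c \<phi> where f: "\<And>y. y \<in> Y \<Longrightarrow> c + \<phi> \<bullet> \<gamma> y = 0"
    "\<And>t. t \<in> {a..b} \<Longrightarrow> t \<notin> Y \<Longrightarrow> (-1) ^ card {y\<in>Y. y < t} * (c + \<phi> \<bullet> \<gamma> t) > 0"
    using affine_functional_with_zeros[OF Y(1,2) cY] by blast
  have "d t0 * (c + \<phi> \<bullet> \<gamma> t0) = (\<Sum>t\<in>T. d t * (c + \<phi> \<bullet> \<gamma> t))"
    using T t0 f(1) Y(4) by (subst sum.remove[of T t0]) (auto intro!: sum.neutral)
  also have "\<dots> = c * (\<Sum>t\<in>T. d t) + \<phi> \<bullet> (\<Sum>t\<in>T. d t *\<^sub>R \<gamma> t)"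
    by (simp add: distrib_left sum.distrib sum_distrib_left inner_sum_right mult.commute)
  also have "\<dots> = 0" using sum0 by simp
  finally show ?thesis using f(2)[of t0] T t0 Y(3) by force
qed

text \<open>The nodes are the points of \<open>Z\<close>, their translates by \<open>h\<close>, and the end points in \<open>E\<close>. Outside the
  gaps between \<open>z\<close> and \<open>z + h\<close> the nodes below \<open>t\<close> come in pairs except for a possible simple node
  \<open>a\<close>, and so the sign is constant there. The normalization prepares for a limit
  \<open>h \<rightarrow> 0\<close>.\<close>
lemma doubled_nodes_functional:
  assumes Z: "Z \<subseteq> {a..<b}" "finite Z" and E: "E \<subseteq> {a, b}" and disj: "Z \<inter> E = {}"
    and card: "2 * card Z + card E = CARD('n)" and h: "h > 0"
    and gap: "\<And>z. z \<in> Z \<Longrightarrow> z + h < b" "\<And>z z'. z \<in> Z \<Longrightarrow> z' \<in> Z \<Longrightarrow> z < z' \<Longrightarrow> z + h < z'"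
  obtains c \<phi> where "norm (c, \<phi>) = 1" "\<And>t. t \<in> Z \<union> E \<Longrightarrow> c + \<phi> \<bullet> \<gamma> t = 0"
    "\<And>t. t \<in> {a..b} \<Longrightarrow> (\<And>z. z \<in> Z \<Longrightarrow> \<not> (z < t \<and> t < z + h)) \<Longrightarrow> c + \<phi> \<bullet> \<gamma> t \<ge> 0"
proof -
  define Y where "Y = Z \<union> (\<lambda>z. z + h) ` Z \<union> E"
  have finE: "finite E" using E finite_subset by auto
  have Zdisj: "Z \<inter> (\<lambda>z. z + h) ` Z = {}" using gap(2) h by fastforce
  have Edisj: "(Z \<union> (\<lambda>z. z + h) ` Z) \<inter> E = {}"
    using disj E Z gap(1) h by fastforce
  have fY: "finite Y" unfolding Y_def using Z finE by auto
  have cY: "card Y = CARD('n)"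
    unfolding Y_def using Zdisj Edisj Z finE card
    by (simp add: card_Un_disjoint card_image)
  have Y: "Y \<subseteq> {a..b}" unfolding Y_def using Z E gap(1) h a_less_b
    by (fastforce simp: less_imp_le)
  obtain c \<phi> where f: "\<And>y. y \<in> Y \<Longrightarrow> c + \<phi> \<bullet> \<gamma> y = 0"
    "\<And>t. t \<in> {a..b} \<Longrightarrow> t \<notin> Y \<Longrightarrow> (-1) ^ card {y\<in>Y. y < t} * (c + \<phi> \<bullet> \<gamma> t) > 0"
    using affine_functional_with_zeros[OF Y fY cY] by blast
  define \<sigma> :: real where "\<sigma> = (-1) ^ card (E \<inter> {a})"
  have pos: "\<sigma> * (c + \<phi> \<bullet> \<gamma> t) > 0"
    if t: "t \<in> {a..b}" "t \<notin> Y" and ng: "\<And>z. z \<in> Z \<Longrightarrow> \<not> (z < t \<and> t < z + h)" for t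
  proof -
    have "z + h < t" if "z \<in> Z" "z < t" for z
      using ng[OF that(1)] that t(2) unfolding Y_def by (cases "z + h = t") auto
    then have Yt: "{y\<in>Y. y < t} = {z\<in>Z. z < t} \<union> (\<lambda>z. z + h) ` {z\<in>Z. z < t} \<union> (E \<inter> {a})"
      using t E h unfolding Y_def by (auto simp: less_le)
    have "card {y\<in>Y. y < t} = 2 * card {z\<in>Z. z < t} + card (E \<inter> {a})"
      unfolding Yt using Z Zdisj Edisj finE
      by (subst card_Un_disjoint; (subst card_Un_disjoint)?) (auto simp: card_image)
    then show ?thesis using f(2)[OF t] by (simp add: \<sigma>_def power_add power_mult)
  qed
  have "infinite ({a..b} - Y)" using fY a_less_b by (simp add: Diff_infinite_finite)
  then obtain t where "t \<in> {a..b}" "t \<notin> Y" by (metis Diff_iff finite.emptyI ex_in_conv)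
  from f(2)[OF this] have "(c, \<phi>) \<noteq> 0" by (auto simp: zero_prod_def)
  then have N: "norm (c, \<phi>) > 0" by simp
  define N where "N = norm (c, \<phi>)"
  show thesis
  proof
    have "(\<sigma> * c / N, (\<sigma> / N) *\<^sub>R \<phi>) = (\<sigma> / N) *\<^sub>R (c, \<phi>)" by simp
    then have "norm (\<sigma> * c / N, (\<sigma> / N) *\<^sub>R \<phi>) = \<bar>\<sigma> / N\<bar> * norm (c, \<phi>)"
      using norm_scaleR by metis
    then show "norm (\<sigma> * c / N, (\<sigma> / N) *\<^sub>R \<phi>) = 1"
      using N by (simp add: N_def \<sigma>_def power_abs)
    have eq: "\<sigma> * c / N + ((\<sigma> / N) *\<^sub>R \<phi>) \<bullet> \<gamma> t = \<sigma> * (c + \<phi> \<bullet> \<gamma> t) / N" for t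
      by (simp add: field_simps add_divide_distrib)
    show "\<sigma> * c / N + ((\<sigma> / N) *\<^sub>R \<phi>) \<bullet> \<gamma> t = 0" if "t \<in> Z \<union> E" for t
      using that f(1)[of t] unfolding eq Y_def by auto
    show "\<sigma> * c / N + ((\<sigma> / N) *\<^sub>R \<phi>) \<bullet> \<gamma> t \<ge> 0"
      if "t \<in> {a..b}" "\<And>z. z \<in> Z \<Longrightarrow> \<not> (z < t \<and> t < z + h)" for t
      unfolding eq using f(1)[of t] pos[of t] that N by (cases "t \<in> Y") (auto simp: N_def)
  qed
qed

text \<open>A limit point of the functionals of \<open>doubled_nodes_functional\<close> as \<open>h\<close> tends to \<open>0\<close>: the points of
  \<open>Z\<close> become double zeros and the gaps disappear. Compactness of the unit sphere keeps the limit
  away from \<open>0\<close>.\<close>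
lemma supporting_functional:
  assumes Z: "Z \<subseteq> {a..<b}" "finite Z" and E: "E \<subseteq> {a, b}" and disj: "Z \<inter> E = {}"
    and card: "2 * card Z + card E = CARD('n)"
  obtains c \<phi> where "(c, \<phi>) \<noteq> 0" "\<And>t. t \<in> Z \<union> E \<Longrightarrow> c + \<phi> \<bullet> \<gamma> t = 0"
    "\<And>t. t \<in> {a..b} \<Longrightarrow> c + \<phi> \<bullet> \<gamma> t \<ge> 0"
proof -
  define h where "h = (\<lambda>k. inverse (real (Suc k)))"
  have hpos: "h k > 0" for k by (simp add: h_def)
  have h0: "h \<longlonglongrightarrow> 0" unfolding h_def by (rule LIMSEQ_inverse_real_of_nat)
  have ev: "eventually (\<lambda>k. z + h k < x) sequentially" if "z < x" for z x
    using order_tendstoD(2)[OF h0, of "x - z"] that by (auto elim!: eventually_mono)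
  have "eventually (\<lambda>k. \<forall>z\<in>Z. z + h k < b \<and> (\<forall>z'\<in>Z. z < z' \<longrightarrow> z + h k < z')) sequentially"
    using Z ev by (auto simp: eventually_ball_finite_distrib eventually_conj_iff intro!: ev)
  then obtain K where K: "\<And>k. k \<ge> K \<Longrightarrow> \<forall>z\<in>Z. z + h k < b \<and> (\<forall>z'\<in>Z. z < z' \<longrightarrow> z + h k < z')"
    unfolding eventually_sequentially by blast
  define G where "G = (\<lambda>k p. norm p = 1 \<and> (\<forall>t\<in>Z \<union> E. fst p + snd p \<bullet> \<gamma> t = 0) \<and>
    (\<forall>t\<in>{a..b}. (\<forall>z\<in>Z. \<not> (z < t \<and> t < z + h k)) \<longrightarrow> fst p + snd p \<bullet> \<gamma> t \<ge> 0))"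
  have "\<exists>p. G (k + K) p" for k
  proof -
    have g: "\<And>z. z \<in> Z \<Longrightarrow> z + h (k + K) < b"
        "\<And>z z'. z \<in> Z \<Longrightarrow> z' \<in> Z \<Longrightarrow> z < z' \<Longrightarrow> z + h (k + K) < z'"
      using K[of "k + K"] by auto
    show ?thesis
    proof (rule doubled_nodes_functional[OF Z E disj card hpos g])
      fix c \<phi>
      assume "norm (c, \<phi>) = 1" "\<And>t. t \<in> Z \<union> E \<Longrightarrow> c + \<phi> \<bullet> \<gamma> t = 0"
        "\<And>t. t \<in> {a..b} \<Longrightarrow> (\<And>z. z \<in> Z \<Longrightarrow> \<not> (z < t \<and> t < z + h (k + K))) \<Longrightarrow> c + \<phi> \<bullet> \<gamma> t \<ge> 0"
      then have "G (k + K) (c, \<phi>)" unfolding G_def fst_conv snd_conv by blast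
      then show ?thesis by blast
    qed
  qed
  then obtain p where p: "\<And>k. G (k + K) (p k)" by metis
  have "compact (sphere (0 :: real \<times> (real^'n::_)) 1)" by (rule compact_sphere)
  moreover have "\<forall>k. p k \<in> sphere 0 1" using p by (simp add: G_def)
  ultimately obtain q r where q: "q \<in> sphere 0 1" "strict_mono r" "(p \<circ> r) \<longlonglongrightarrow> q"
    unfolding compact_def by blast
  have lim: "(\<lambda>k. fst (p (r k)) + snd (p (r k)) \<bullet> \<gamma> t) \<longlonglongrightarrow> fst q + snd q \<bullet> \<gamma> t" for t
    using q(3) by (intro tendsto_intros) (auto simp: o_def)
  show thesis
  proof
    show "(fst q, snd q) \<noteq> 0" using q(1) by auto
  next
    fix t assume "t \<in> Z \<union> E"
    then have "fst (p (r k)) + snd (p (r k)) \<bullet> \<gamma> t = 0" for k using p[of "r k"] by (auto simp: G_def)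
    then show "fst q + snd q \<bullet> \<gamma> t = 0" using lim[of t] LIMSEQ_const_iff[of "0 :: real"] by simp
  next
    fix t assume t: "t \<in> {a..b}"
    have "eventually (\<lambda>k. \<forall>z\<in>Z. \<not> (z < t \<and> t < z + h k)) sequentially"
      using Z(2)
    proof (subst eventually_ball_finite_distrib, safe)
      fix z assume "z \<in> Z"
      show "eventually (\<lambda>k. \<not> (z < t \<and> t < z + h k)) sequentially"
        by (cases "z < t") (use ev[of z t] in \<open>auto elim!: eventually_mono\<close>)
    qed
    moreover have "filterlim (\<lambda>k. r k + K) sequentially sequentially"
      using q(2) filterlim_add_const_nat_at_top filterlim_compose filterlim_subseq by blast
    ultimately have "eventually (\<lambda>k. \<forall>z\<in>Z. \<not> (z < t \<and> t < z + h (r k + K))) sequentially"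
      by (rule eventually_compose_filterlim)
    then have "eventually (\<lambda>k. fst (p (r k)) + snd (p (r k)) \<bullet> \<gamma> t \<ge> 0) sequentially"
      by (rule eventually_mono) (use p t in \<open>auto simp: G_def\<close>)
    then show "fst q + snd q \<bullet> \<gamma> t \<ge> 0"
      using tendsto_lowerbound[OF lim] by simp
  qed
qed

text \<open>The multiplicity that a zero of a nonnegative function on the interval needs at the point.\<close>
definition node_weight :: "real \<Rightarrow> nat" where
  "node_weight t = (if t \<in> {a, b} then 1 else 2)"

text \<open>The points can be completed to the zeros of a supporting functional, which then vanishes at each
  convex combination of them. The number of zeros has to be \<open>n\<close> exactly: if \<open>b\<close> takes its share and an
  even number is left, all other zeros are double, including one at \<open>a\<close>; otherwise there is a simple
  zero at \<open>a\<close>. Double zeros at further points fill up the number.\<close>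
lemma hull_of_few_points_misses_interior:
  assumes P: "finite P" "P \<subseteq> {a..b}" "(\<Sum>t\<in>P. node_weight t) \<le> CARD('n)"
  shows "convex hull (\<gamma> ` P) \<inter> interior (convex hull (\<gamma> ` {a..b})) = {}"
proof (rule ccontr)
  assume "\<not> ?thesis"
  then obtain p where p: "p \<in> convex hull (\<gamma> ` P)" "p \<in> interior (convex hull (\<gamma> ` {a..b}))" by blast
  then have Pne: "P \<noteq> {}" by auto
  have "\<exists>Z E. Z \<subseteq> {a..<b} \<and> finite Z \<and> E \<subseteq> {a, b} \<and> Z \<inter> E = {} \<and>
    2 * card Z + card E = CARD('n) \<and> P \<subseteq> Z \<union> E"
  proof -
    define m where "m = card (P \<inter> {b})"
    have "(\<Sum>t\<in>P. node_weight t) =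
        (\<Sum>t\<in>P. (if t \<in> {a<..<b} then 2 else 0) + (if t \<in> {a} then 1 else 0) + (if t \<in> {b} then 1 else 0))"
      using P(2) a_less_b by (intro sum.cong) (auto simp: node_weight_def)
    also have "\<dots> = 2 * card (P \<inter> {a<..<b}) + card (P \<inter> {a}) + m"
      unfolding m_def sum.distrib using P(1) by (simp only: sum.If_cases Collect_mem_eq) simp
    finally have w: "2 * card (P \<inter> {a<..<b}) + card (P \<inter> {a}) + m \<le> CARD('n)"
      using P(3) by simp
    have \<alpha>: "card (P \<inter> {a}) \<le> 1" by (auto simp: Int_insert_right)
    have tab: "a \<le> t \<and> t \<le> b" if "t \<in> P" for t using subsetD[OF P(2) that] by simp
    show ?thesis
    proof (cases "even (CARD('n) - m)")
      case True
      have "P \<inter> {a..<b} = (P \<inter> {a<..<b}) \<union> (P \<inter> {a})" using a_less_b by auto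
      then have "card (P \<inter> {a..<b}) = card (P \<inter> {a<..<b}) + card (P \<inter> {a})"
        using P(1) by (simp only:) (subst card_Un_disjoint, auto)
      then have c: "card (P \<inter> {a..<b}) \<le> (CARD('n) - m) div 2"
        using half_bounds(1)[OF w \<alpha> True] by (simp only:)
      have fin: "finite (P \<inter> {a..<b})" "P \<inter> {a..<b} \<subseteq> {a..<b}" "infinite {a..<b}"
        using P(1) a_less_b by auto
      obtain Z where Z: "finite Z" "P \<inter> {a..<b} \<subseteq> Z" "Z \<subseteq> {a..<b}" "card Z = (CARD('n) - m) div 2"
        by (rule finite_superset_of_card[OF fin c])
      have "2 * card Z + card (P \<inter> {b}) = CARD('n)"
        unfolding Z(4) m_def[symmetric] by (rule half_bounds(3)[OF w True])
      moreover have "P \<subseteq> Z \<union> (P \<inter> {b})"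
      proof
        show "t \<in> Z \<union> (P \<inter> {b})" if "t \<in> P" for t
          using tab[OF that] Z(2) that by (cases "t = b") auto
      qed
      moreover have "P \<inter> {b} \<subseteq> {a, b}" "Z \<inter> (P \<inter> {b}) = {}" using Z(3) by auto
      ultimately show ?thesis using Z(1,3) by metis
    next
      case False
      have c: "card (P \<inter> {a<..<b}) \<le> (CARD('n) - m) div 2"
        by (rule half_bounds(2)[OF w False])
      have fin: "finite (P \<inter> {a<..<b})" "P \<inter> {a<..<b} \<subseteq> {a<..<b}" "infinite {a<..<b}"
        using P(1) a_less_b by auto
      obtain Z where Z: "finite Z" "P \<inter> {a<..<b} \<subseteq> Z" "Z \<subseteq> {a<..<b}" "card Z = (CARD('n) - m) div 2"
        by (rule finite_superset_of_card[OF fin c])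
      have "card (insert a (P \<inter> {b})) = Suc m" using a_less_b P(1) by (simp add: m_def)
      then have "2 * card Z + card (insert a (P \<inter> {b})) = CARD('n)"
        using half_bounds(4)[OF w False] by (simp only: Z(4))
      moreover have "P \<subseteq> Z \<union> insert a (P \<inter> {b})"
      proof
        show "t \<in> Z \<union> insert a (P \<inter> {b})" if "t \<in> P" for t
          using tab[OF that] Z(2) that by (cases "t = b"; cases "t = a") auto
      qed
      moreover have "insert a (P \<inter> {b}) \<subseteq> {a, b}" "Z \<inter> insert a (P \<inter> {b}) = {}" "Z \<subseteq> {a..<b}"
        using Z(3) by auto
      ultimately show ?thesis using Z(1) by metis
    qed
  qed
  then obtain Z E where ZE: "Z \<subseteq> {a..<b}" "finite Z" "E \<subseteq> {a, b}" "Z \<inter> E = {}"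
    "2 * card Z + card E = CARD('n)" "P \<subseteq> Z \<union> E" by blast
  obtain c \<phi> where f: "(c, \<phi>) \<noteq> 0" "\<And>t. t \<in> Z \<union> E \<Longrightarrow> c + \<phi> \<bullet> \<gamma> t = 0"
    "\<And>t. t \<in> {a..b} \<Longrightarrow> c + \<phi> \<bullet> \<gamma> t \<ge> 0"
    using supporting_functional[OF ZE(1-5)] by blast
  have "\<phi> \<noteq> 0"
  proof
    assume "\<phi> = 0"
    moreover obtain t where "t \<in> P" using Pne by blast
    ultimately have "c = 0" using f(2)[of t] ZE(6) by auto
    then show False using f(1) \<open>\<phi> = 0\<close> by (simp add: zero_prod_def)
  qed
  have "convex hull (\<gamma> ` P) \<subseteq> {v. \<phi> \<bullet> v = - c}"
  proof (rule hull_minimal)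
    show "\<gamma> ` P \<subseteq> {v. \<phi> \<bullet> v = - c}"
      using f(2) ZE(6) by (auto simp: eq_neg_iff_add_eq_0 add.commute)
  qed (rule convex_hyperplane)
  then have fp: "\<phi> \<bullet> p = - c" using p(1) by auto
  have C: "convex hull (\<gamma> ` {a..b}) \<subseteq> {v. \<phi> \<bullet> v \<ge> - c}"
  proof (rule hull_minimal)
    have "\<phi> \<bullet> \<gamma> t \<ge> - c" if "t \<in> {a..b}" for t using f(3)[OF that] by linarith
    then show "\<gamma> ` {a..b} \<subseteq> {v. \<phi> \<bullet> v \<ge> - c}" by blast
  qed (rule convex_halfspace_ge)
  obtain e where e: "e > 0" "ball p e \<subseteq> convex hull (\<gamma> ` {a..b})"
    using p(2) by (auto simp: mem_interior)
  \<comment> \<open>A step against the gradient stays in the hull but makes the functional negative.\<close>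
  define v where "v = p - (e / 2 / norm \<phi>) *\<^sub>R \<phi>"
  have "v \<in> ball p e" unfolding v_def using e \<open>\<phi> \<noteq> 0\<close> by (simp add: dist_norm)
  then have "\<phi> \<bullet> v \<ge> - c" using e C by auto
  moreover have "\<phi> \<bullet> v = - c - e / 2 / norm \<phi> * (\<phi> \<bullet> \<phi>)"
    unfolding v_def by (simp add: inner_diff_right fp)
  moreover have "e / 2 / norm \<phi> * (\<phi> \<bullet> \<phi>) > 0" using e \<open>\<phi> \<noteq> 0\<close> by simp
  ultimately show False by linarith
qed

end

section \<open>The parametrization of the interior of the convex hull\<close>

definition par :: "real^'n::{finite,linorder} \<Rightarrow> nat \<Rightarrow> real" where
  "par v j = v $ coord j"

lemma par_eqI: "(\<And>j. j < CARD('n) \<Longrightarrow> par v j = par w j) \<Longrightarrow> v = w" for v w :: "real^'n::{finite,linorder}"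
proof (rule Finite_Cartesian_Product.vec_eq_iff[THEN iffD2, OF allI])
  fix i :: 'n
  assume *: "\<And>j. j < CARD('n) \<Longrightarrow> par v j = par w j"
  obtain j where "j < CARD('n)" "coord j = i"
    using bij_betw_imp_surj_on[OF bij_betw_coord[where 'n = 'n]] by (metis UNIV_I imageE lessThan_iff)
  then show "v $ i = w $ i" using *[of j] by (simp add: par_def)
qed

lemma continuous_on_par [continuous_intros]: "continuous_on S (\<lambda>v. par v j)"
  unfolding par_def by (intro continuous_intros)

lemma exists_par: "\<exists>v :: real^'n::{finite,linorder}. \<forall>j<CARD('n). par v j = f j"
proof (intro exI allI impI)
  fix j assume "j < CARD('n)"
  then show "par (\<chi> i :: 'n. f (inv_into {..<CARD('n)} coord i)) j = f j"
    using bij_betw_inv_into_left[OF bij_betw_coord[where 'n = 'n], of j] by (simp add: par_def)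
qed

text \<open>Here \<open>k\<close> is the number of moving nodes and \<open>q 0, \<dots>, q (e - 1)\<close> are the fixed nodes. Since these are
  increasing and taken from the two end points, \<open>e \<le> 2\<close>.\<close>
locale principal_parametrization = chebyshev_curve \<gamma> \<gamma>' a b
  for \<gamma> \<gamma>' :: "real \<Rightarrow> real^'n::{finite,linorder}" and a b :: real +
  fixes k e :: nat and q :: "nat \<Rightarrow> real"
  assumes dim: "2 * k + e = Suc CARD('n)"
    and q_end: "\<And>i. i < e \<Longrightarrow> q i \<in> {a, b}"
    and q_strict: "\<And>i j. i < j \<Longrightarrow> j < e \<Longrightarrow> q i < q j"
begin

text \<open>The nodes are numbered from \<open>0\<close> to \<open>m\<close>. The weight of node \<open>0\<close> is determined by the others. The first
  \<open>m\<close> parameters are the weights of the nodes \<open>1, \<dots>, m\<close> and the last \<open>k\<close> are the moving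
  nodes, which is the order of the columns in the determinants of the statement.\<close>
definition m :: nat where "m = k + e - 1"

lemma m_simps: "Suc m = k + e" "m + k = CARD('n)"
proof -
  have "CARD('n) > 0" by simp
  then show "Suc m = k + e" "m + k = CARD('n)" using dim unfolding m_def by linarith+
qed

text \<open>The numbering puts the fixed nodes first, whatever their values are: with \<open>b\<close> as the only fixed
  node, node \<open>0\<close> is the largest one.\<close>
definition node :: "(nat \<Rightarrow> real) \<Rightarrow> nat \<Rightarrow> real" where
  "node f j = (if j < e then q j else f (m + (j - e)))"

definition wt :: "(nat \<Rightarrow> real) \<Rightarrow> nat \<Rightarrow> real" where
  "wt f j = (case j of 0 \<Rightarrow> 1 - (\<Sum>i<m. f i) | Suc i \<Rightarrow> f i)"

definition U :: "real^'n::_ \<Rightarrow> real^'n::_" where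
  "U v = (\<Sum>j\<le>m. wt (par v) j *\<^sub>R \<gamma> (node (par v) j))"

definition closed_dom :: "(nat \<Rightarrow> real) \<Rightarrow> bool" where
  "closed_dom f \<longleftrightarrow> (\<forall>j\<in>{..m}. 0 \<le> wt f j) \<and> (\<forall>i\<in>{..<k}. a \<le> f (m + i) \<and> f (m + i) \<le> b) \<and>
    (\<forall>i\<in>{i. Suc i < k}. f (m + i) \<le> f (m + Suc i))"

definition open_dom :: "(nat \<Rightarrow> real) \<Rightarrow> bool" where
  "open_dom f \<longleftrightarrow> (\<forall>j\<in>{..m}. 0 < wt f j) \<and> (\<forall>i\<in>{..<k}. a < f (m + i) \<and> f (m + i) < b) \<and>
    (\<forall>i\<in>{i. Suc i < k}. f (m + i) < f (m + Suc i))"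

definition chamber :: "(nat \<Rightarrow> real) \<Rightarrow> bool" where
  "chamber f \<longleftrightarrow> (\<forall>i\<in>{..<k}. a < f (m + i) \<and> f (m + i) < b) \<and>
    (\<forall>i\<in>{i. Suc i < k}. f (m + i) < f (m + Suc i))"

lemma open_dom_iff: "open_dom f \<longleftrightarrow> (\<forall>j\<in>{..m}. 0 < wt f j) \<and> chamber f"
  unfolding open_dom_def chamber_def ..

abbreviation K :: "(real^'n::_) set" where "K \<equiv> {v. closed_dom (par v)}"
abbreviation D :: "(real^'n::_) set" where "D \<equiv> {v. open_dom (par v)}"

lemma node_cases:
  assumes "j \<le> m"
  obtains "j < e" "\<And>f. node f j = q j" | i where "i < k" "j = e + i" "\<And>f. node f j = f (m + i)"
proof (cases "j < e")
  case False
  then have "j = e + (j - e)" "j - e < k" using assms m_simps by linarith+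
  then show ?thesis using that(2)[of "j - e"] False unfolding node_def by simp
qed (use that(1) in \<open>auto simp: node_def\<close>)

lemma finite_Suc_less: "finite {i. Suc i < k}"
  by (rule finite_subset[of _ "{..<k}"]) auto

lemma sum_wt: "(\<Sum>j\<le>m. wt f j) = 1"
  unfolding wt_def lessThan_Suc_atMost[symmetric] sum.lessThan_Suc_shift by simp

lemma continuous_on_wt [continuous_intros]: "continuous_on S (\<lambda>v. wt (par v) j)"
  unfolding wt_def by (cases j) (auto intro!: continuous_intros)

lemma continuous_on_node [continuous_intros]: "continuous_on S (\<lambda>v. node (par v) j)"
  unfolding node_def by (cases "j < e") (auto intro!: continuous_intros)

lemma open_D: "open D"
proof -
  have "D = (\<Inter>j\<in>{..m}. {v. 0 < wt (par v) j}) \<inter> (\<Inter>i\<in>{..<k}. {v. a < par v (m + i)} \<inter> {v. par v (m + i) < b})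
    \<inter> (\<Inter>i\<in>{i. Suc i < k}. {v. par v (m + i) < par v (m + Suc i)})"
    unfolding open_dom_def by auto
  also have "open \<dots>"
    by (intro open_Int open_INT ballI open_Collect_less continuous_intros finite_Suc_less) auto
  finally show ?thesis .
qed

lemma closed_K: "closed K"
proof -
  have "K = (\<Inter>j\<in>{..m}. {v. 0 \<le> wt (par v) j}) \<inter> (\<Inter>i\<in>{..<k}. {v. a \<le> par v (m + i)} \<inter> {v. par v (m + i) \<le> b})
    \<inter> (\<Inter>i\<in>{i. Suc i < k}. {v. par v (m + i) \<le> par v (m + Suc i)})"
    unfolding closed_dom_def by auto
  also have "closed \<dots>"
    by (intro closed_Int closed_INT ballI closed_Collect_le continuous_intros)
  finally show ?thesis .
qed

text \<open>The weights lie in the unit interval and the nodes between \<open>a\<close> and \<open>b\<close>.\<close>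
lemma compact_K: "compact K"
proof -
  define M where "M = 1 + \<bar>a\<bar> + \<bar>b\<bar>"
  have "\<bar>par v j\<bar> \<le> M" if v: "v \<in> K" and j: "j < CARD('n)" for v j
  proof (cases "j < m")
    case True
    have nonneg: "0 \<le> par v i" if "i < m" for i
      using v that unfolding closed_dom_def by (auto simp: wt_def dest!: bspec[of _ _ "Suc i"])
    have "0 \<le> wt (par v) 0" using v unfolding closed_dom_def by auto
    then have "(\<Sum>i<m. par v i) \<le> 1" by (simp add: wt_def)
    moreover have "par v j \<le> (\<Sum>i<m. par v i)"
      using True nonneg by (intro member_le_sum) auto
    ultimately show ?thesis using nonneg[OF True] unfolding M_def by linarith
  next
    case False
    then have "j - m < k" "m + (j - m) = j" using j m_simps by linarith+
    then have "a \<le> par v j \<and> par v j \<le> b"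
      using v unfolding closed_dom_def by (auto dest!: bspec[of "{..<k}" _ "j - m"])
    then show ?thesis unfolding M_def by linarith
  qed
  note par_bound = this
  have "\<bar>v $ i\<bar> \<le> M" if "v \<in> K" for v and i :: 'n
  proof -
    have "i \<in> coord ` {..<CARD('n)}" using bij_betw_imp_surj_on[OF bij_betw_coord[where 'n = 'n]] by simp
    then obtain j where "j < CARD('n)" "i = coord j" by auto
    then show ?thesis using par_bound[OF that, of j] by (simp add: par_def)
  qed
  then have "K \<subseteq> cbox (\<chi> i. - M) (\<chi> i. M)"
    by (auto simp: mem_box_cart abs_le_iff minus_le_iff)
  then show ?thesis using closed_K bounded_cbox bounded_subset compact_eq_bounded_closed by blast
qed

lemma D_subset_K: "D \<subseteq> K"
  unfolding closed_dom_def open_dom_def by (auto simp: less_imp_le)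

lemma node_range:
  assumes "closed_dom f" "j \<le> m"
  shows "node f j \<in> {a..b}"
  using assms(2)
proof (cases rule: node_cases)
  case 1
  then show ?thesis using q_end[of j] a_less_b by auto
next
  case (2 i)
  then show ?thesis using assms(1) unfolding closed_dom_def by auto
qed

lemma continuous_on_U: "continuous_on K U"
  unfolding U_def
  by (intro continuous_intros continuous_on_compose2[OF cont]) (use node_range in auto)

lemma U_in_hull:
  assumes "v \<in> K" "J \<subseteq> {..m}" "\<And>j. j \<in> {..m} - J \<Longrightarrow> wt (par v) j = 0"
  shows "U v \<in> convex hull (\<gamma> ` node (par v) ` J)"
proof -
  have fin: "finite J" using assms(2) finite_subset by blast
  have U: "U v = (\<Sum>j\<in>J. wt (par v) j *\<^sub>R \<gamma> (node (par v) j))"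
    unfolding U_def using assms(2,3) by (intro sum.mono_neutral_right) auto
  have one: "(\<Sum>j\<in>J. wt (par v) j) = 1"
    using sum_wt[of "par v"] assms(2,3) by (subst (asm) sum.mono_neutral_right[of _ J]) auto
  show ?thesis unfolding U
    by (rule convex_sum[OF fin convex_convex_hull one])
       (use assms(1,2) in \<open>auto simp: closed_dom_def intro: hull_inc\<close>)
qed

lemma U_K_subset: "U ` K \<subseteq> convex hull (\<gamma> ` {a..b})"
proof
  fix p assume "p \<in> U ` K"
  then obtain v where v: "v \<in> K" "p = U v" by blast
  have "U v \<in> convex hull (\<gamma> ` node (par v) ` {..m})" by (rule U_in_hull) (use v in auto)
  also have "\<dots> \<subseteq> convex hull (\<gamma> ` {a..b})"
    using v node_range by (intro hull_mono image_mono) auto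
  finally show "p \<in> convex hull (\<gamma> ` {a..b})" using v by simp
qed

lemma chamber_strict_mono:
  assumes "chamber f" "i < j" "j < k"
  shows "f (m + i) < f (m + j)"
  using assms(2,3)
proof (induction j)
  case (Suc j)
  have "f (m + j) < f (m + Suc j)" using assms(1) Suc.prems unfolding chamber_def by auto
  then show ?case using Suc by (cases "i = j") auto
qed simp

lemma inj_on_node:
  assumes f: "open_dom f"
  shows "inj_on (node f) {..m}"
proof (rule linorder_inj_onI')
  fix i j assume ij: "i \<in> {..m}" "j \<in> {..m}" "i < j"
  have le: "i \<le> m" "j \<le> m" using ij by auto
  show "node f i \<noteq> node f j"
    using le(2)
  proof (cases rule: node_cases)
    case 1
    then show ?thesis using ij q_strict[of i j] by (auto simp: node_def)
  next
    case j: (2 j')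
    then have fj: "f (m + j') \<notin> {a, b}" using f unfolding open_dom_def by auto
    show ?thesis using le(1)
    proof (cases rule: node_cases)
      case 1
      then show ?thesis using q_end[of i] fj j by auto
    next
      case (2 i')
      then show ?thesis using chamber_strict_mono[of f i' j'] f j ij by (auto simp: open_dom_iff)
    qed
  qed
qed

lemma nodes_interior:
  assumes f: "open_dom f"
  shows "(\<lambda>i. f (m + i)) ` {..<k} = node f ` {..m} \<inter> {a<..<b}"
proof (intro equalityI subsetI)
  fix t assume "t \<in> (\<lambda>i. f (m + i)) ` {..<k}"
  then obtain i where i: "i < k" "t = f (m + i)" by auto
  then have "t = node f (e + i)" "e + i \<in> {..m}" using m_simps by (auto simp: node_def)
  moreover have "t \<in> {a<..<b}" using i f by (auto simp: open_dom_def)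
  ultimately show "t \<in> node f ` {..m} \<inter> {a<..<b}" by blast
next
  fix t assume "t \<in> node f ` {..m} \<inter> {a<..<b}"
  then obtain j where j: "j \<le> m" "t = node f j" "a < t" "t < b" by auto
  from j(1) show "t \<in> (\<lambda>i. f (m + i)) ` {..<k}"
    by (cases rule: node_cases) (use j q_end[of j] in auto)
qed

text \<open>The weighted nodes of the two parameters are read as functions \<open>W f\<close> and \<open>W f'\<close> on a common set \<open>T\<close> of
  nodes. Since \<open>T\<close> has at most \<open>e + 2 k = n + 1\<close> elements, the points of the curve at \<open>T\<close> are affinely
  independent and the two functions agree. All weights are positive, and so the sets of nodes agree, too;
  the moving nodes are recovered from their set because they are increasing.\<close>
lemma inj_on_U: "inj_on U D"
proof (rule inj_onI)
  fix v v' assume v: "v \<in> D" and v': "v' \<in> D" and eq: "U v = U v'"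
  define f f' where "f = par v" and "f' = par v'"
  have f: "open_dom f" "open_dom f'" using v v' by (auto simp: f_def f'_def)
  have cf: "closed_dom f" "closed_dom f'" using v v' D_subset_K by (auto simp: f_def f'_def)
  define T where "T = node f ` {..m} \<union> node f' ` {..m}"
  define W where "W = (\<lambda>g t. \<Sum>j\<le>m. if node g j = t then wt g j else 0)"
  have finT: "finite T" unfolding T_def by simp
  have Tab: "T \<subseteq> {a..b}" unfolding T_def using node_range cf by auto
  have "T \<subseteq> q ` {..<e} \<union> (\<lambda>i. f (m + i)) ` {..<k} \<union> (\<lambda>i. f' (m + i)) ` {..<k}"
  proof -
    have "node g j \<in> q ` {..<e} \<union> (\<lambda>i. g (m + i)) ` {..<k}" if "j \<le> m" for g j
      using that by (cases rule: node_cases) auto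
    then show ?thesis unfolding T_def by auto
  qed
  then have "card T \<le> card (q ` {..<e} \<union> (\<lambda>i. f (m + i)) ` {..<k} \<union> (\<lambda>i. f' (m + i)) ` {..<k})"
    by (intro card_mono) auto
  also have "\<dots> \<le> e + k + k"
    by (intro order_trans[OF card_Un_le] add_mono order_trans[OF card_image_le]) auto
  finally have cT: "card T \<le> Suc CARD('n)" using dim by linarith
  have sumW: "(\<Sum>t\<in>T. W g t * h t) = (\<Sum>j\<le>m. wt g j * h (node g j))"
    "(\<Sum>t\<in>T. W g t *\<^sub>R \<gamma> t) = (\<Sum>j\<le>m. wt g j *\<^sub>R \<gamma> (node g j))" if "g = f \<or> g = f'" for g h
  proof -
    have inT: "node g j \<in> T" if "j \<le> m" for j using that \<open>g = f \<or> g = f'\<close> unfolding T_def by auto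
    have "(\<Sum>t\<in>T. W g t * h t) = (\<Sum>j\<le>m. \<Sum>t\<in>T. if t = node g j then wt g j * h t else 0)"
      unfolding W_def sum_distrib_right by (subst sum.swap) (auto intro!: sum.cong)
    also have "\<dots> = (\<Sum>j\<le>m. wt g j * h (node g j))"
      using inT finT by (intro sum.cong) (auto simp: sum.delta')
    finally show "(\<Sum>t\<in>T. W g t * h t) = (\<Sum>j\<le>m. wt g j * h (node g j))" .
    have "(\<Sum>t\<in>T. W g t *\<^sub>R \<gamma> t) = (\<Sum>j\<le>m. \<Sum>t\<in>T. if t = node g j then wt g j *\<^sub>R \<gamma> t else 0)"
      unfolding W_def scaleR_sum_left by (subst sum.swap) (auto intro!: sum.cong)
    also have "\<dots> = (\<Sum>j\<le>m. wt g j *\<^sub>R \<gamma> (node g j))"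
      using inT finT by (intro sum.cong) (auto simp: sum.delta')
    finally show "(\<Sum>t\<in>T. W g t *\<^sub>R \<gamma> t) = (\<Sum>j\<le>m. wt g j *\<^sub>R \<gamma> (node g j))" .
  qed
  have W_eq: "W f t = W f' t" if "t \<in> T" for t
  proof -
    have "W f t - W f' t = 0"
    proof (rule curve_points_affinely_independent[OF finT Tab cT _ _ that])
      show "(\<Sum>t\<in>T. W f t - W f' t) = 0"
        using sumW(1)[of f "\<lambda>_. 1"] sumW(1)[of f' "\<lambda>_. 1"] sum_wt by (simp add: sum_subtractf)
      show "(\<Sum>t\<in>T. (W f t - W f' t) *\<^sub>R \<gamma> t) = 0"
        using sumW(2) eq unfolding U_def f_def[symmetric] f'_def[symmetric]
        by (simp add: scaleR_left_diff_distrib sum_subtractf)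
    qed
    then show ?thesis by simp
  qed
  have W_node: "W g (node g j) = wt g j" if "j \<le> m" "open_dom g" for g j
  proof -
    have "W g (node g j) = (\<Sum>i\<le>m. if i = j then wt g i else 0)"
      unfolding W_def using inj_on_node[OF that(2)] that(1)
      by (intro sum.cong) (auto simp: inj_on_eq_iff)
    then show ?thesis using that by (simp add: sum.delta)
  qed
  have W_zero: "W g t = 0" if "t \<notin> node g ` {..m}" for g t
    unfolding W_def using that by (intro sum.neutral) auto
  have pos: "wt g j > 0" if "open_dom g" "j \<le> m" for g j using that unfolding open_dom_def by auto
  have sub: "node g ` {..m} \<subseteq> node g' ` {..m}"
    if g: "open_dom g" "node g ` {..m} \<subseteq> T" and eq: "\<And>t. t \<in> T \<Longrightarrow> W g t = W g' t" for g g'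
  proof
    fix t assume t: "t \<in> node g ` {..m}"
    then have "W g t > 0" using W_node g pos by auto
    then show "t \<in> node g' ` {..m}" using eq[of t] t g W_zero[of t g'] by force
  qed
  have "node f ` {..m} = node f' ` {..m}"
    using sub[OF f(1), of f'] sub[OF f(2), of f] W_eq unfolding T_def by (intro equalityI) auto
  then have img: "(\<lambda>i. f (m + i)) ` {..<k} = (\<lambda>i. f' (m + i)) ` {..<k}"
    unfolding nodes_interior[OF f(1)] nodes_interior[OF f(2)] by simp
  have sorted: "sorted_wrt (<) (map (\<lambda>i. g (m + i)) [0..<k])" if "open_dom g" for g
    using chamber_strict_mono[of g] that by (auto simp: open_dom_iff sorted_wrt_iff_nth_less)
  have "map (\<lambda>i. f (m + i)) [0..<k] = map (\<lambda>i. f' (m + i)) [0..<k]"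
    by (rule strict_sorted_equal) (use sorted f img in \<open>auto simp: atLeast0LessThan\<close>)
  then have x_eq: "f (m + i) = f' (m + i)" if "i < k" for i using that by (auto simp: list_eq_iff_nth_eq)
  have node_eq: "node f j = node f' j" if "j \<le> m" for j
    using that by (cases rule: node_cases) (auto simp: x_eq)
  have wt_eq: "wt f j = wt f' j" if "j \<le> m" for j
    using W_node[OF that f(1)] W_node[OF that f(2)] W_eq[of "node f j"] node_eq[OF that] that
    unfolding T_def by auto
  show "v = v'"
  proof (rule par_eqI)
    fix j assume j: "j < CARD('n)"
    show "par v j = par v' j"
    proof (cases "j < m")
      case True
      then show ?thesis using wt_eq[of "Suc j"] by (simp add: wt_def f_def f'_def)
    next
      case False
      then have "m + (j - m) = j" "j - m < k" using j m_simps by linarith+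
      then show ?thesis using x_eq[of "j - m"] by (simp add: f_def f'_def)
    qed
  qed
qed

text \<open>On the boundary of the domain a weight vanishes, a moving node hits an end point, or two moving nodes
  collide. In each case the total multiplicity of the nodes that are really used drops from \<open>n + 1\<close> to
  at most \<open>n\<close>, and \<open>hull_of_few_points_misses_interior\<close> applies.\<close>
lemma U_boundary:
  assumes v: "v \<in> K - D"
  shows "U v \<notin> interior (convex hull (\<gamma> ` {a..b}))"
proof -
  define f where "f = par v"
  have f: "closed_dom f" "\<not> open_dom f" using v by (auto simp: f_def)
  define J where "J = {j\<in>{..m}. wt f j \<noteq> 0}"
  define \<nu> :: "nat \<Rightarrow> nat" where "\<nu> j = (if j < e then 1 else 2)" for j
  have sum_\<nu>: "(\<Sum>j\<le>m. \<nu> j) = Suc CARD('n)"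
  proof -
    have "(\<Sum>j\<le>m. \<nu> j) = (\<Sum>j\<in>{..<k+e}. \<nu> j)" unfolding m_simps(1)[symmetric] lessThan_Suc_atMost ..
    also have "\<dots> = (\<Sum>j\<in>{..<e}. \<nu> j) + (\<Sum>j\<in>{e..<k+e}. \<nu> j)"
      by (subst sum.union_disjoint[symmetric]) (auto intro!: sum.cong)
    also have "\<dots> = e + 2 * k" by (simp add: \<nu>_def)
    finally show ?thesis using dim by simp
  qed
  have le_\<nu>: "node_weight (node f j) \<le> \<nu> j" if "j \<le> m" for j
    using q_end[of j] unfolding \<nu>_def node_weight_def node_def by auto
  have bound: "(\<Sum>t\<in>node f ` I. node_weight t) \<le> (\<Sum>j\<in>I. node_weight (node f j))" if "finite I" for I
    using sum_image_le[of I node_weight "node f"] that by (simp add: o_def)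
  have drop: "(\<Sum>t\<in>node f ` ({..m} - {j}). node_weight t) \<le> CARD('n)" if "j \<le> m" for j
  proof -
    have "(\<Sum>t\<in>node f ` ({..m} - {j}). node_weight t) \<le> (\<Sum>i\<in>{..m} - {j}. \<nu> i)"
      by (rule order_trans[OF bound]) (auto intro!: sum_mono le_\<nu>)
    moreover have "(\<Sum>i\<in>{..m}. \<nu> i) = \<nu> j + (\<Sum>i\<in>{..m} - {j}. \<nu> i)"
      using that by (intro sum.remove) auto
    moreover have "\<nu> j \<ge> 1" by (simp add: \<nu>_def)
    ultimately show ?thesis using sum_\<nu> by linarith
  qed
  have mono: "(\<Sum>t\<in>node f ` J. node_weight t) \<le> (\<Sum>t\<in>B. node_weight t)" if "finite B" "node f ` J \<subseteq> B" for B
    using that by (intro sum_mono2) auto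
  have node_x: "node f (e + i) = f (m + i)" "e + i \<le> m" if "i < k" for i
    using that m_simps by (auto simp: node_def)
  have "(\<exists>j\<in>{..m}. wt f j = 0) \<or> (\<exists>i\<in>{..<k}. f (m + i) \<in> {a, b}) \<or>
      (\<exists>i\<in>{i. Suc i < k}. f (m + i) = f (m + Suc i))"
  proof (rule ccontr)
    assume neg: "\<not> ?thesis"
    have "open_dom f"
      unfolding open_dom_def
    proof (intro conjI ballI)
      fix j assume j: "j \<in> {..m}"
      have "0 \<le> wt f j" using f(1) j unfolding closed_dom_def by blast
      moreover have "wt f j \<noteq> 0" using neg j by blast
      ultimately show "0 < wt f j" by simp
    next
      fix i assume i: "i \<in> {..<k}"
      have "a \<le> f (m + i)" "f (m + i) \<le> b" using f(1) i unfolding closed_dom_def by blast+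
      moreover have "f (m + i) \<noteq> a" "f (m + i) \<noteq> b" using neg i by blast+
      ultimately show "a < f (m + i)" "f (m + i) < b" by simp_all
    next
      fix i assume i: "i \<in> {i. Suc i < k}"
      have "f (m + i) \<le> f (m + Suc i)" using f(1) i unfolding closed_dom_def by blast
      moreover have "f (m + i) \<noteq> f (m + Suc i)" using neg i by blast
      ultimately show "f (m + i) < f (m + Suc i)" by simp
    qed
    then show False using f(2) by contradiction
  qed
  then consider j where "j \<le> m" "wt f j = 0"
    | i where "i < k" "f (m + i) \<in> {a, b}"
    | i where "Suc i < k" "f (m + i) = f (m + Suc i)"
    by blast
  then have "(\<Sum>t\<in>node f ` J. node_weight t) \<le> CARD('n)"
  proof cases
    case 1
    then have "node f ` J \<subseteq> node f ` ({..m} - {j})" unfolding J_def by auto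
    then show ?thesis using mono drop[OF 1(1)] by (meson finite_Diff finite_atMost finite_imageI order_trans)
  next
    case 2
    have "(\<Sum>t\<in>node f ` J. node_weight t) \<le> (\<Sum>t\<in>node f ` {..m}. node_weight t)"
      by (rule mono) (auto simp: J_def)
    also have "\<dots> \<le> (\<Sum>j\<le>m. node_weight (node f j))" by (rule bound) simp
    also have "\<dots> < (\<Sum>j\<le>m. \<nu> j)"
      by (rule sum_strict_mono_ex1)
         (use le_\<nu> node_x[OF 2(1)] 2(2) in \<open>auto simp: node_weight_def \<nu>_def intro!: bexI[of _ "e + i"]\<close>)
    finally show ?thesis using sum_\<nu> by simp
  next
    case 3
    have "node f ` J \<subseteq> node f ` ({..m} - {e + i})"
    proof
      fix t assume "t \<in> node f ` J"
      then obtain j where j: "j \<le> m" "t = node f j" unfolding J_def by auto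
      show "t \<in> node f ` ({..m} - {e + i})"
      proof (cases "j = e + i")
        case True
        then have "t = node f (e + Suc i)" using node_x[of i] node_x[of "Suc i"] 3 j by auto
        then show ?thesis using node_x[OF 3(1)] by (intro image_eqI[of _ _ "e + Suc i"]) auto
      qed (use j in auto)
    qed
    then have "(\<Sum>t\<in>node f ` J. node_weight t) \<le> (\<Sum>t\<in>node f ` ({..m} - {e + i}). node_weight t)"
      by (intro mono) auto
    also have "\<dots> \<le> CARD('n)" using drop[of "e + i"] node_x(2)[of i] 3(1) by simp
    finally show ?thesis .
  qed
  moreover have "U v \<in> convex hull (\<gamma> ` node f ` J)"
    unfolding f_def by (rule U_in_hull) (use v in \<open>auto simp: J_def f_def\<close>)
  moreover have "node f ` J \<subseteq> {a..b}" using node_range[OF f(1)] unfolding J_def by auto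
  moreover have "finite (node f ` J)" unfolding J_def by simp
  ultimately show ?thesis using hull_of_few_points_misses_interior[of "node f ` J"] by blast
qed

lemma D_nonempty: "D \<noteq> {}"
proof -
  obtain v :: "real^'n::_" where v: "\<And>j. j < CARD('n) \<Longrightarrow>
      par v j = (if j < m then 1 / real (Suc m) else a + (b - a) * (real (Suc (j - m)) / real (Suc k)))"
    using exists_par[of "\<lambda>j. if j < m then 1 / real (Suc m)
      else a + (b - a) * (real (Suc (j - m)) / real (Suc k))"] by blast
  have x: "par v (m + i) = a + (b - a) * (real (Suc i) / real (Suc k))" if "i < k" for i
    using v[of "m + i"] that m_simps by simp
  have l: "par v i = 1 / real (Suc m)" if "i < m" for i using v[of i] that m_simps by simp
  have "open_dom (par v)"
    unfolding open_dom_def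
  proof (intro conjI ballI)
    fix j assume "j \<in> {..m}"
    then show "0 < wt (par v) j" by (cases j) (auto simp: wt_def l field_simps)
  next
    fix i assume "i \<in> {..<k}"
    then have i: "i < k" by simp
    have r: "0 < real (Suc i) / real (Suc k)" "real (Suc i) / real (Suc k) < 1" using i by auto
    show "a < par v (m + i)" using r a_less_b by (simp add: x[OF i])
    have "(b - a) * (real (Suc i) / real (Suc k)) < (b - a) * 1"
      using r a_less_b by (intro mult_strict_left_mono) auto
    then show "par v (m + i) < b" by (simp add: x[OF i])
  next
    fix i assume "i \<in> {i. Suc i < k}"
    then have i: "Suc i < k" by simp
    have "(b - a) * (real (Suc i) / real (Suc k)) < (b - a) * (real (Suc (Suc i)) / real (Suc k))"
      using a_less_b by (intro mult_strict_left_mono divide_strict_right_mono) auto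
    then show "par v (m + i) < par v (m + Suc i)" using x[of i] x[of "Suc i"] i by simp
  qed
  then show ?thesis by blast
qed

text \<open>The image is open by invariance of domain, and closed in the interior of the hull because the boundary
  of the compact domain \<open>K\<close> is mapped outside of this interior.\<close>
lemma U_image: "U ` D = interior (convex hull (\<gamma> ` {a..b}))"
proof -
  let ?I = "interior (convex hull (\<gamma> ` {a..b}))"
  have op: "open (U ` D)"
    by (rule invariance_of_domain[OF _ open_D inj_on_U])
       (rule continuous_on_subset[OF continuous_on_U D_subset_K])
  have sub: "U ` D \<subseteq> ?I"
    by (rule interior_maximal[OF _ op]) (use U_K_subset D_subset_K in blast)
  have "closed (U ` K)" using compact_continuous_image[OF continuous_on_U compact_K] compact_imp_closed by blast
  moreover have "U ` D = ?I \<inter> U ` K" using sub U_boundary D_subset_K by blast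
  ultimately have "closedin (top_of_set ?I) (U ` D)" by (simp add: closedin_closed_Int)
  moreover have "openin (top_of_set ?I) (U ` D)" using op sub by (simp add: open_subset)
  moreover have "connected ?I" by (simp add: convex_connected convex_interior convex_convex_hull)
  ultimately show ?thesis using D_nonempty unfolding connected_clopen by blast
qed

lemma measure_hull_eq_image: "measure lebesgue (convex hull (\<gamma> ` {a..b})) = measure lebesgue (U ` D)"
  "U ` D \<in> lmeasurable"
proof -
  have "compact (\<gamma> ` {a..b})" using cont by (intro compact_continuous_image) auto
  then have bd: "bounded (convex hull (\<gamma> ` {a..b}))" using bounded_convex_hull compact_imp_bounded by blast
  show "measure lebesgue (convex hull (\<gamma> ` {a..b})) = measure lebesgue (U ` D)"
    unfolding U_image
    by (rule measure_interior[OF bd negligible_convex_frontier[OF convex_convex_hull], symmetric])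
  show "U ` D \<in> lmeasurable" unfolding U_image by (rule lmeasurable_interior[OF bd])
qed

end

section \<open>The Jacobian determinant and its sign\<close>

context chebyshev_curve
begin

abbreviation u :: "real \<Rightarrow> nat \<Rightarrow> real" where "u t \<equiv> homog 1 (\<gamma> t)"
abbreviation u' :: "real \<Rightarrow> nat \<Rightarrow> real" where "u' t \<equiv> homog 0 (\<gamma>' t)"

lemma u_deriv:
  assumes "t \<in> {a<..<b}"
  shows "((\<lambda>t. u t i) has_real_derivative u' t i) (at t)"
proof (cases i)
  case (Suc j)
  have "((\<lambda>t. \<gamma> t $ coord j) has_vector_derivative \<gamma>' t $ coord j) (at t)"
    by (rule bounded_linear.has_vector_derivative[OF bounded_linear_vec_nth deriv[OF assms]])
  then show ?thesis using Suc by (simp add: has_real_derivative_iff_has_vector_derivative)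
qed simp

text \<open>A column \<open>u' x\<close> next to \<open>u x\<close> is the limit of difference quotients of \<open>u\<close> from the right, and in these
  the subtracted column is the neighbour, which drops out. Replacing the pairs one at a time, the
  determinant is a limit of nonnegative ones. The weak inequality determines the absolute value of the
  Jacobian determinant, which is all that the change of variables formula asks for.\<close>
lemma confluent_dets_nonneg:
  assumes "sorted_wrt (<) (ts @ xs @ bs)" "set ts \<union> set bs \<subseteq> {a..b}" "set xs \<subseteq> {a<..<b}"
    and "length ts + 2 * length xs + length bs = Suc CARD('n)"
  shows "dets (map u ts @ concat (map (\<lambda>x. [u x, u' x]) xs) @ map u bs) \<ge> 0"
  using assms
proof (induction xs arbitrary: ts)
  case Nil
  then show ?case using dets_pos[of "ts @ bs"] by simp
next
  case (Cons x xs)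
  define R where "R = concat (map (\<lambda>x. [u x, u' x]) xs) @ map u bs"
  have x: "x \<in> {a<..<b}" using Cons.prems by simp
  obtain C where C: "\<And>w. dets ((map u ts @ [u x]) @ w # R) =
      (\<Sum>i<Suc (length ((map u ts @ [u x]) @ R)). C i * w i)"
    using dets_linear_form by blast
  define G where "G = (\<lambda>y. dets ((map u ts @ [u x]) @ u y # R))"
  have G: "(G has_real_derivative dets ((map u ts @ [u x]) @ u' x # R)) (at x)"
    unfolding G_def C by (intro DERIV_sum DERIV_cmult u_deriv x)
  \<comment> \<open>So a negative derivative at \<open>x\<close> would make \<open>G\<close> negative slightly to the right of \<open>x\<close>.\<close>
  have Gx: "G x = 0"
    using dets_repeated[of "map u ts" "u x" "[]" R] by (simp add: G_def)
  show ?case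
  proof (rule ccontr)
    assume "\<not> ?case"
    then have "dets ((map u ts @ [u x]) @ u' x # R) < 0" by (simp add: R_def)
    then obtain d where d: "d > 0" "\<And>h. h > 0 \<Longrightarrow> h < d \<Longrightarrow> G (x + h) < G x"
      using DERIV_neg_dec_right[OF G] by blast
    define d' where "d' = Min ((\<lambda>z. z - x) ` insert b (set (xs @ bs)))"
    have "d' > 0" unfolding d'_def using x Cons.prems(1) by (auto simp: sorted_wrt_append)
    define h where "h = min d d' / 2"
    have h: "h > 0" "h < d" "h < d'" using d(1) \<open>d' > 0\<close> by (auto simp: h_def)
    have less: "x + h < z" if "z \<in> insert b (set (xs @ bs))" for z
    proof -
      have "d' \<le> z - x" unfolding d'_def using that by (intro Min_le) auto
      then show ?thesis using h by linarith
    qed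
    have "dets (map u (ts @ [x, x + h]) @ concat (map (\<lambda>x. [u x, u' x]) xs) @ map u bs) \<ge> 0"
    proof (rule Cons.IH)
      show "sorted_wrt (<) ((ts @ [x, x + h]) @ xs @ bs)"
        using Cons.prems(1) less h(1) by (auto simp: sorted_wrt_append)
      show "set (ts @ [x, x + h]) \<union> set bs \<subseteq> {a..b}"
        using Cons.prems(2) x h(1) less[of b] by auto
    qed (use Cons.prems in auto)
    then have "G (x + h) \<ge> 0" by (simp add: G_def R_def)
    then show False using d(2)[OF h(1,2)] Gx by simp
  qed
qed

end

lemma length_pairs: "length (concat (map (\<lambda>x. [f x, g x]) xs)) = 2 * length xs"
  by (induction xs) auto

lemma par_axis:
  assumes "i < CARD('n)" "j < CARD('n)"
  shows "par (axis (coord j) 1 :: real^'n::{finite,linorder}) i = (if i = j then 1 else 0)"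
  using bij_betw_imp_inj_on[OF bij_betw_coord[where 'n = 'n]] assms
  by (auto simp: par_def axis_def inj_on_eq_iff)

context principal_parametrization
begin

text \<open>The factor of the Jacobian determinant that depends on the nodes only. This is the integrand of
  the volume formulas.\<close>
definition coeff_det :: "(nat \<Rightarrow> real) \<Rightarrow> real" where
  "coeff_det f = dets (map (\<lambda>j r. (\<gamma> (node f (Suc j)) - \<gamma> (node f 0)) $ coord r) [0..<m] @
     map (\<lambda>i r. \<gamma>' (f (m + i)) $ coord r) [0..<k])"

text \<open>Passing to homogeneous coordinates adds a row and the column of node \<open>0\<close>.\<close>
lemma coeff_det_homog:
  "coeff_det f = dets (map (\<lambda>j. u (node f j)) [0..<Suc m] @ map (\<lambda>i. u' (f (m + i))) [0..<k])"
proof -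
  define X R where "X = map (\<lambda>j. u (node f (Suc j))) [0..<m]" and "R = map (\<lambda>i. u' (f (m + i))) [0..<k]"
  have split: "map (\<lambda>j. u (node f j)) [0..<Suc m] = u (node f 0) # X"
    unfolding X_def by (simp add: upt_conv_Cons map_Suc_upt[symmetric] o_def del: upt_Suc)
  have "dets (map (\<lambda>j. u (node f j)) [0..<Suc m] @ R) = dets (u (node f 0) # [] @ X @ R)"
    unfolding split by simp
  also have "\<dots> = dets (u (node f 0) # [] @ map (\<lambda>j r. u (node f (Suc j)) r - u (node f 0) r) [0..<m] @ R)"
    unfolding X_def by (rule dets_subtract_first[symmetric])
  also have "\<dots> = dets (map (\<lambda>v r. v (Suc r)) (map (\<lambda>j r. u (node f (Suc j)) r - u (node f 0) r) [0..<m] @ R))"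
    unfolding append_Nil by (rule dets_border) (auto simp: R_def)
  also have "\<dots> = coeff_det f"
    unfolding coeff_det_def R_def by (simp add: o_def)
  finally show ?thesis unfolding R_def by (rule sym)
qed

lemma end_nodes:
  obtains A B where "map q [0..<e] = A @ B" "A \<in> {[], [a]}" "B \<in> {[], [b]}"
proof -
  have "e \<le> 2"
  proof (rule ccontr)
    assume "\<not> e \<le> 2"
    then have e: "0 < e" "1 < e" "2 < e" by auto
    have "q 0 < q 1" "q 1 < q 2" using q_strict[of 0 1] q_strict[of 1 2] e by auto
    moreover have "q 0 = a \<or> q 0 = b" "q 1 = a \<or> q 1 = b" "q 2 = a \<or> q 2 = b"
      using q_end[OF e(1)] q_end[OF e(2)] q_end[OF e(3)] by blast+
    ultimately show False by (metis less_asym less_irrefl)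
  qed
  then consider "e = 0" | "e = 1" | "e = 2" by linarith
  then show thesis
  proof cases
    case 1
    then show ?thesis using that[of "[]" "[]"] by simp
  next
    case 2
    then show ?thesis using that[of "[a]" "[]"] that[of "[]" "[b]"] q_end[of 0] by auto
  next
    case 3
    then have "q 0 = a" "q 1 = b" using q_end[of 0] q_end[of 1] q_strict[of 0 1] a_less_b by auto
    then show ?thesis using 3 that[of "[a]" "[b]"] by (simp add: numeral_2_eq_2)
  qed
qed

text \<open>In homogeneous coordinates the columns are sorted into the order of the nodes, with \<open>u' x\<close> next to
  \<open>u x\<close>. This takes \<open>k (k - 1) / 2\<close> transpositions for the moving nodes; a fixed node \<open>b\<close> has to be moved
  to the end past \<open>2 k\<close> columns, which does not change the sign.\<close>
lemma coeff_det_sign: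
  assumes f: "chamber f"
  shows "(-1) ^ (k * (k - 1) div 2) * coeff_det f \<ge> 0"
proof -
  define xs where "xs = map (\<lambda>i. f (m + i)) [0..<k]"
  obtain A B where AB: "map q [0..<e] = A @ B" "A \<in> {[], [a]}" "B \<in> {[], [b]}"
    by (rule end_nodes)
  have lenAB: "length A + length B = e" using arg_cong[OF AB(1), of length] by simp
  have lenxs: "length xs = k" by (simp add: xs_def)
  have xs: "set xs \<subseteq> {a<..<b}" "sorted_wrt (<) xs"
    using f chamber_strict_mono[OF f] unfolding xs_def chamber_def by (auto simp: sorted_wrt_iff_nth_less)
  define P where "P = concat (map (\<lambda>x. [u x, u' x]) xs)"
  have P: "even (length P)" unfolding P_def length_pairs by simp
  have "map (\<lambda>j. u (node f j)) [0..<Suc m] = map (\<lambda>j. u (node f j)) [0..<e] @ map (\<lambda>j. u (node f (j + e))) [0..<k]"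
  proof -
    have "[0..<Suc m] = [0..<e] @ map (\<lambda>j. j + e) [0..<k]"
      unfolding m_simps(1) map_add_upt using upt_add_eq_append[of 0 e k] by (simp add: add.commute)
    then show ?thesis by (simp del: upt_Suc)
  qed
  moreover have "map (\<lambda>j. u (node f j)) [0..<e] = map u (map q [0..<e])"
    by (simp add: node_def)
  moreover have "map (\<lambda>j. u (node f (j + e))) [0..<k] = map u xs"
    by (simp add: node_def xs_def)
  ultimately have "map (\<lambda>j. u (node f j)) [0..<Suc m] = (map u A @ map u B) @ map u xs"
    unfolding AB(1) by simp
  moreover have "map (\<lambda>i. u' (f (m + i))) [0..<k] = map u' xs" by (simp add: xs_def)
  ultimately have "coeff_det f = dets ((map u A @ map u B) @ map u xs @ map u' xs @ [])"
    unfolding coeff_det_homog by simp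
  also have "\<dots> = (-1) ^ (k * (k - 1) div 2) * dets ((map u A @ map u B) @ P @ [])"
    unfolding dets_interleave P_def lenxs ..
  also have "dets ((map u A @ map u B) @ P @ []) = dets (map u A @ P @ map u B)"
    using AB(3) dets_move[of "map u A" P "u b" "[]"] P by auto
  finally have eq: "coeff_det f = (-1) ^ (k * (k - 1) div 2) * dets (map u A @ P @ map u B)" .
  have "dets (map u A @ P @ map u B) \<ge> 0"
    unfolding P_def
  proof (rule confluent_dets_nonneg)
    show "sorted_wrt (<) (A @ xs @ B)"
      using AB(2,3) xs a_less_b by (auto simp: sorted_wrt_append)
    show "set A \<union> set B \<subseteq> {a..b}" using AB(2,3) a_less_b by auto
    show "length A + 2 * length xs + length B = Suc CARD('n)"
      using lenAB lenxs dim by linarith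
  qed (rule xs)
  then show ?thesis unfolding eq by (simp add: power_add[symmetric] mult.assoc[symmetric])
qed

definition dwt :: "(nat \<Rightarrow> real) \<Rightarrow> nat \<Rightarrow> real" where
  "dwt d j = (case j of 0 \<Rightarrow> - (\<Sum>i<m. d i) | Suc i \<Rightarrow> d i)"

definition dnode :: "(nat \<Rightarrow> real) \<Rightarrow> nat \<Rightarrow> real" where
  "dnode d j = (if j < e then 0 else d (m + (j - e)))"

text \<open>The derivative of \<open>U\<close> at \<open>v\<close> in direction \<open>d\<close>.\<close>
definition U' :: "real^'n::_ \<Rightarrow> real^'n::_ \<Rightarrow> real^'n::_" where
  "U' v d = (\<Sum>j\<le>m. wt (par v) j *\<^sub>R (dnode (par d) j *\<^sub>R \<gamma>' (node (par v) j)) +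
      dwt (par d) j *\<^sub>R \<gamma> (node (par v) j))"

lemma has_derivative_par: "((\<lambda>v. par v j) has_derivative (\<lambda>d. par d j)) (at v)"
  unfolding par_def by (rule bounded_linear.has_derivative[OF bounded_linear_vec_nth]) simp

lemma U_has_derivative:
  assumes v: "v \<in> D"
  shows "(U has_derivative U' v) (at v)"
  unfolding U_def U'_def
proof (rule has_derivative_sum, rule has_derivative_scaleR)
  fix j assume j: "j \<in> {..m}"
  show "((\<lambda>v. wt (par v) j) has_derivative (\<lambda>d. dwt (par d) j)) (at v)"
  proof (cases j)
    case 0
    have "((\<lambda>v. 1 - (\<Sum>i<m. par v i)) has_derivative (\<lambda>d. 0 - (\<Sum>i<m. par d i))) (at v)"
      by (intro has_derivative_diff has_derivative_const has_derivative_sum has_derivative_par)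
    then show ?thesis using 0 by (simp add: wt_def dwt_def)
  qed (simp add: wt_def dwt_def has_derivative_par)
  show "((\<lambda>v. \<gamma> (node (par v) j)) has_derivative (\<lambda>d. dnode (par d) j *\<^sub>R \<gamma>' (node (par v) j))) (at v)"
  proof (cases "j < e")
    case True
    then show ?thesis by (simp add: node_def dnode_def)
  next
    case False
    define i where "i = j - e"
    have i: "i < k" using False j m_simps unfolding i_def by simp
    then have "par v (m + i) \<in> {a<..<b}" using v by (auto simp: open_dom_def)
    then have "(\<gamma> has_derivative (\<lambda>h. h *\<^sub>R \<gamma>' (par v (m + i)))) (at (par v (m + i)))"
      using deriv unfolding has_vector_derivative_def by blast
    from has_derivative_compose[OF has_derivative_par this]
    show ?thesis using False by (simp add: node_def dnode_def i_def)
  qed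
qed

lemma U'_axis_weight:
  assumes "j < m"
  shows "U' v (axis (coord j) 1) = \<gamma> (node (par v) (Suc j)) - \<gamma> (node (par v) 0)"
proof -
  define d where "d = par (axis (coord j) 1 :: real^'n::_)"
  have d: "d i = (if i = j then 1 else 0)" if "i < CARD('n)" for i
    using par_axis[OF that, of j] assms m_simps by (simp add: d_def)
  have dnode: "dnode d i = 0" if "i \<le> m" for i
    using that d[of "m + (i - e)"] assms m_simps by (auto simp: dnode_def)
  have dwt0: "dwt d 0 = - 1"
  proof -
    have "(\<Sum>i<m. d i) = (\<Sum>i<m. if i = j then 1 else 0)"
      using m_simps by (intro sum.cong) (auto simp: d)
    then show ?thesis using assms by (simp add: dwt_def)
  qed
  have dwtS: "dwt d (Suc i) = (if i = j then 1 else 0)" if "i < m" for i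
    using d[of i] that m_simps by (simp add: dwt_def)
  have "U' v (axis (coord j) 1) = (\<Sum>i\<le>m. dwt d i *\<^sub>R \<gamma> (node (par v) i))"
    unfolding U'_def d_def[symmetric] by (intro sum.cong) (auto simp: dnode)
  also have "\<dots> = - \<gamma> (node (par v) 0) + (\<Sum>i<m. dwt d (Suc i) *\<^sub>R \<gamma> (node (par v) (Suc i)))"
    unfolding lessThan_Suc_atMost[symmetric] sum.lessThan_Suc_shift by (simp add: dwt0)
  also have "(\<Sum>i<m. dwt d (Suc i) *\<^sub>R \<gamma> (node (par v) (Suc i))) =
      (\<Sum>i<m. if i = j then \<gamma> (node (par v) (Suc i)) else 0)"
    by (intro sum.cong) (auto simp: dwtS)
  also have "\<dots> = \<gamma> (node (par v) (Suc j))" using assms by simp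
  finally show ?thesis by simp
qed

lemma U'_axis_node:
  assumes "i < k"
  shows "U' v (axis (coord (m + i)) 1) = wt (par v) (e + i) *\<^sub>R \<gamma>' (par v (m + i))"
proof -
  define d where "d = par (axis (coord (m + i)) 1 :: real^'n::_)"
  have d: "d j = (if j = m + i then 1 else 0)" if "j < CARD('n)" for j
    using par_axis[OF that, of "m + i"] assms m_simps by (simp add: d_def)
  have dnode: "dnode d j = (if j = e + i then 1 else 0)" if "j \<le> m" for j
  proof (cases "j < e")
    case False
    then have "j - e < k" using that m_simps by linarith
    then show ?thesis using False d[of "m + (j - e)"] m_simps by (auto simp: dnode_def)
  qed (simp add: dnode_def)
  have dwt: "dwt d j = 0" if "j \<le> m" for j
    using that m_simps d by (cases j) (auto simp: dwt_def intro!: sum.neutral)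
  have ei: "e + i \<le> m" using assms m_simps by linarith
  have "U' v (axis (coord (m + i)) 1) =
      (\<Sum>j\<le>m. if j = e + i then wt (par v) j *\<^sub>R \<gamma>' (node (par v) j) else 0)"
    unfolding U'_def d_def[symmetric] by (intro sum.cong) (auto simp: dnode dwt)
  also have "\<dots> = wt (par v) (e + i) *\<^sub>R \<gamma>' (node (par v) (e + i))"
    using ei by simp
  finally show ?thesis by (simp add: node_def)
qed

definition weight_prod :: "(nat \<Rightarrow> real) \<Rightarrow> real" where
  "weight_prod f = (\<Prod>i<k. wt f (e + i))"

lemma jacobian_det:
  "dets (map (\<lambda>j r. U' v (axis (coord j) 1) $ coord r) [0..<CARD('n)]) =
    weight_prod (par v) * coeff_det (par v)"
proof -
  let ?f = "par v"
  have "[0..<CARD('n)] = [0..<m] @ map (\<lambda>i. i + m) [0..<k]"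
    unfolding m_simps(2)[symmetric] map_add_upt using upt_add_eq_append[of 0 m k] by (simp add: add.commute)
  then have "map (\<lambda>j r. U' v (axis (coord j) 1) $ coord r) [0..<CARD('n)] =
      map (\<lambda>j r. U' v (axis (coord j) 1) $ coord r) [0..<m] @
      map (\<lambda>i r. U' v (axis (coord (m + i)) 1) $ coord r) [0..<k]"
    by (simp add: add.commute)
  moreover have "map (\<lambda>j r. U' v (axis (coord j) 1) $ coord r) [0..<m] =
      map (\<lambda>j r. (\<gamma> (node ?f (Suc j)) - \<gamma> (node ?f 0)) $ coord r) [0..<m]"
    by (simp add: U'_axis_weight)
  moreover have "map (\<lambda>i r. U' v (axis (coord (m + i)) 1) $ coord r) [0..<k] =
      map (\<lambda>i r. wt ?f (e + i) * \<gamma>' (?f (m + i)) $ coord r) [0..<k]"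
    by (simp add: U'_axis_node)
  ultimately show ?thesis
    using dets_scale_columns[of "map (\<lambda>j r. (\<gamma> (node ?f (Suc j)) - \<gamma> (node ?f 0)) $ coord r) [0..<m]"
        "\<lambda>i. wt ?f (e + i)" "\<lambda>i r. \<gamma>' (?f (m + i)) $ coord r" "[0..<k]" "[]"]
    by (simp add: coeff_det_def weight_prod_def prod.list_conv_set_nth lessThan_atLeast0)
qed

end

section \<open>Change of variables in product coordinates\<close>

text \<open>The two Leibniz sums correspond to each other under conjugation of permutations with \<open>e\<close>, which
  preserves signs.\<close>
lemma det_eq_dets:
  fixes A :: "real^'m^'m" and e :: "nat \<Rightarrow> 'm::finite"
  assumes e: "bij_betw e {..<CARD('m)} UNIV"
  shows "Determinants.det A = dets (map (\<lambda>j i. A $ e i $ e j) [0..<CARD('m)])"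
proof -
  define n where "n = CARD('m)"
  have e': "inj_on e {0..<n}" "bij_betw e {0..<n} UNIV"
    using e unfolding n_def bij_betw_def atLeast0LessThan by auto
  let ?\<phi> = "map_permutation {0..<n} e"
  let ?\<psi> = "map_permutation UNIV (inv_into {0..<n} e)"
  have bij: "bij_betw ?\<phi> {p. p permutes {0..<n}} {p. p permutes (UNIV :: 'm set)}"
  proof (rule bij_betw_byWitness[where f' = ?\<psi>])
    show "\<forall>p\<in>{p. p permutes {0..<n}}. ?\<psi> (?\<phi> p) = p"
      using e' by (auto intro!: map_permutation_compose_inv)
    show "\<forall>p\<in>{p. p permutes UNIV}. ?\<phi> (?\<psi> p) = p"
      using e' by (auto intro!: map_permutation_compose_inv simp: bij_betw_inv_into bij_betw_inv_into_right)
    show "?\<phi> ` {p. p permutes {0..<n}} \<subseteq> {p. p permutes UNIV}"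
      using e' by (auto intro!: map_permutation_permutes)
    show "?\<psi> ` {p. p permutes UNIV} \<subseteq> {p. p permutes {0..<n}}"
      using e' by (auto intro!: map_permutation_permutes bij_betw_inv_into)
  qed
  have "dets (map (\<lambda>j i. A $ e i $ e j) [0..<n]) = Determinant.det (Matrix.mat n n (\<lambda>(i, j). A $ e i $ e j))"
    unfolding dets_def by (intro arg_cong[of _ _ Determinant.det] eq_matI) auto
  also have "\<dots> = (\<Sum>p\<in>{p. p permutes {0..<n}}. of_int (sign p) * (\<Prod>i=0..<n. A $ e i $ e (p i)))"
    by (subst det_def'[of _ n]) (auto intro!: sum.cong prod.cong dest: permutes_in_image)
  also have "\<dots> = (\<Sum>p\<in>{p. p permutes {0..<n}}. of_int (sign (?\<phi> p)) * (\<Prod>i\<in>UNIV. A $ i $ (?\<phi> p) i))"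
  proof (rule sum.cong[OF refl])
    fix p assume "p \<in> {p. p permutes {0..<n}}"
    then have p: "p permutes {0..<n}" by simp
    have "(\<Prod>i\<in>UNIV. A $ i $ (?\<phi> p) i) = (\<Prod>i\<in>{0..<n}. A $ e i $ (?\<phi> p) (e i))"
      using prod.reindex_bij_betw[OF e'(2), of "\<lambda>i. A $ i $ (?\<phi> p) i"] by simp
    also have "\<dots> = (\<Prod>i\<in>{0..<n}. A $ e i $ e (p i))"
      using e'(1) by (intro prod.cong) (auto simp: map_permutation_apply)
    finally show "of_int (sign p) * (\<Prod>i=0..<n. A $ e i $ e (p i)) =
        of_int (sign (?\<phi> p)) * (\<Prod>i\<in>UNIV. A $ i $ (?\<phi> p) i)"
      using sign_map_permutation[OF e'(1) p] by simp
  qed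
  also have "\<dots> = Determinants.det A"
    unfolding Determinants.det_def by (rule sum.reindex_bij_betw[OF bij])
  finally show ?thesis unfolding n_def ..
qed

lemma lborel_eq_distr_PiM:
  fixes e :: "nat \<Rightarrow> 'm::finite"
  assumes e: "bij_betw e {..<CARD('m)} UNIV"
  shows "(lborel :: (real^'m) measure) =
    distr (\<Pi>\<^sub>M i\<in>{..<CARD('m)}. lborel) borel (\<lambda>f. \<chi> i. f (inv_into {..<CARD('m)} e i))"
    (is "_ = distr ?P borel ?v")
proof (rule lborel_eqI)
  let ?n = "CARD('m)"
  interpret product_sigma_finite "\<lambda>_::nat. lborel :: real measure" by standard
  have inv: "inv_into {..<?n} e (e j) = j" if "j < ?n" for j
    using bij_betw_inv_into_left[OF e] that by simp
  have inv': "inv_into {..<?n} e i < ?n" "e (inv_into {..<?n} e i) = i" for i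
    using bij_betw_inv_into_right[OF e, of i] bij_betw_apply[OF bij_betw_inv_into[OF e], of i] by auto
  have meas: "?v \<in> measurable ?P borel"
    unfolding borel_measurable_euclidean_space[of ?v ?P]
  proof
    fix b :: "real^'m" assume "b \<in> Basis"
    then obtain i where b: "b = axis i 1" by (auto simp: Basis_vec_def)
    have "(\<lambda>f. f (inv_into {..<?n} e i)) \<in> borel_measurable ?P"
      using measurable_component_singleton[of "inv_into {..<?n} e i" "{..<?n}" "\<lambda>_. lborel"] inv'(1)[of i]
      by simp
    then show "(\<lambda>f. ?v f \<bullet> b) \<in> borel_measurable ?P"
      by (simp add: b cart_eq_inner_axis[symmetric])
  qed
  fix l u :: "real^'m" assume lu: "\<And>b. b \<in> Basis \<Longrightarrow> l \<bullet> b \<le> u \<bullet> b"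
  have lu': "l $ i \<le> u $ i" for i using lu[of "axis i 1"] by (simp add: cart_eq_inner_axis)
  have "?v -` box l u \<inter> space ?P = Pi\<^sub>E {..<?n} (\<lambda>j. {l $ e j<..<u $ e j})"
  proof (intro equalityI subsetI)
    fix f assume f: "f \<in> ?v -` box l u \<inter> space ?P"
    then have "l $ e j < f j \<and> f j < u $ e j" if "j < ?n" for j
      using that inv[OF that] by (auto simp: mem_box_cart dest!: spec[of _ "e j"])
    then show "f \<in> Pi\<^sub>E {..<?n} (\<lambda>j. {l $ e j<..<u $ e j})"
      using f by (auto simp: space_PiM PiE_def extensional_def)
  next
    fix f assume f: "f \<in> Pi\<^sub>E {..<?n} (\<lambda>j. {l $ e j<..<u $ e j})"
    have "l $ i < f (inv_into {..<?n} e i) \<and> f (inv_into {..<?n} e i) < u $ i" for i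
      using PiE_mem[OF f, of "inv_into {..<?n} e i"] inv'[of i] by auto
    then show "f \<in> ?v -` box l u \<inter> space ?P"
      using f by (auto simp: mem_box_cart space_PiM PiE_def)
  qed
  then have "emeasure (distr ?P borel ?v) (box l u) = emeasure ?P (Pi\<^sub>E {..<?n} (\<lambda>j. {l $ e j<..<u $ e j}))"
    by (subst emeasure_distr[OF meas]) auto
  also have "\<dots> = (\<Prod>j<?n. ennreal (u $ e j - l $ e j))"
    by (subst emeasure_PiM) (auto simp: lu')
  also have "\<dots> = ennreal (\<Prod>j<?n. (u - l) $ e j)"
    by (subst prod_ennreal) (auto simp: lu')
  also have "(\<Prod>j<?n. (u - l) $ e j) = (\<Prod>i\<in>UNIV. (u - l) $ i)"
    by (rule prod.reindex_bij_betw[OF e])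
  also have "\<dots> = (\<Prod>b\<in>Basis. (u - l) \<bullet> b)"
  proof -
    have "bij_betw (\<lambda>i. axis i (1::real)) UNIV (Basis :: (real^'m) set)"
      by (auto simp: bij_betw_def inj_on_def axis_eq_axis Basis_vec_def)
    from prod.reindex_bij_betw[OF this, of "\<lambda>b. (u - l) \<bullet> b"]
    show ?thesis by (simp add: cart_eq_inner_axis)
  qed
  finally show "emeasure (distr ?P borel ?v) (box l u) = ennreal (\<Prod>b\<in>Basis. (u - l) \<bullet> b)" .
qed simp

text \<open>A finite linear order is a well-order. The copy of the index type carries this as a type class
  instance, so that the change of variables theorem for well-ordered index types applies to it.\<close>
typedef 'n wo = "UNIV :: 'n set" by simp

instance wo :: (finite) finite
proof
  have "surj (Abs_wo :: 'a \<Rightarrow> 'a wo)" using type_definition.Abs_image[OF type_definition_wo] by simp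
  then show "finite (UNIV :: 'a wo set)" by (metis finite finite_imageI)
qed

instantiation wo :: (linorder) linorder
begin
definition less_eq_wo :: "'a wo \<Rightarrow> 'a wo \<Rightarrow> bool" where "x \<le> y \<longleftrightarrow> Rep_wo x \<le> Rep_wo y"
definition less_wo :: "'a wo \<Rightarrow> 'a wo \<Rightarrow> bool" where "x < y \<longleftrightarrow> Rep_wo x < Rep_wo y"
instance by standard (auto simp: less_eq_wo_def less_wo_def Rep_wo_inject less_le)
end

instance wo :: ("{finite, linorder}") wellorder
proof
  fix P :: "'a wo \<Rightarrow> bool" and x :: "'a wo"
  assume step: "\<And>x. (\<And>y. y < x \<Longrightarrow> P y) \<Longrightarrow> P x"
  have "wf {(x :: 'a wo, y). x < y}"
    by (rule wf_subset[OF wf_measure[of "\<lambda>x. card {z. z < x}"]])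
       (auto intro!: psubset_card_mono)
  then show "P x" by (rule wf_induct_rule) (use step in auto)
qed

lemma inverse_wo [simp]: "Abs_wo (Rep_wo x) = x" "Rep_wo (Abs_wo y) = y"
  by (simp_all add: Rep_wo_inverse Abs_wo_inverse)

lemma bij_Abs_wo: "bij Abs_wo" "bij Rep_wo"
  by (rule o_bij[of Rep_wo] o_bij[of Abs_wo]; simp add: fun_eq_iff)+

lemma card_wo [simp]: "CARD('n wo) = CARD('n)"
  using bij_betw_same_card[OF bij_Abs_wo(2)] by simp

text \<open>The change of variables formula for the constant function \<open>1\<close>, with the Jacobian determinant taken in
  the enumeration \<open>e\<close> of the coordinates. The linear bijection \<open>R\<close> that relabels the coordinates preserves
  Lebesgue measure and transports the formula from \<open>'n wo\<close> to \<open>'n\<close>.\<close>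
lemma lebesgue_jacobian_integral:
  fixes g :: "real^'n::{finite,linorder} \<Rightarrow> real^'n::_" and e :: "nat \<Rightarrow> 'n::{finite,linorder}"
  assumes e: "bij_betw e {..<CARD('n)} UNIV"
    and S: "open S" and gS: "open (g ` S)" "g ` S \<in> lmeasurable" and inj: "inj_on g S"
    and der: "\<And>v. v \<in> S \<Longrightarrow> (g has_derivative g' v) (at v)"
    and J: "\<And>v. v \<in> S \<Longrightarrow> J v = \<bar>dets (map (\<lambda>j i. g' v (axis (e j) 1) $ e i) [0..<CARD('n)])\<bar>"
    and meas: "(\<lambda>v. indicator S v * J v) \<in> borel_measurable borel"
  shows "integral\<^sup>L lborel (\<lambda>v. indicator S v * J v) = measure lebesgue (g ` S)"
proof -
  define T :: "real^'n::_ \<Rightarrow> real^'n wo" where "T v = (\<chi> i. v $ Rep_wo i)" for v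
  define R :: "real^'n wo \<Rightarrow> real^'n::_" where "R w = (\<chi> i. w $ Abs_wo i)" for w
  have TR [simp]: "T (R w) = w" "R (T v) = v" for v w
    by (simp_all add: T_def R_def Finite_Cartesian_Product.vec_eq_iff)
  have lin: "linear T" "linear R"
    by (auto simp: T_def R_def linear_iff Finite_Cartesian_Product.vec_eq_iff)
  then have blT: "bounded_linear T" and blR: "bounded_linear R" by (simp_all add: linear_conv_bounded_linear)
  have contT: "continuous_on A T" and contR: "continuous_on B R" for A B
    using blT blR by (simp_all add: linear_continuous_on)
  have measT: "T \<in> borel_measurable borel" and measR: "R \<in> borel_measurable borel"
    using contT contR by (auto intro: borel_measurable_continuous_onI)
  have img: "T ` A = R -` A" for A by (force simp: image_iff)
  have pres: "distr lborel borel R = (lborel :: (real^'n::_) measure)"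
  proof (rule lborel_eqI[symmetric])
    fix l u :: "real^'n::_" assume lu: "\<And>b. b \<in> Basis \<Longrightarrow> l \<bullet> b \<le> u \<bullet> b"
    have lu': "l $ i \<le> u $ i" for i using lu[of "axis i 1"] by (simp add: cart_eq_inner_axis)
    have box: "R -` box l u = box (T l) (T u)"
    proof -
      have "(\<forall>i. l $ i < w $ Abs_wo i \<and> w $ Abs_wo i < u $ i) \<longleftrightarrow>
          (\<forall>i. l $ Rep_wo i < w $ i \<and> w $ i < u $ Rep_wo i)" for w :: "real^'n wo"
        by (metis inverse_wo)
      then show ?thesis unfolding R_def T_def by (simp add: set_eq_iff mem_box_cart)
    qed
    have pr: "(\<Prod>b\<in>Basis. (y - x) \<bullet> b) = (\<Prod>i\<in>UNIV. (y - x) $ i)" for x y :: "real^'k::finite"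
    proof -
      have "bij_betw (\<lambda>i. axis i (1::real)) UNIV (Basis :: (real^'k) set)"
        by (auto simp: bij_betw_def inj_on_def axis_eq_axis Basis_vec_def)
      from prod.reindex_bij_betw[OF this, of "\<lambda>b. (y - x) \<bullet> b"]
      show ?thesis by (simp add: cart_eq_inner_axis)
    qed
    have "emeasure (distr lborel borel R) (box l u) = emeasure lborel (box (T l) (T u))"
      using measR by (subst emeasure_distr) (auto simp: box)
    also have "\<dots> = (\<Prod>b\<in>Basis. (T u - T l) \<bullet> b)"
      by (rule emeasure_lborel_box) (auto simp: Basis_vec_def inner_axis T_def lu')
    also have "(\<Prod>b\<in>Basis. (T u - T l) \<bullet> b) = (\<Prod>b\<in>Basis. (u - l) \<bullet> b)"
      unfolding pr using prod.reindex_bij_betw[OF bij_Abs_wo(2), of "\<lambda>i. (u - l) $ i"] by (simp add: T_def)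
    finally show "emeasure (distr lborel borel R) (box l u) = (\<Prod>b\<in>Basis. (u - l) \<bullet> b)" .
  qed simp
  define S' where "S' = T ` S"
  define h where "h = (\<lambda>w. T (g (R w)))"
  define h' where "h' = (\<lambda>w d. T (g' (R w) (R d)))"
  have oS': "open S'" unfolding S'_def img using contR S by (simp add: open_vimage)
  have himg: "h ` S' = T ` g ` S" unfolding h_def S'_def by (simp add: image_image)
  have "open (T ` g ` S)" unfolding img using contR gS by (simp add: open_vimage)
  have measTg: "measure lebesgue (T ` g ` S) = measure lebesgue (g ` S)"
    "emeasure lebesgue (T ` g ` S) = emeasure lebesgue (g ` S)"
  proof -
    have "emeasure lborel (g ` S) = emeasure (distr lborel borel R) (g ` S)" using pres by simp
    also have "\<dots> = emeasure lborel (T ` g ` S)"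
      unfolding img using measR gS(1) by (subst emeasure_distr) auto
    finally show "emeasure lebesgue (T ` g ` S) = emeasure lebesgue (g ` S)"
      using gS(1) \<open>open (T ` g ` S)\<close> by simp
    then show "measure lebesgue (T ` g ` S) = measure lebesgue (g ` S)" by (simp only: measure_def)
  qed
  have lm: "T ` g ` S \<in> lmeasurable"
    using gS(2) measTg(2) \<open>open (T ` g ` S)\<close> unfolding fmeasurable_def by auto
  have derh: "(h has_derivative h' w) (at w within S')" if "w \<in> S'" for w
  proof -
    have "R w \<in> S" using that by (auto simp: S'_def)
    note d1 = has_derivative_compose[OF bounded_linear.has_derivative[OF blR has_derivative_ident] der[OF this]]
    have "(h has_derivative h' w) (at w)"
      using bounded_linear.has_derivative[OF blT d1] unfolding h_def h'_def by simp
    then show ?thesis by (rule has_derivative_at_withinI)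
  qed
  have injh: "inj_on h S'"
    using inj unfolding h_def S'_def inj_on_def by (metis TR imageE)
  have detJ: "\<bar>Determinants.det (matrix (h' w))\<bar> = J (R w)" if "w \<in> S'" for w
  proof -
    have "bij_betw (Abs_wo \<circ> e) {..<CARD('n wo)} UNIV"
      using bij_betw_trans[OF e bij_Abs_wo(1)] by simp
    note det_eq_dets[OF this, of "matrix (h' w)"]
    moreover have "R (axis (Abs_wo (e j)) 1) = axis (e j) 1" for j
      by (auto simp: R_def axis_def Finite_Cartesian_Product.vec_eq_iff) (metis inverse_wo(2))
    then have "matrix (h' w) $ Abs_wo (e i) $ Abs_wo (e j) = g' (R w) (axis (e j) 1) $ e i" for i j
      by (simp add: matrix_def h'_def T_def)
    moreover have "R w \<in> S" using that by (auto simp: S'_def)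
    ultimately show ?thesis using J by simp
  qed
  have "((\<lambda>w. \<bar>Determinants.det (matrix (h' w))\<bar>) has_integral measure lebesgue (g ` S)) S'"
    using has_measure_differentiable_image[of S' h h' "measure lebesgue (g ` S)"] oS' derh injh lm
    by (auto simp: himg measTg)
  then have hi: "((\<lambda>w. J (R w)) has_integral measure lebesgue (g ` S)) S'"
    by (rule has_integral_eq[rotated]) (use detJ in auto)
  have Jpos: "J (R w) \<ge> 0" if "w \<in> S'" for w using detJ[OF that] by (metis abs_ge_zero)
  then have ai: "(\<lambda>w. J (R w)) absolutely_integrable_on S'"
    using hi by (intro nonnegative_absolutely_integrable_1) (auto simp: has_integral_integrable_integral)
  have ind: "indicator S' w * J (R w) = indicator S (R w) * J (R w)" for w
    by (auto simp: indicator_def S'_def image_iff) (metis TR(1))+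
  have measF: "(\<lambda>w. indicator S (R w) * J (R w)) \<in> borel_measurable lborel"
    using measurable_compose[OF measR meas] by simp
  have "measure lebesgue (g ` S) = (LINT w:S'|lebesgue. J (R w))"
    using set_lebesgue_integral_eq_integral(2)[OF ai] integral_unique[OF hi] by simp
  also have "\<dots> = (LINT w|lebesgue. indicator S (R w) * J (R w))"
    unfolding set_lebesgue_integral_def by (simp add: ind)
  also have "\<dots> = (LINT w|lborel. indicator S (R w) * J (R w))"
    by (rule integral_completion[OF measF])
  also have "\<dots> = (LINT v|distr lborel borel R. indicator S v * J v)"
    using measR meas by (subst integral_distr) auto
  finally show "integral\<^sup>L lborel (\<lambda>v. indicator S v * J v) = measure lebesgue (g ` S)"
    unfolding pres by simp
qed

lemma measurable_dets:
  assumes "\<And>c r. c \<in> set cs \<Longrightarrow> (\<lambda>x. c x r) \<in> borel_measurable M"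
  shows "(\<lambda>x. dets (map (\<lambda>c. c x) cs)) \<in> borel_measurable M"
proof -
  let ?n = "length cs"
  have "dets (map (\<lambda>c. c x) cs) = (\<Sum>p | p permutes {0..<?n}. of_int (sign p) * (\<Prod>i=0..<?n. (cs ! p i) x i))" for x
    unfolding dets_def
    by (subst det_def'[of _ ?n]) (auto intro!: sum.cong prod.cong dest: permutes_in_image)
  then show ?thesis
    using assms by (auto intro!: borel_measurable_sum borel_measurable_times borel_measurable_prod
        simp: permutes_in_image)
qed

abbreviation lborel_PiM :: "nat set \<Rightarrow> (nat \<Rightarrow> real) measure" where
  "lborel_PiM I \<equiv> \<Pi>\<^sub>M i\<in>I. (lborel :: real measure)"

interpretation lborel_product: product_sigma_finite "\<lambda>_ :: nat. lborel :: real measure"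
  by standard

lemma measurable_coordinate: "i \<in> I \<Longrightarrow> (\<lambda>x. x i) \<in> borel_measurable (lborel_PiM I)"
  using measurable_component_singleton[of i I "\<lambda>_. lborel"] by simp

text \<open>The graph of a function of the other coordinates is a null set: integrate over the coordinate \<open>j\<close>
  first.\<close>
lemma AE_coordinate_neq:
  assumes I: "finite I" "j \<in> I" and \<phi>: "\<phi> \<in> borel_measurable (lborel_PiM I)"
    and indep: "\<And>x y. \<phi> (x(j := y)) = \<phi> x"
  shows "AE x in lborel_PiM I. x j \<noteq> \<phi> x"
proof -
  have I': "I = insert j (I - {j})" using I by auto
  have meas: "{x \<in> space (lborel_PiM I). x j = \<phi> x} \<in> sets (lborel_PiM I)"
    using measurable_coordinate[OF I(2)] \<phi> by measurable
  let ?N = "{x \<in> space (lborel_PiM I). x j = \<phi> x}"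
  have "emeasure (lborel_PiM I) ?N = (\<integral>\<^sup>+x. indicator ?N x \<partial>lborel_PiM (insert j (I - {j})))"
    using meas I' by (simp add: nn_integral_indicator)
  also have "\<dots> = (\<integral>\<^sup>+x. (\<integral>\<^sup>+y. indicator ?N (x(j := y)) \<partial>lborel) \<partial>lborel_PiM (I - {j}))"
    using I meas by (intro lborel_product.product_nn_integral_insert) (auto simp: insert_absorb)
  also have "\<dots> \<le> (\<integral>\<^sup>+x. (\<integral>\<^sup>+y. indicator {\<phi> x} y \<partial>lborel) \<partial>lborel_PiM (I - {j}))"
    using indep by (intro nn_integral_mono) (auto simp: indicator_def)
  also have "\<dots> = 0" by simp
  finally have "?N \<in> null_sets (lborel_PiM I)" using meas by (simp add: null_sets_def)
  then show ?thesis by (rule AE_I') auto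
qed

lemma PiM_reindex:
  assumes "finite J" and t: "bij_betw t J I"
  shows "distr (lborel_PiM I) (lborel_PiM J) (\<lambda>x. \<lambda>j\<in>J. x (t j)) = lborel_PiM J"
proof (rule lborel_product.PiM_eqI)
  let ?T = "\<lambda>x. \<lambda>j\<in>J. x (t j)"
  have fin: "finite I" using assms bij_betw_finite by blast
  have tI: "t j \<in> I" if "j \<in> J" for j using t that by (auto simp: bij_betw_def)
  have meas: "?T \<in> measurable (lborel_PiM I) (lborel_PiM J)"
    by (rule measurable_restrict) (use measurable_component_singleton[of _ I "\<lambda>_. lborel"] tI in auto)
  fix A :: "nat \<Rightarrow> real set" assume A: "\<And>i. i \<in> J \<Longrightarrow> A i \<in> sets lborel"
  define s where "s = inv_into J t"
  have s: "s i \<in> J" "t (s i) = i" if "i \<in> I" for i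
    using t that unfolding s_def bij_betw_def by (auto simp: inv_into_into f_inv_into_f)
  have st: "s (t j) = j" if "j \<in> J" for j
    using t that unfolding s_def bij_betw_def by (auto simp: inv_into_f_f)
  have "?T -` Pi\<^sub>E J A \<inter> space (lborel_PiM I) = Pi\<^sub>E I (\<lambda>i. A (s i))"
  proof (intro equalityI subsetI)
    fix x assume x: "x \<in> ?T -` Pi\<^sub>E J A \<inter> space (lborel_PiM I)"
    then have "x i \<in> A (s i)" if "i \<in> I" for i
      using PiE_mem[of "?T x" J A "s i"] s[OF that] by auto
    then show "x \<in> Pi\<^sub>E I (\<lambda>i. A (s i))" using x by (auto simp: space_PiM PiE_def)
  next
    fix x assume x: "x \<in> Pi\<^sub>E I (\<lambda>i. A (s i))"
    have "x (t j) \<in> A j" if "j \<in> J" for j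
      using PiE_mem[OF x tI[OF that]] st[OF that] by simp
    then show "x \<in> ?T -` Pi\<^sub>E J A \<inter> space (lborel_PiM I)" using x by (auto simp: space_PiM PiE_def)
  qed
  then have "emeasure (distr (lborel_PiM I) (lborel_PiM J) ?T) (Pi\<^sub>E J A) =
      emeasure (lborel_PiM I) (Pi\<^sub>E I (\<lambda>i. A (s i)))"
    using meas A assms(1) by (subst emeasure_distr) (auto intro!: sets_PiM_I_finite)
  also have "\<dots> = (\<Prod>i\<in>I. emeasure lborel (A (s i)))"
    using fin A s by (intro lborel_product.emeasure_PiM) auto
  also have "\<dots> = (\<Prod>j\<in>J. emeasure lborel (A (s (t j))))"
    by (rule prod.reindex_bij_betw[OF t, of "\<lambda>i. emeasure lborel (A (s i))", symmetric])
  also have "\<dots> = (\<Prod>j\<in>J. emeasure lborel (A j))" using st by simp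
  finally show "emeasure (distr (lborel_PiM I) (lborel_PiM J) ?T) (Pi\<^sub>E J A) = (\<Prod>j\<in>J. emeasure lborel (A j))" .
qed (use assms in auto)

section \<open>The Dirichlet integral of the weights\<close>

text \<open>Only the exponents \<open>0\<close> and \<open>1\<close> occur: a weight enters the Jacobian determinant if its node
  is moving. With this restriction there are no factorials in the numerator.\<close>
lemma beta_integral:
  fixes s :: real
  assumes "s > 0" "c \<le> 1"
  shows "(\<integral>\<^sup>+y. ennreal (indicator {0<..<s} y * (y ^ c * (s - y) ^ N / fact N)) \<partial>lborel) =
    ennreal (s ^ (N + c + 1) / fact (N + c + 1))"
proof -
  define F where "F = (\<lambda>y. if c = 0 then - ((s - y) ^ Suc N / fact (Suc N))
    else - (y * (s - y) ^ Suc N / fact (Suc N)) - (s - y) ^ Suc (Suc N) / fact (Suc (Suc N)))"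
  have c: "c = 0 \<or> c = 1" using assms by auto
  have pw: "((\<lambda>y. (s - y) ^ Suc M / fact (Suc M)) has_real_derivative - ((s - y) ^ M / fact M)) (at y)" for M y
  proof -
    have "((\<lambda>y. (s - y) ^ Suc M) has_real_derivative real (Suc M) * (s - y) ^ M * (- 1)) (at y)"
      by (auto intro!: derivative_eq_intros simp del: power_Suc)
    from DERIV_cdivide[OF this, of "fact (Suc M)"] show ?thesis
      by (simp add: fact_Suc del: power_Suc of_nat_Suc)
  qed
  have der: "(F has_real_derivative y ^ c * (s - y) ^ N / fact N) (at y)" for y
  proof (cases "c = 0")
    case True
    then show ?thesis using DERIV_minus[OF pw[of N y]] by (simp add: F_def)
  next
    case False
    then have "c = 1" using c by simp
    have "((\<lambda>y. y * ((s - y) ^ Suc N / fact (Suc N))) has_real_derivative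
        1 * ((s - y) ^ Suc N / fact (Suc N)) + - ((s - y) ^ N / fact N) * y) (at y)"
      by (rule DERIV_mult[OF DERIV_ident pw])
    from DERIV_diff[OF DERIV_minus[OF this] pw[of "Suc N" y]]
    show ?thesis using \<open>c = 1\<close> by (simp add: F_def mult_ac)
  qed
  have "(\<integral>\<^sup>+y. ennreal (indicator {0<..<s} y * (y ^ c * (s - y) ^ N / fact N)) \<partial>lborel) =
      (\<integral>\<^sup>+y. ennreal (y ^ c * (s - y) ^ N / fact N) * indicator {0..s} y \<partial>lborel)"
  proof (rule nn_integral_cong_AE)
    have "AE y in lborel. y \<noteq> 0 \<and> y \<noteq> s"
      using AE_lborel_singleton[of 0] AE_lborel_singleton[of s] by eventually_elim auto
    then show "AE y in lborel. ennreal (indicator {0<..<s} y * (y ^ c * (s - y) ^ N / fact N)) =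
        ennreal (y ^ c * (s - y) ^ N / fact N) * indicator {0..s} y"
      by eventually_elim (auto simp: indicator_def)
  qed
  also have "\<dots> = ennreal (F s - F 0)"
    by (rule nn_integral_FTC_Icc) (use assms der in \<open>auto intro!: has_field_derivative_at_within\<close>)
  also have "F s - F 0 = s ^ (N + c + 1) / fact (N + c + 1)"
    using c by (auto simp: F_def)
  finally show ?thesis .
qed

text \<open>Induction on the number of variables: if the new variable has the value \<open>y\<close>, the others run through
  a simplex of size \<open>s - y\<close>, which leaves the integral of \<open>beta_integral\<close>. For \<open>s = 1\<close> the factor
  \<open>(s - sum) ^ p\<close> stands for the weight of node \<open>0\<close>, with \<open>p = 1\<close> if this node is moving and \<open>p = 0\<close>
  if it is fixed.\<close>
lemma dirichlet_integral:
  assumes "finite I" "\<And>i. i \<in> I \<Longrightarrow> c i \<le> 1" "s > 0"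
  shows "(\<integral>\<^sup>+x. ennreal (of_bool ((\<forall>i\<in>I. 0 < x i) \<and> (\<Sum>i\<in>I. x i) < s) *
      ((\<Prod>i\<in>I. x i ^ c i) * ((s - (\<Sum>i\<in>I. x i)) ^ p / fact p))) \<partial>lborel_PiM I) =
    ennreal (s ^ (p + (\<Sum>i\<in>I. c i + 1)) / fact (p + (\<Sum>i\<in>I. c i + 1)))"
  using assms
proof (induction I arbitrary: s rule: finite_induct)
  case empty
  then show ?case by (simp add: PiM_empty)
next
  case (insert j I)
  define N where "N = p + (\<Sum>i\<in>I. c i + 1)"
  let ?G = "\<lambda>I s x. ennreal (of_bool ((\<forall>i\<in>I. 0 < x i) \<and> (\<Sum>i\<in>I. x i) < s) *
      ((\<Prod>i\<in>I. x i ^ c i) * ((s - (\<Sum>i\<in>I. x i)) ^ p / fact p)))"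
  have meas: "?G I s \<in> borel_measurable (lborel_PiM I)" if "finite I" for I s
  proof -
    note [measurable] = measurable_coordinate
    show ?thesis using that by measurable
  qed
  have "(\<integral>\<^sup>+x. ?G (insert j I) s x \<partial>lborel_PiM (insert j I)) =
      (\<integral>\<^sup>+y. (\<integral>\<^sup>+x. ?G (insert j I) s (x(j := y)) \<partial>lborel_PiM I) \<partial>lborel)"
    by (rule lborel_product.product_nn_integral_insert_rev) (use insert meas in auto)
  also have "\<dots> = (\<integral>\<^sup>+y. ennreal (indicator {0<..<s} y * (y ^ c j * (s - y) ^ N / fact N)) \<partial>lborel)"
  proof (rule nn_integral_cong)
    fix y :: real
    have upd: "(\<Sum>i\<in>insert j I. (x(j := y)) i) = y + (\<Sum>i\<in>I. x i)"
      "(\<Prod>i\<in>insert j I. (x(j := y)) i ^ c i) = y ^ c j * (\<Prod>i\<in>I. x i ^ c i)"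
      "(\<forall>i\<in>insert j I. 0 < (x(j := y)) i) \<longleftrightarrow> 0 < y \<and> (\<forall>i\<in>I. 0 < x i)" for x
    proof -
      have "(x(j := y)) i = x i" if "i \<in> I" for i using insert.hyps that by auto
      then have "(\<Sum>i\<in>I. (x(j := y)) i) = (\<Sum>i\<in>I. x i)" "(\<Prod>i\<in>I. (x(j := y)) i ^ c i) = (\<Prod>i\<in>I. x i ^ c i)"
        "(\<forall>i\<in>I. 0 < (x(j := y)) i) \<longleftrightarrow> (\<forall>i\<in>I. 0 < x i)"
        by (auto intro!: sum.cong prod.cong simp del: fun_upd_apply)
      then show "(\<Sum>i\<in>insert j I. (x(j := y)) i) = y + (\<Sum>i\<in>I. x i)"
        "(\<Prod>i\<in>insert j I. (x(j := y)) i ^ c i) = y ^ c j * (\<Prod>i\<in>I. x i ^ c i)"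
        "(\<forall>i\<in>insert j I. 0 < (x(j := y)) i) \<longleftrightarrow> 0 < y \<and> (\<forall>i\<in>I. 0 < x i)"
        using insert.hyps by simp_all
    qed
    show "(\<integral>\<^sup>+x. ?G (insert j I) s (x(j := y)) \<partial>lborel_PiM I) =
        ennreal (indicator {0<..<s} y * (y ^ c j * (s - y) ^ N / fact N))"
    proof (cases "y \<in> {0<..<s}")
      case True
      have "?G (insert j I) s (x(j := y)) = ennreal (y ^ c j) * ?G I (s - y) x" for x
      proof (cases "(\<forall>i\<in>I. 0 < x i) \<and> (\<Sum>i\<in>I. x i) < s - y")
        case cond: True
        have "0 \<le> (\<Prod>i\<in>I. x i ^ c i) * ((s - y - (\<Sum>i\<in>I. x i)) ^ p / fact p)"
          using cond by (intro mult_nonneg_nonneg prod_nonneg divide_nonneg_nonneg zero_le_power ballI) (auto simp: less_imp_le)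
        then show ?thesis
          unfolding upd using True cond
          by (subst ennreal_mult'[symmetric]) (auto simp: algebra_simps)
      next
        case cond: False
        then show ?thesis unfolding upd using True by (auto simp: algebra_simps)
      qed
      then have "(\<integral>\<^sup>+x. ?G (insert j I) s (x(j := y)) \<partial>lborel_PiM I) =
          ennreal (y ^ c j) * (\<integral>\<^sup>+x. ?G I (s - y) x \<partial>lborel_PiM I)"
        using meas[OF insert.hyps(1)] by (simp add: nn_integral_cmult)
      also have "\<dots> = ennreal (y ^ c j) * ennreal ((s - y) ^ N / fact N)"
        unfolding N_def using insert.IH[of "s - y"] insert.prems True by simp
      finally show ?thesis using True by (simp add: ennreal_mult[symmetric])
    next
      case False
      have "?G (insert j I) s (x(j := y)) = 0" for x
      proof -
        have "\<not> (0 < y \<and> (\<forall>i\<in>I. 0 < x i) \<and> y + (\<Sum>i\<in>I. x i) < s)"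
        proof
          assume *: "0 < y \<and> (\<forall>i\<in>I. 0 < x i) \<and> y + (\<Sum>i\<in>I. x i) < s"
          then have "(\<Sum>i\<in>I. x i) \<ge> 0" by (intro sum_nonneg) (auto simp: less_imp_le)
          then show False using * False by simp
        qed
        then show ?thesis unfolding upd by auto
      qed
      then show ?thesis using False by simp
    qed
  qed
  also have "\<dots> = ennreal (s ^ (N + c j + 1) / fact (N + c j + 1))"
    by (rule beta_integral) (use insert.prems in auto)
  also have "N + c j + 1 = p + (\<Sum>i\<in>insert j I. c i + 1)"
    using insert.hyps by (simp add: N_def)
  finally show ?case .
qed

section \<open>The volume as an integral over the nodes\<close>

context principal_parametrization
begin

definition weights_pos :: "(nat \<Rightarrow> real) \<Rightarrow> bool" where
  "weights_pos f \<longleftrightarrow> (\<forall>j\<in>{..m}. 0 < wt f j)"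

text \<open>\<open>coeff_det\<close> with the curve and its derivative as arguments, which will be replaced by Borel
  measurable extensions.\<close>
definition column_det :: "(real \<Rightarrow> real^'n::_) \<Rightarrow> (real \<Rightarrow> real^'n::_) \<Rightarrow> (nat \<Rightarrow> real) \<Rightarrow> real" where
  "column_det g g' f = dets (map (\<lambda>j r. (g (node f (Suc j)) - g (node f 0)) $ coord r) [0..<m] @
     map (\<lambda>i r. g' (f (m + i)) $ coord r) [0..<k])"

lemma coeff_det_eq_column_det: "coeff_det f = column_det \<gamma> \<gamma>' f"
  unfolding coeff_det_def column_det_def ..

lemma node_cong:
  assumes "\<And>i. i < k \<Longrightarrow> f (m + i) = f' (m + i)" "j \<le> m"
  shows "node f j = node f' j"
  using assms(2) by (cases rule: node_cases) (auto simp: assms(1))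

lemma column_det_cong:
  assumes "\<And>i. i < k \<Longrightarrow> f (m + i) = f' (m + i)"
    and "\<And>j. j \<le> m \<Longrightarrow> g (node f j) = h (node f j)" "\<And>i. i < k \<Longrightarrow> g' (f (m + i)) = h' (f (m + i))"
  shows "column_det g g' f = column_det h h' f'"
proof -
  have "map (\<lambda>j r. (g (node f (Suc j)) - g (node f 0)) $ coord r) [0..<m] =
      map (\<lambda>j r. (h (node f' (Suc j)) - h (node f' 0)) $ coord r) [0..<m]"
    using assms(2) node_cong[of f f', OF assms(1)] by (intro map_cong) auto
  moreover have "map (\<lambda>i r. g' (f (m + i)) $ coord r) [0..<k] = map (\<lambda>i r. h' (f' (m + i)) $ coord r) [0..<k]"
    using assms(3) assms(1) by (intro map_cong) auto
  ultimately show ?thesis unfolding column_det_def by (simp only:)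
qed

lemma chamber_cong:
  assumes eq: "\<And>i. i < k \<Longrightarrow> f (m + i) = f' (m + i)"
  shows "chamber f \<longleftrightarrow> chamber f'"
proof -
  have "f (m + i) = f' (m + i)" "f (m + Suc i) = f' (m + Suc i)" if "Suc i < k" for i
    using eq[of i] eq[of "Suc i"] that by auto
  then show ?thesis
    unfolding chamber_def using eq by (intro conj_cong ball_cong refl) (auto simp del: add_Suc_right)
qed

lemma wt_cong: "(\<And>i. i < m \<Longrightarrow> f i = f' i) \<Longrightarrow> j \<le> m \<Longrightarrow> wt f j = wt f' j"
  by (cases j) (auto simp: wt_def)

lemma weights_pos_cong: "(\<And>i. i < m \<Longrightarrow> f i = f' i) \<Longrightarrow> weights_pos f \<longleftrightarrow> weights_pos f'"
  unfolding weights_pos_def using wt_cong[of f f'] by auto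

lemma weight_prod_cong: "(\<And>i. i < m \<Longrightarrow> f i = f' i) \<Longrightarrow> weight_prod f = weight_prod f'"
  unfolding weight_prod_def using wt_cong[of f f'] m_simps by (intro prod.cong) auto

definition curve_ext :: "real \<Rightarrow> real^'n::_" where
  "curve_ext t = indicator {a..b} t *\<^sub>R \<gamma> t"

text \<open>The end points are included with whatever value \<open>\<gamma>'\<close> has there, since the integral over the
  closed set of ordered tuples requires a measurable integrand on all of this set.\<close>
definition deriv_ext :: "real \<Rightarrow> real^'n::_" where
  "deriv_ext t = indicator {a<..<b} t *\<^sub>R \<gamma>' t + indicator {a} t *\<^sub>R \<gamma>' a + indicator {b} t *\<^sub>R \<gamma>' b"

lemma ext_eq: "t \<in> {a..b} \<Longrightarrow> curve_ext t = \<gamma> t" "t \<in> {a..b} \<Longrightarrow> deriv_ext t = \<gamma>' t"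
  using a_less_b by (auto simp: curve_ext_def deriv_ext_def indicator_def)

lemma measurable_ext: "curve_ext \<in> borel_measurable borel" "deriv_ext \<in> borel_measurable borel"
proof -
  show "curve_ext \<in> borel_measurable borel"
    unfolding curve_ext_def[abs_def] by (rule borel_measurable_continuous_on_indicator[OF _ cont]) auto
  have [measurable]: "(\<lambda>t. indicator {a<..<b} t *\<^sub>R \<gamma>' t) \<in> borel_measurable borel"
    by (rule borel_measurable_continuous_on_indicator[OF _ cont_deriv]) auto
  show "deriv_ext \<in> borel_measurable borel"
    unfolding deriv_ext_def[abs_def] by measurable
qed

lemma measurable_column_det:
  assumes X: "\<And>i. i < k \<Longrightarrow> (\<lambda>x. X x (m + i)) \<in> borel_measurable M"
    and g: "g \<in> borel_measurable borel" "g' \<in> borel_measurable borel"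
  shows "(\<lambda>x. column_det g g' (X x)) \<in> borel_measurable M"
proof -
  have [measurable]: "(\<lambda>v :: real^'n::_. v $ i) \<in> borel_measurable borel" for i
    by (intro borel_measurable_continuous_onI continuous_intros)
  have node: "(\<lambda>x. node (X x) j) \<in> borel_measurable M" if "j \<le> m" for j
    using that by (cases rule: node_cases) (auto simp: X)
  have gn: "(\<lambda>x. g (node (X x) j)) \<in> borel_measurable M" if "j \<le> m" for j
    using measurable_compose[OF node[OF that] g(1)] .
  have gx: "(\<lambda>x. g' (X x (m + i))) \<in> borel_measurable M" if "i < k" for i
    using measurable_compose[OF X[OF that] g(2)] .
  define cs where "cs = map (\<lambda>j x r. (g (node (X x) (Suc j)) - g (node (X x) 0)) $ coord r) [0..<m] @
     map (\<lambda>i x r. g' (X x (m + i)) $ coord r) [0..<k]"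
  have "(\<lambda>x. dets (map (\<lambda>c. c x) cs)) \<in> borel_measurable M"
  proof (rule measurable_dets)
    fix c r assume "c \<in> set cs"
    then consider j where "j < m" "c = (\<lambda>x r. (g (node (X x) (Suc j)) - g (node (X x) 0)) $ coord r)"
      | i where "i < k" "c = (\<lambda>x r. g' (X x (m + i)) $ coord r)"
      unfolding cs_def by auto
    then show "(\<lambda>x. c x r) \<in> borel_measurable M"
    proof cases
      case 1
      have [measurable]: "(\<lambda>x. g (node (X x) (Suc j))) \<in> borel_measurable M" "(\<lambda>x. g (node (X x) 0)) \<in> borel_measurable M"
        using gn 1 by auto
      show ?thesis unfolding 1 by measurable
    next
      case 2
      note [measurable] = gx[OF 2(1)]
      show ?thesis unfolding 2 by measurable
    qed
  qed
  then show ?thesis unfolding cs_def column_det_def by (simp add: o_def)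
qed

lemma measurable_wt:
  assumes "\<And>i. i < m \<Longrightarrow> (\<lambda>x. X x i) \<in> borel_measurable M" "j \<le> m"
  shows "(\<lambda>x. wt (X x) j) \<in> borel_measurable M"
  using assms by (cases j) (auto simp: wt_def intro!: borel_measurable_diff borel_measurable_sum)

lemma measurable_weight_prod:
  assumes "\<And>i. i < m \<Longrightarrow> (\<lambda>x. X x i) \<in> borel_measurable M"
  shows "(\<lambda>x. weight_prod (X x)) \<in> borel_measurable M"
  unfolding weight_prod_def using measurable_wt[of X M, OF assms] m_simps
  by (intro borel_measurable_prod) auto

definition shuffle_sign :: real where "shuffle_sign = (-1) ^ (k * (k - 1) div 2)"

definition weight_density :: "(nat \<Rightarrow> real) \<Rightarrow> real" where
  "weight_density f = of_bool (weights_pos f) * weight_prod f"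

definition node_density :: "(nat \<Rightarrow> real) \<Rightarrow> real" where
  "node_density f = of_bool (chamber f) * (shuffle_sign * coeff_det f)"

lemma weight_density_nonneg: "weight_density f \<ge> 0"
proof -
  have "0 \<le> weight_prod f" if "weights_pos f"
    unfolding weight_prod_def
  proof (rule prod_nonneg)
    fix i assume "i \<in> {..<k}"
    then have "e + i \<in> {..m}" using m_simps by auto
    then show "0 \<le> wt f (e + i)" using that unfolding weights_pos_def by (auto intro: less_imp_le)
  qed
  then show ?thesis by (simp add: weight_density_def)
qed

lemma node_density_nonneg: "node_density f \<ge> 0"
  using coeff_det_sign[of f] unfolding node_density_def shuffle_sign_def by auto

lemma measurable_weight_density:
  assumes X: "\<And>i. i < m \<Longrightarrow> (\<lambda>x. X x i) \<in> borel_measurable M"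
  shows "(\<lambda>x. weight_density (X x)) \<in> borel_measurable M"
proof -
  have [measurable]: "(\<lambda>x. wt (X x) j) \<in> borel_measurable M" if "j \<in> {..m}" for j
    using measurable_wt[of X M, OF X] that by simp
  have [measurable]: "Measurable.pred M (\<lambda>x. weights_pos (X x))"
    unfolding weights_pos_def by measurable
  note [measurable] = measurable_weight_prod[of X M, OF X]
  show ?thesis unfolding weight_density_def by measurable
qed

lemma measurable_node_density:
  assumes X: "\<And>i. i < k \<Longrightarrow> (\<lambda>x. X x (m + i)) \<in> borel_measurable M"
  shows "(\<lambda>x. node_density (X x)) \<in> borel_measurable M"
proof -
  have [measurable]: "(\<lambda>x. X x (m + i)) \<in> borel_measurable M" if "i \<in> {..<k}" for i
    using X that by simp
  have [measurable]: "(\<lambda>x. X x (m + i)) \<in> borel_measurable M" "(\<lambda>x. X x (m + Suc i)) \<in> borel_measurable M"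
    if "i \<in> {i. Suc i < k}" for i
    using X[of i] X[of "Suc i"] that by auto
  have [measurable]: "Measurable.pred M (\<lambda>x. chamber (X x))"
    unfolding chamber_def using finite_Suc_less by measurable
  note [measurable] = measurable_column_det[of X M, OF X measurable_ext]
  have "node_density f = of_bool (chamber f) * (shuffle_sign * column_det curve_ext deriv_ext f)" for f
  proof (cases "chamber f")
    case True
    have x: "f (m + i) \<in> {a..b}" if "i < k" for i using True that by (auto simp: chamber_def less_imp_le)
    have "node f j \<in> {a..b}" if "j \<le> m" for j
      using that by (cases rule: node_cases) (use x q_end[of j] a_less_b in auto)
    then show ?thesis
      unfolding node_density_def coeff_det_eq_column_det
      using column_det_cong[of f f \<gamma> curve_ext \<gamma>' deriv_ext] ext_eq x by auto
  qed (simp add: node_density_def)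
  then show ?thesis by simp
qed

lemma weights_pos_iff: "weights_pos f \<longleftrightarrow> (\<forall>i\<in>{..<m}. 0 < f i) \<and> (\<Sum>i<m. f i) < 1"
proof -
  have "{..m} = insert 0 (Suc ` {..<m})"
    unfolding lessThan_Suc_atMost[symmetric] by (rule lessThan_Suc_eq_insert_0)
  then show ?thesis unfolding weights_pos_def by (auto simp: wt_def)
qed

text \<open>The exponents are \<open>1\<close> at the weights of moving nodes and \<open>0\<close> at those of fixed nodes, and \<open>p\<close> is the exponent
  of the weight of node \<open>0\<close>. Together with the number \<open>m\<close> of variables they sum up to
  \<open>k + m = n\<close>.\<close>
lemma weight_integral:
  "(\<integral>\<^sup>+f. ennreal (weight_density f) \<partial>lborel_PiM {..<m}) = ennreal (1 / fact CARD('n))"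
proof -
  define c where "c = (\<lambda>j. if e \<le> Suc j then 1 else 0 :: nat)"
  define p where "p = (if e = 0 then 1 else 0 :: nat)"
  have wp: "weight_prod f = (\<Prod>i\<in>{..<m}. f i ^ c i) * ((1 - (\<Sum>i\<in>{..<m}. f i)) ^ p / fact p)" for f
  proof (cases "e = 0")
    case True
    have p: "p = 1" and c: "c = (\<lambda>_. 1)" using True by (auto simp: p_def c_def)
    have ei: "e + i = i" for i using True by simp
    have "k = Suc m" using m_simps(1) True by linarith
    then have kS: "{..<k} = {..<Suc m}" by (rule arg_cong)
    have "weight_prod f = (\<Prod>i<Suc m. wt f i)"
      unfolding weight_prod_def ei kS ..
    also have "\<dots> = wt f 0 * (\<Prod>i<m. wt f (Suc i))" by (rule prod.lessThan_Suc_shift)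
    finally show ?thesis by (simp add: wt_def p c mult.commute)
  next
    case False
    then obtain e' where e': "e = Suc e'" by (cases e) auto
    have p: "p = 0" and c: "c j = (if e' \<le> j then 1 else 0)" for j using e' by (auto simp: p_def c_def)
    have ei: "e + i = Suc (e' + i)" for i using e' by simp
    have m: "m = e' + k" using m_simps(1) ei[of k] by simp
    have "(\<Prod>i\<in>{..<m}. f i ^ c i) = (\<Prod>i\<in>{e'..<e' + k}. f i)"
      by (rule prod.mono_neutral_cong_right) (auto simp: m c)
    also have "\<dots> = (\<Prod>i<k. f (e' + i))"
      using prod.shift_bounds_nat_ivl[of f 0 e' k] by (simp add: atLeast0LessThan add.commute)
    finally show ?thesis unfolding weight_prod_def ei by (simp add: wt_def p)
  qed
  have expo: "p + (\<Sum>i\<in>{..<m}. c i + 1) = CARD('n)"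
  proof -
    have "(\<Sum>i\<in>{..<m}. c i) = card {i\<in>{..<m}. e \<le> Suc i}"
      unfolding c_def by (simp add: sum.If_cases Int_def)
    also have "{i\<in>{..<m}. e \<le> Suc i} = {e - 1..<m}" by auto
    finally have "(\<Sum>i\<in>{..<m}. c i) = m - (e - 1)" by simp
    then have "p + (\<Sum>i\<in>{..<m}. c i + 1) = p + (m - (e - 1)) + m"
      unfolding sum.distrib by simp
    moreover have "p + (m - (e - 1)) = k"
    proof (cases "e = 0")
      case True
      then have "p = 1" by (simp add: p_def)
      then show ?thesis using m_simps(1) True by linarith
    next
      case False
      then have "p = 0" by (simp add: p_def)
      then show ?thesis using m_simps(1) False by linarith
    qed
    ultimately show ?thesis using m_simps(2) by simp
  qed
  have "(\<integral>\<^sup>+f. ennreal (weight_density f) \<partial>lborel_PiM {..<m}) =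
      ennreal (1 ^ (p + (\<Sum>i\<in>{..<m}. c i + 1)) / fact (p + (\<Sum>i\<in>{..<m}. c i + 1)))"
    unfolding weight_density_def weights_pos_iff wp by (rule dirichlet_integral) (auto simp: c_def)
  then show ?thesis unfolding expo by simp
qed

text \<open>In the coordinates of the parametrization the modulus of the Jacobian determinant is a product of a
  function of the weights and a function of the nodes, and the domain is the product of a simplex
  and a chamber. Tonelli's theorem separates the integrals.\<close>
lemma volume_product:
  "measure lebesgue (convex hull (\<gamma> ` {a..b})) =
    (LINT f|lborel_PiM {m..<CARD('n)}. node_density f) / fact CARD('n)"
proof -
  let ?n = "CARD('n)"
  let ?J = "\<lambda>v :: real^'n::_. weight_prod (par v) * (shuffle_sign * coeff_det (par v))"
  have par_meas: "(\<lambda>v :: real^'n::_. par v i) \<in> borel_measurable borel" for i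
    unfolding par_def by (intro borel_measurable_continuous_onI continuous_intros)
  have F: "indicator D v * ?J v = weight_density (par v) * node_density (par v)" for v
    by (auto simp: weight_density_def node_density_def weights_pos_def open_dom_iff indicator_def)
  have meas: "(\<lambda>v. indicator D v * ?J v) \<in> borel_measurable borel"
    unfolding F by (intro borel_measurable_times measurable_weight_density measurable_node_density par_meas)
  have "measure lebesgue (convex hull (\<gamma> ` {a..b})) = measure lebesgue (U ` D)" by (rule measure_hull_eq_image)
  also have "\<dots> = (LINT v|lborel. indicator D v * ?J v)"
  proof (rule lebesgue_jacobian_integral[symmetric, OF bij_betw_coord open_D _ measure_hull_eq_image(2) inj_on_U])
    show "open (U ` D)" unfolding U_image by simp
    show "(U has_derivative U' v) (at v)" if "v \<in> D" for v by (rule U_has_derivative[OF that])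
    fix v :: "real^'n::_" assume v: "v \<in> D"
    have "weight_prod (par v) \<ge> 0" "shuffle_sign * coeff_det (par v) \<ge> 0"
      using weight_density_nonneg[of "par v"] node_density_nonneg[of "par v"] v
      unfolding weight_density_def node_density_def weights_pos_def open_dom_iff by auto
    then have "?J v = \<bar>?J v\<bar>" by simp
    also have "\<dots> = \<bar>weight_prod (par v) * coeff_det (par v)\<bar>" by (simp add: abs_mult shuffle_sign_def power_abs)
    finally show "?J v = \<bar>dets (map (\<lambda>j i. U' v (axis (coord j) 1) $ coord i) [0..<?n])\<bar>"
      unfolding jacobian_det .
  qed (rule meas)
  also have "\<dots> = (LINT f|lborel_PiM {..<?n}. weight_density f * node_density f)"
  proof -
    let ?v = "\<lambda>f :: nat \<Rightarrow> real. (\<chi> i :: 'n. f (inv_into {..<?n} coord i))"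
    have par_v: "par (?v f) j = f j" if "j < ?n" for f j
      using bij_betw_inv_into_left[OF bij_betw_coord[where 'n = 'n], of j] that by (simp add: par_def)
    have mv: "?v \<in> measurable (lborel_PiM {..<?n}) borel"
    proof -
      have "inv_into {..<?n} coord i < ?n" for i :: 'n
        using bij_betw_apply[OF bij_betw_inv_into[OF bij_betw_coord[where 'n = 'n]], of i] by simp
      then have "(\<lambda>f. ?v f \<bullet> d) \<in> borel_measurable (lborel_PiM {..<?n})" if "d \<in> Basis" for d
        using that by (auto simp: Basis_vec_def cart_eq_inner_axis[symmetric] intro!: measurable_coordinate)
      then show ?thesis unfolding borel_measurable_euclidean_space[of ?v] by blast
    qed
    have "(LINT v|lborel. indicator D v * ?J v) =
        (LINT f|lborel_PiM {..<?n}. indicator D (?v f) * ?J (?v f))"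
      unfolding lborel_eq_distr_PiM[OF bij_betw_coord[where 'n = 'n]]
      by (rule integral_distr[OF mv meas])
    also have "\<dots> = (LINT f|lborel_PiM {..<?n}. weight_density f * node_density f)"
    proof (rule Bochner_Integration.integral_cong[OF refl])
      fix f :: "nat \<Rightarrow> real"
      have "weight_density (par (?v f)) = weight_density f"
        unfolding weight_density_def using weights_pos_cong[of "par (?v f)" f] weight_prod_cong[of "par (?v f)" f] par_v m_simps
        by simp
      moreover have "node_density (par (?v f)) = node_density f"
        unfolding node_density_def coeff_det_eq_column_det
        using chamber_cong[of "par (?v f)" f] column_det_cong[of "par (?v f)" f \<gamma> \<gamma> \<gamma>' \<gamma>'] par_v m_simps
        by simp
      ultimately show "indicator D (?v f) * ?J (?v f) = weight_density f * node_density f"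
        unfolding F by simp
    qed
    finally show ?thesis .
  qed
  also have "\<dots> = enn2real (\<integral>\<^sup>+f. ennreal (weight_density f * node_density f) \<partial>lborel_PiM {..<?n})"
    by (rule integral_eq_nn_integral)
       (use weight_density_nonneg node_density_nonneg m_simps in \<open>auto intro!: borel_measurable_times
          measurable_weight_density measurable_node_density measurable_coordinate AE_I2\<close>)
  also have "(\<integral>\<^sup>+f. ennreal (weight_density f * node_density f) \<partial>lborel_PiM {..<?n}) =
      (\<integral>\<^sup>+f. ennreal (weight_density f) \<partial>lborel_PiM {..<m}) * (\<integral>\<^sup>+f. ennreal (node_density f) \<partial>lborel_PiM {m..<?n})"
  proof -
    have un: "{..<?n} = {..<m} \<union> {m..<?n}" using m_simps by auto
    have mB: "(\<lambda>f. ennreal (node_density f)) \<in> borel_measurable (lborel_PiM {m..<?n})"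
      using m_simps by (auto intro!: measurable_compose[OF _ measurable_ennreal] measurable_node_density measurable_coordinate)
    have mA: "(\<lambda>f. ennreal (weight_density f)) \<in> borel_measurable (lborel_PiM {..<m})"
      by (auto intro!: measurable_compose[OF _ measurable_ennreal] measurable_weight_density measurable_coordinate)
    have mAB: "(\<lambda>f. ennreal (weight_density f * node_density f)) \<in> borel_measurable (lborel_PiM ({..<m} \<union> {m..<?n}))"
      using m_simps
      by (auto intro!: measurable_compose[OF _ measurable_ennreal] borel_measurable_times
          measurable_weight_density measurable_node_density measurable_coordinate)
    have "(\<integral>\<^sup>+f. ennreal (weight_density f * node_density f) \<partial>lborel_PiM {..<?n}) =
        (\<integral>\<^sup>+x. (\<integral>\<^sup>+y. ennreal (weight_density (merge {..<m} {m..<?n} (x, y)) *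
            node_density (merge {..<m} {m..<?n} (x, y))) \<partial>lborel_PiM {m..<?n}) \<partial>lborel_PiM {..<m})"
      unfolding un by (rule lborel_product.product_nn_integral_fold[OF _ _ _ mAB]) auto
    also have "\<dots> = (\<integral>\<^sup>+x. (\<integral>\<^sup>+y. ennreal (weight_density x) * ennreal (node_density y)
        \<partial>lborel_PiM {m..<?n}) \<partial>lborel_PiM {..<m})"
    proof (intro nn_integral_cong)
      fix x y :: "nat \<Rightarrow> real"
      let ?f = "merge {..<m} {m..<?n} (x, y)"
      have "weight_density ?f = weight_density x"
        unfolding weight_density_def using weights_pos_cong[of ?f x] weight_prod_cong[of ?f x]
        by (simp add: merge_def)
      moreover have "node_density ?f = node_density y"
        unfolding node_density_def coeff_det_eq_column_det
        using chamber_cong[of ?f y] column_det_cong[of ?f y \<gamma> \<gamma> \<gamma>' \<gamma>'] m_simps by (simp add: merge_def)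
      ultimately show "ennreal (weight_density ?f * node_density ?f) = ennreal (weight_density x) * ennreal (node_density y)"
        by (simp add: ennreal_mult weight_density_nonneg node_density_nonneg)
    qed
    also have "\<dots> = (\<integral>\<^sup>+x. ennreal (weight_density x) * (\<integral>\<^sup>+y. ennreal (node_density y) \<partial>lborel_PiM {m..<?n}) \<partial>lborel_PiM {..<m})"
      using mB by (simp add: nn_integral_cmult)
    also have "\<dots> = (\<integral>\<^sup>+f. ennreal (weight_density f) \<partial>lborel_PiM {..<m}) * (\<integral>\<^sup>+f. ennreal (node_density f) \<partial>lborel_PiM {m..<?n})"
      using mA by (rule nn_integral_multc)
    finally show ?thesis .
  qed
  also have "enn2real \<dots> = 1 / fact ?n * enn2real (\<integral>\<^sup>+f. ennreal (node_density f) \<partial>lborel_PiM {m..<?n})"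
    unfolding weight_integral enn2real_mult by simp
  also have "enn2real (\<integral>\<^sup>+f. ennreal (node_density f) \<partial>lborel_PiM {m..<?n}) = (LINT f|lborel_PiM {m..<?n}. node_density f)"
    by (rule integral_eq_nn_integral[symmetric])
       (use node_density_nonneg m_simps in \<open>auto intro!: measurable_node_density measurable_coordinate AE_I2\<close>)
  finally show ?thesis by simp
qed

text \<open>The number \<open>lo\<close> is the first index of the variables of integration. The chamber and the set
  of ordered tuples differ by tuples in which a node coincides with an end point or with another node; these
  form a null set.\<close>
theorem volume_formula:
  "measure lebesgue (convex hull (\<gamma> ` {a..b})) = (-1) ^ (k * (k - 1) div 2) / fact CARD('n) *
    ordered_integral {lo..<lo + k} a b (\<lambda>x. coeff_det (\<lambda>i. x (lo + (i - m))))"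
proof -
  let ?n = "CARD('n)" and ?I = "{lo..<lo + k}"
  let ?t = "\<lambda>j. lo + (j - m)"
  have t: "bij_betw ?t {m..<?n} ?I"
    by (rule bij_betwI[where g = "\<lambda>i. m + (i - lo)"]) (use m_simps in auto)
  let ?T = "\<lambda>x. \<lambda>j\<in>{m..<?n}. x (?t j)" and ?f = "\<lambda>x i. x (?t i)"
  have mT: "?T \<in> measurable (lborel_PiM ?I) (lborel_PiM {m..<?n})"
  proof (rule measurable_restrict)
    fix j assume "j \<in> {m..<?n}"
    then have "?t j \<in> ?I" using t by (auto simp: bij_betw_def)
    then show "(\<lambda>x. x (?t j)) \<in> measurable (lborel_PiM ?I) lborel" using measurable_coordinate by simp
  qed
  have coord: "(\<lambda>x. ?f x (m + i)) \<in> borel_measurable (lborel_PiM ?I)" if "i < k" for i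
    using that by (auto intro!: measurable_coordinate)
  have nd: "(\<lambda>x. node_density (?f x)) \<in> borel_measurable (lborel_PiM ?I)"
    by (rule measurable_node_density) (rule coord)
  have "(LINT f|lborel_PiM {m..<?n}. node_density f) = (LINT f|distr (lborel_PiM ?I) (lborel_PiM {m..<?n}) ?T. node_density f)"
    using PiM_reindex[OF _ t] by simp
  also have "\<dots> = (LINT x|lborel_PiM ?I. node_density (?T x))"
    using mT m_simps by (intro integral_distr) (auto intro!: measurable_node_density measurable_coordinate)
  also have "\<dots> = (LINT x|lborel_PiM ?I. node_density (?f x))"
  proof (rule Bochner_Integration.integral_cong[OF refl])
    fix x :: "nat \<Rightarrow> real"
    show "node_density (?T x) = node_density (?f x)"
      unfolding node_density_def coeff_det_eq_column_det
      using chamber_cong[of "?T x" "?f x"] column_det_cong[of "?T x" "?f x" \<gamma> \<gamma> \<gamma>' \<gamma>'] m_simps by simp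
  qed
  also have "\<dots> = (LINT x|lborel_PiM ?I. shuffle_sign * (indicator (ordered_tuples ?I a b) x * coeff_det (?f x)))"
  proof (rule integral_cong_AE)
    show "(\<lambda>x. node_density (?f x)) \<in> borel_measurable (lborel_PiM ?I)" by (rule nd)
    have [measurable]: "Measurable.pred (lborel_PiM ?I) (\<lambda>x. x \<in> ordered_tuples ?I a b)"
    proof -
      have range: "Measurable.pred (lborel_PiM ?I) (\<lambda>x. a \<le> x i \<and> x i \<le> b)" if "i \<in> ?I" for i
      proof -
        note [measurable] = measurable_coordinate[OF that]
        show ?thesis by measurable
      qed
      have le: "Measurable.pred (lborel_PiM ?I) (\<lambda>x. i \<le> j \<longrightarrow> x i \<le> x j)" if "i \<in> ?I" "j \<in> ?I" for i j
      proof -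
        have "Measurable.pred (lborel_PiM ?I) (\<lambda>x. x i \<le> x j)"
          unfolding pred_def by (rule borel_measurable_le[OF that[THEN measurable_coordinate]])
        then show ?thesis by (cases "i \<le> j") simp_all
      qed
      show ?thesis
        unfolding ordered_tuples_def mem_Collect_eq
        by (intro pred_intros_logic(3) pred_intros_finite(3) range le) auto
    qed
    note [measurable] = measurable_column_det[of ?f "lborel_PiM ?I", OF coord measurable_ext]
    have "indicator (ordered_tuples ?I a b) x * coeff_det (?f x) =
        of_bool (x \<in> ordered_tuples ?I a b) * column_det curve_ext deriv_ext (?f x)" for x
    proof (cases "x \<in> ordered_tuples ?I a b")
      case True
      then have x: "?f x (m + i) \<in> {a..b}" if "i < k" for i using that by (auto simp: ordered_tuples_def)
      have "node (?f x) j \<in> {a..b}" if "j \<le> m" for j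
        using that by (cases rule: node_cases) (use x q_end[of j] a_less_b in auto)
      then show ?thesis
        unfolding coeff_det_eq_column_det
        using column_det_cong[of "?f x" "?f x" \<gamma> curve_ext \<gamma>' deriv_ext] ext_eq x by auto
    qed simp
    then show "(\<lambda>x. shuffle_sign * (indicator (ordered_tuples ?I a b) x * coeff_det (?f x))) \<in> borel_measurable (lborel_PiM ?I)"
      by simp
    have "AE x in lborel_PiM ?I. \<forall>i\<in>?I. x i \<noteq> a \<and> x i \<noteq> b \<and> (\<forall>j\<in>?I. i \<noteq> j \<longrightarrow> x i \<noteq> x j)"
    proof (intro AE_finite_allI AE_conjI)
      fix i assume i: "i \<in> ?I"
      show "AE x in lborel_PiM ?I. x i \<noteq> a" "AE x in lborel_PiM ?I. x i \<noteq> b"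
        using i by (auto intro!: AE_coordinate_neq)
      fix j assume j: "j \<in> ?I"
      show "AE x in lborel_PiM ?I. i \<noteq> j \<longrightarrow> x i \<noteq> x j"
      proof (cases "i = j")
        case False
        have "AE x in lborel_PiM ?I. x i \<noteq> x j"
          using i j False by (intro AE_coordinate_neq measurable_coordinate) auto
        then show ?thesis by eventually_elim simp
      qed simp
    qed auto
    then show "AE x in lborel_PiM ?I. node_density (?f x) = shuffle_sign * (indicator (ordered_tuples ?I a b) x * coeff_det (?f x))"
    proof eventually_elim
      fix x assume x: "\<forall>i\<in>?I. x i \<noteq> a \<and> x i \<noteq> b \<and> (\<forall>j\<in>?I. i \<noteq> j \<longrightarrow> x i \<noteq> x j)"
      have "x \<in> ordered_tuples ?I a b \<longleftrightarrow> chamber (?f x)"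
      proof
        assume o: "x \<in> ordered_tuples ?I a b"
        have "a < x (lo + i) \<and> x (lo + i) < b" if "i < k" for i
        proof -
          have "lo + i \<in> ?I" using that by simp
          then show ?thesis using o x unfolding ordered_tuples_def by (force simp: less_le)
        qed
        moreover have "x (lo + i) < x (lo + Suc i)" if "Suc i < k" for i
        proof -
          have i: "lo + i \<in> ?I" "lo + Suc i \<in> ?I" using that by auto
          then have "x (lo + i) \<le> x (lo + Suc i)" using o unfolding ordered_tuples_def by auto
          moreover have "x (lo + i) \<noteq> x (lo + Suc i)" using x i by (metis add_left_cancel n_not_Suc_n)
          ultimately show ?thesis by simp
        qed
        ultimately show "chamber (?f x)" unfolding chamber_def by simp
      next
        assume ch: "chamber (?f x)"
        have le: "x (lo + i) \<le> x (lo + j)" if "i \<le> j" "j < k" for i j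
          using chamber_strict_mono[OF ch, of i j] that by (cases "i = j") auto
        have "x i \<le> x j" if "i \<in> ?I" "j \<in> ?I" "i \<le> j" for i j
          using le[of "i - lo" "j - lo"] that by auto
        moreover have "a \<le> x i \<and> x i \<le> b" if "i \<in> ?I" for i
          using ch that unfolding chamber_def by (auto simp: le_iff_add less_imp_le)
        ultimately show "x \<in> ordered_tuples ?I a b" unfolding ordered_tuples_def by auto
      qed
      then show "node_density (?f x) = shuffle_sign * (indicator (ordered_tuples ?I a b) x * coeff_det (?f x))"
        by (simp add: node_density_def indicator_def)
    qed
  qed
  also have "\<dots> = shuffle_sign * ordered_integral ?I a b (\<lambda>x. coeff_det (?f x))"
    unfolding ordered_integral_def set_lebesgue_integral_def by simp
  finally show ?thesis unfolding volume_product shuffle_sign_def by simp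
qed

end

section \<open>Curves with totally positive torsion\<close>

lemma pick_lessThan: "i < k \<Longrightarrow> pick {..<k} i = i"
proof (induction i)
  case (Suc i)
  then have "pick {..<k} (Suc i) = (LEAST a. a < k \<and> a > i)" by simp
  also have "\<dots> = Suc i" using Suc.prems by (intro Least_equality) auto
  finally show ?case .
qed (auto intro: Least_equality)

lemma det_mat_with_cols:
  fixes vs :: "(real^'n::{finite,linorder}) list"
  assumes "length vs = CARD('n)"
  shows "Determinant.det (mat_with_cols vs) = dets (map (\<lambda>v r. v $ coord r) vs)"
  unfolding dets_def mat_with_cols_def using assms
  by (intro arg_cong[of _ _ Determinant.det] eq_matI) auto

text \<open>The leading principal minors of the torsion matrix are the Wronskians of the first derivatives of the
  coordinate functions.\<close>
lemma det_leading_minor: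
  fixes \<gamma> :: "real \<Rightarrow> real^'n::{finite,linorder}"
  assumes "k \<le> CARD('n)"
  shows "Determinant.det (submatrix (torsion_matrix \<gamma> t) {..<k} {..<k}) =
    dets (map (\<lambda>j i. nth_vector_derivative (Suc j) \<gamma> t $ coord i) [0..<k])"
proof -
  let ?A = "torsion_matrix \<gamma> t"
  have dimA: "dim_row ?A = CARD('n)" "dim_col ?A = CARD('n)"
    by (simp_all add: torsion_matrix_def mat_with_cols_def)
  have set: "{i. i < CARD('n) \<and> i \<in> {..<k}} = {..<k}" using assms by auto
  have entry: "?A $$ (i, j) = nth_vector_derivative (Suc j) \<gamma> t $ coord i" if "i < k" "j < k" for i j
  proof -
    have "map (\<lambda>j. nth_vector_derivative j \<gamma> t) [1..<Suc CARD('n)] ! j = nth_vector_derivative (Suc j) \<gamma> t"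
      using that assms by (subst nth_map) (auto simp del: upt_Suc simp: nth_upt)
    then show ?thesis
      using that assms by (simp add: torsion_matrix_def mat_with_cols_def del: upt_Suc)
  qed
  have "submatrix ?A {..<k} {..<k} = Matrix.mat k k (\<lambda>(i, j). ?A $$ (i, j))"
    unfolding submatrix_def dimA set by (rule eq_matI) (auto simp: pick_lessThan)
  also have "\<dots> = Matrix.mat k k (\<lambda>(i, j). nth_vector_derivative (Suc j) \<gamma> t $ coord i)"
    by (rule eq_matI) (auto simp: entry)
  finally show ?thesis
    unfolding dets_def by (auto intro!: arg_cong[of _ _ Determinant.det] eq_matI)
qed

lemma nth_vector_derivative_simps:
  "nth_vector_derivative 0 f = f"
  "nth_vector_derivative (Suc k) f t = vector_derivative (nth_vector_derivative k f) (at t)"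
  by (simp_all add: nth_vector_derivative_def)

lemma chebyshev_curve_of_torsion:
  fixes \<gamma> :: "real \<Rightarrow> real^'n::{finite,linorder}"
  assumes ab: "a < b" and cont: "continuous_on {a..b} \<gamma>" and C: "C_k_on CARD('n) \<gamma> {a<..<b}"
    and torsion: "totally_positive_torsion \<gamma> a b"
  shows "chebyshev_curve \<gamma> (\<lambda>t. vector_derivative \<gamma> (at t)) a b"
proof
  let ?N = "\<lambda>k. nth_vector_derivative k \<gamma>" and ?n = "CARD('n)"
  have n: "?n > 0" by simp
  have der: "(?N k has_vector_derivative ?N (Suc k) t) (at t)" if "k < ?n" "t \<in> {a<..<b}" for k t
    using C that unfolding C_k_on_def nth_vector_derivative_simps by (simp add: vector_derivative_works)
  have der_coord: "((\<lambda>t. ?N k t $ i) has_real_derivative ?N (Suc k) t $ i) (at t)"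
    if "k < ?n" "t \<in> {a<..<b}" for k t i
    unfolding has_real_derivative_iff_has_vector_derivative
    by (rule bounded_linear.has_vector_derivative[OF bounded_linear_vec_nth der[OF that]])
  have N1: "?N 1 t = vector_derivative \<gamma> (at t)" for t
    unfolding One_nat_def nth_vector_derivative_simps ..
  show "(\<gamma> has_vector_derivative vector_derivative \<gamma> (at t)) (at t)" if "t \<in> {a<..<b}" for t
    using der[OF n that] N1[of t] by (simp add: nth_vector_derivative_simps(1))
  show "continuous_on {a<..<b} (\<lambda>t. vector_derivative \<gamma> (at t))"
  proof -
    have "1 \<le> ?n" using n by linarith
    then have "continuous_on {a<..<b} (?N 1)" using C unfolding C_k_on_def by blast
    moreover have "?N 1 = (\<lambda>t. vector_derivative \<gamma> (at t))" by (rule ext) (rule N1)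
    ultimately show ?thesis by (simp only:)
  qed
  fix ts assume ts: "length ts = Suc ?n" "sorted_wrt (<) ts" "set ts \<subseteq> {a..b}"
  show "dets (map (\<lambda>t. homog 1 (\<gamma> t)) ts) > 0"
  proof (rule dets_pos_of_derivative_pos[where u' = "\<lambda>t. homog 0 (?N 1 t)", OF _ _ _ _ ts])
    show "continuous_on {a..b} (\<lambda>t. homog 1 (\<gamma> t) i)" for i
      by (cases i) (auto intro!: continuous_intros cont)
    show "((\<lambda>t. homog 1 (\<gamma> t) i) has_real_derivative homog 0 (?N 1 t) i) (at t)" if "t \<in> {a<..<b}" for i t
      using der_coord[OF n that] by (cases i) (auto simp: nth_vector_derivative_simps(1))
  next
    fix ss assume ss: "length ss = ?n" "sorted_wrt (<) ss" "set ss \<subseteq> {a<..<b}"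
    have "dets (map (\<lambda>t i. (\<lambda>j i t. ?N (Suc j) t $ coord i) 0 i t) ss) > 0"
    proof (rule dets_pos_of_wronskians_pos[OF _ _ ss])
      fix k i t assume "Suc k < ?n" "t \<in> {a<..<b}"
      then show "((\<lambda>t. ?N (Suc k) t $ coord i) has_real_derivative ?N (Suc (Suc k)) t $ coord i) (at t)"
        by (rule der_coord)
    next
      fix k t assume k: "k \<le> ?n" and t: "t \<in> {a<..<b}"
      show "dets (map (\<lambda>j i. ?N (Suc j) t $ coord i) [0..<k]) > 0"
      proof (cases "k = 0")
        case True
        then show ?thesis by (simp add: dets_def)
      next
        case False
        then have "k \<in> {1..?n}" using k by auto
        then have "Determinant.det (submatrix (torsion_matrix \<gamma> t) {..<k} {..<k}) > 0"
          using torsion t unfolding totally_positive_torsion_def by blast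
        then show ?thesis unfolding det_leading_minor[OF k] .
      qed
    qed
    then show "dets (map (\<lambda>s r. homog 0 (?N 1 s) (Suc r)) ss) > 0" by simp
  qed simp
qed (rule ab cont)+

lemma (in principal_parametrization) coeff_det_mat_with_cols:
  "coeff_det f = Determinant.det (mat_with_cols
    (map (\<lambda>j. \<gamma> (node f (Suc j)) - \<gamma> (node f 0)) [0..<m] @ map (\<lambda>i. \<gamma>' (f (m + i))) [0..<k]))"
  by (subst det_mat_with_cols) (simp_all add: m_simps coeff_det_def o_def)

theorem corollary2p7:
  fixes \<gamma> :: "real \<Rightarrow> real^'n::{finite,linorder}" and a b :: real and l :: nat
  assumes "a < b"
    and "continuous_on {a..b} \<gamma>"
    and "C_k_on CARD('n) \<gamma> {a<..<b}"
    and "totally_positive_torsion \<gamma> a b"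
  shows
    "(CARD('n) = 2 * l \<longrightarrow>
        measure lebesgue (convex hull (\<gamma> ` {a..b})) =
          (-1) ^ (l * (l - 1) div 2) / fact (2 * l) *
          ordered_integral {1..l} a b (\<lambda>x. Determinant.det (mat_with_cols (
            map (\<lambda>i. \<gamma> (x i) - \<gamma> a) [1..<Suc l] @
            map (\<lambda>i. vector_derivative \<gamma> (at (x i))) [1..<Suc l]))) \<and>
        measure lebesgue (convex hull (\<gamma> ` {a..b})) =
          (-1) ^ (l * (l - 1) div 2) / fact (2 * l) *
          ordered_integral {1..l} a b (\<lambda>x. Determinant.det (mat_with_cols (
            map (\<lambda>i. \<gamma> (x i) - \<gamma> b) [1..<Suc l] @
            map (\<lambda>i. vector_derivative \<gamma> (at (x i))) [1..<Suc l])))) \<and>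
     (l \<ge> 1 \<and> CARD('n) = 2 * l - 1 \<longrightarrow>
        measure lebesgue (convex hull (\<gamma> ` {a..b})) =
          (-1) ^ ((l - 1) * (l - 2) div 2) / fact (2 * l - 1) *
          ordered_integral {2..l} a b (\<lambda>x. Determinant.det (mat_with_cols (
            [\<gamma> b - \<gamma> a] @
            map (\<lambda>i. \<gamma> (x i) - \<gamma> a) [2..<Suc l] @
            map (\<lambda>i. vector_derivative \<gamma> (at (x i))) [2..<Suc l]))) \<and>
        measure lebesgue (convex hull (\<gamma> ` {a..b})) =
          (-1) ^ (l * (l - 1) div 2) / fact (2 * l - 1) *
          ordered_integral {1..l} a b (\<lambda>x. Determinant.det (mat_with_cols (
            map (\<lambda>i. \<gamma> (x i) - \<gamma> (x 1)) [2..<Suc l] @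
            map (\<lambda>i. vector_derivative \<gamma> (at (x i))) [1..<Suc l]))))"
proof -
  define \<gamma>' where "\<gamma>' = (\<lambda>t. vector_derivative \<gamma> (at t))"
  interpret chebyshev_curve \<gamma> \<gamma>' a b
    unfolding \<gamma>'_def by (rule chebyshev_curve_of_torsion[OF assms])
  let ?V = "measure lebesgue (convex hull (\<gamma> ` {a..b}))"
  have one: "?V = (-1) ^ (l * (l - 1) div 2) / fact CARD('n) *
      ordered_integral {1..l} a b (\<lambda>x. Determinant.det (mat_with_cols (
        map (\<lambda>i. \<gamma> (x i) - \<gamma> c) [1..<Suc l] @ map (\<lambda>i. \<gamma>' (x i)) [1..<Suc l])))"
    if n: "CARD('n) = 2 * l" and c: "c \<in> {a, b}" for c
  proof -
    interpret P: principal_parametrization \<gamma> \<gamma>' a b l 1 "\<lambda>_. c"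
      by standard (use n c in auto)
    have "map (\<lambda>j. \<gamma> (P.node f (Suc j)) - \<gamma> (P.node f 0)) [0..<P.m] @ map (\<lambda>i. \<gamma>' (f (P.m + i))) [0..<l] =
        map (\<lambda>i. \<gamma> (x i) - \<gamma> c) [1..<Suc l] @ map (\<lambda>i. \<gamma>' (x i)) [1..<Suc l]"
      if "f = (\<lambda>i. x (1 + (i - P.m)))" for f x
      unfolding that P.m_def P.node_def by (rule nth_equalityI) (auto simp: nth_append simp del: upt_Suc)
    moreover have "{1..<1 + l} = {1..l}" by auto
    ultimately show ?thesis
      using P.volume_formula[of 1] unfolding P.coeff_det_mat_with_cols by (simp del: upt_Suc)
  qed
  have two: "?V = (-1) ^ ((l - 1) * (l - 2) div 2) / fact CARD('n) *
      ordered_integral {2..l} a b (\<lambda>x. Determinant.det (mat_with_cols (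
        [\<gamma> b - \<gamma> a] @ map (\<lambda>i. \<gamma> (x i) - \<gamma> a) [2..<Suc l] @ map (\<lambda>i. \<gamma>' (x i)) [2..<Suc l])))"
    if n: "l \<ge> 1" "CARD('n) = 2 * l - 1"
  proof -
    interpret P: principal_parametrization \<gamma> \<gamma>' a b "l - 1" 2 "\<lambda>i. if i = 0 then a else b"
      by standard (use n a_less_b in auto)
    have m: "P.m = l" using n unfolding P.m_def by simp
    have "map (\<lambda>j. \<gamma> (P.node f (Suc j)) - \<gamma> (P.node f 0)) [0..<P.m] @ map (\<lambda>i. \<gamma>' (f (P.m + i))) [0..<l - 1] =
        [\<gamma> b - \<gamma> a] @ map (\<lambda>i. \<gamma> (x i) - \<gamma> a) [2..<Suc l] @ map (\<lambda>i. \<gamma>' (x i)) [2..<Suc l]"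
      if "f = (\<lambda>i. x (2 + (i - P.m)))" for f x
      unfolding that P.node_def m using n
      by (intro nth_equalityI) (auto simp: nth_append nth_Cons' simp del: upt_Suc)
    moreover have "{2..<2 + (l - 1)} = {2..l}" using n by auto
    moreover have "l - 1 - 1 = l - 2" by simp
    ultimately show ?thesis
      using P.volume_formula[of 2] unfolding P.coeff_det_mat_with_cols by (simp del: upt_Suc)
  qed
  have three: "?V = (-1) ^ (l * (l - 1) div 2) / fact CARD('n) *
      ordered_integral {1..l} a b (\<lambda>x. Determinant.det (mat_with_cols (
        map (\<lambda>i. \<gamma> (x i) - \<gamma> (x 1)) [2..<Suc l] @ map (\<lambda>i. \<gamma>' (x i)) [1..<Suc l])))"
    if n: "l \<ge> 1" "CARD('n) = 2 * l - 1"
  proof -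
    interpret P: principal_parametrization \<gamma> \<gamma>' a b l 0 "\<lambda>_. a"
      by standard (use n in auto)
    have m: "P.m = l - 1" unfolding P.m_def by simp
    have "map (\<lambda>j. \<gamma> (P.node f (Suc j)) - \<gamma> (P.node f 0)) [0..<P.m] @ map (\<lambda>i. \<gamma>' (f (P.m + i))) [0..<l] =
        map (\<lambda>i. \<gamma> (x i) - \<gamma> (x 1)) [2..<Suc l] @ map (\<lambda>i. \<gamma>' (x i)) [1..<Suc l]"
      if "f = (\<lambda>i. x (1 + (i - P.m)))" for f x
      unfolding that P.node_def m using n
      by (intro nth_equalityI) (auto simp: nth_append simp del: upt_Suc)
    moreover have "{1..<1 + l} = {1..l}" by auto
    ultimately show ?thesis
      using P.volume_formula[of 1] unfolding P.coeff_det_mat_with_cols by (simp del: upt_Suc)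
  qed
  show ?thesis
    using one[of a] one[of b] two three unfolding \<gamma>'_def by auto
qed

end
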